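(* Suppose that $\mathcal F$ and $\mathcal G$ are convex and $d_1$-Lipschitz on $\mathcal P(\mathbb T^d)$, and that $H\in C^2(\mathbb T^d\times\mathbb R^d)$ satisfies, for some constant $C_0\ge1$ and all $(x,p)\in\mathbb T^d\times\mathbb R^d$, $\frac1{C_0}I_{d\times d}\le D^2_{pp}H(x,p)\le C_0I_{d\times d}$ and $|D_xH(x,p)|\le C_0(1+|p|)$. Then $$U(t,m^N_{\boldsymbol x})\le V^N(t,\boldsymbol x)$$ for all $N\in\mathbb N$ and $(t,\boldsymbol x)\in[0,T]\times(\mathbb T^d)^N$.
   Context: $\mathbb T^d=\mathbb R^d/\mathbb Z^d$; $\mathcal P(\mathbb T^d)$ is the set of Borel probability measures on $\mathbb T^d$, with the distance $d_1(m_1,m_2)=\sup\{\int g\,d(m_1-m_2): g \text{ 1-Lipschitz}\}$. For $\boldsymbol x\in(\mathbb T^d)^N$, $m^N_{\boldsymbol x}=\frac1N\sum_{i=1}^N\delta_{x^i}$. Convexity on $\mathcal P(\mathbb T^d)$ is with respect to linear interpolation of measures. Fix $T>0$ and a filtered probability space satisfying the usual conditions, with atomless initial $\sigma$-field, carrying independent $d$-dimensional Brownian motions $W,(W^i)_{i\in\mathbb N}$. The data are $\mathcal F,\mathcal G:\mathcal P(\mathbb T^d)\to\mathbb R$ and a Lagrangian $L:\mathbb T^d\times\mathbb R^d\to\mathbb R$, continuous and convex in its second variable; the Hamiltonian is $H(x,p)=\sup_{a\in\mathbb R^d}\{-L(x,a)-a\cdot p\}$. For $(t_0,\boldsymbol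 x_0)\in[0,T]\times(\mathbb T^d)^N$, $$V^N(t_0,\boldsymbol x_0)=\inf_{\boldsymbol\alpha}\mathbb E\Big[\int_{t_0}^T\Big(\frac1N\sum_{i=1}^NL(X^i_t,\alpha^i_t)+\mathcal F(m^N_{\boldsymbol X_t})\Big)dt+\mathcal G(m^N_{\boldsymbol X_T})\Big],$$ subject to $dX^i_t=\alpha^i_tdt+\sqrt2\,dW^i_t$, $X^i_{t_0}=x^i_0$ (viewed in $\mathbb T^d$), the infimum being over square-integrable progressively measurable $(\mathbb R^d)^N$-valued processes $\boldsymbol\alpha$. For $(t_0,m_0)\in[0,T]\times\mathcal P(\mathbb T^d)$, $$U(t_0,m_0)=\inf_{(m,\alpha)}\Big\{\int_{t_0}^T\Big(\int_{\mathbb T^d}L(x,\alpha(t,x))m_t(dx)+\mathcal F(m_t)\Big)dt+\mathcal G(m_T)\Big\},$$ the infimum being over pairs with $m\in C([t_0,T],(\mathcal P(\mathbb T^d),d_1))$ and $\alpha:[t_0,T]\times\mathbb T^d\to\mathbb R^d$ measurable with $\int_{t_0}^T\int|\alpha(t,x)|^2m_t(dx)dt<\infty$, satisfying in the distributional sense $\partial_tm_t=\Delta m_t-\mathrm{div}(m_t\alpha(t,\cdot))$, $m_{t_0}=m_0$. *)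

theory Defs
  imports "HOL-Probability.Probability"
begin

section \<open>The torus\<close>

definition int_equiv :: "real ^ 'n \<Rightarrow> real ^ 'n \<Rightarrow> bool" where
  "int_equiv x y \<longleftrightarrow> (\<forall>i. x $ i - y $ i \<in> \<int>)"

lemma equivp_int_equiv: "equivp (int_equiv :: real ^ 'n \<Rightarrow> _)"
proof (rule equivpI)
  show "reflp (int_equiv :: real ^ 'n \<Rightarrow> _)"
    by (auto simp: int_equiv_def reflp_def)
  show "symp (int_equiv :: real ^ 'n \<Rightarrow> _)"
    unfolding int_equiv_def symp_def by (metis Ints_minus minus_diff_eq)
  show "transp (int_equiv :: real ^ 'n \<Rightarrow> _)"
  proof (rule transpI)
    fix x y z :: "real ^ 'n"
    assume "int_equiv x y" "int_equiv y z"
    then have "(x $ i - y $ i) + (y $ i - z $ i) \<in> \<int>" for i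
      unfolding int_equiv_def by (intro Ints_add) auto
    then show "int_equiv x z" by (simp add: int_equiv_def)
  qed
qed

quotient_type 'n torus = "real ^ 'n::finite" / int_equiv
  morphisms torus_rep to_torus
  by (rule equivp_int_equiv)

lemma to_torus_eq_iff: "to_torus x = to_torus y \<longleftrightarrow> int_equiv x y"
  by (simp add: torus.abs_eq_iff)

lemma to_torus_rep [simp]: "to_torus (torus_rep x) = x"
  by (rule Quotient_abs_rep[OF Quotient_torus])

instantiation torus :: (finite) ab_group_add
begin

lift_definition zero_torus :: "'a torus" is 0 .

lift_definition plus_torus :: "'a torus \<Rightarrow> 'a torus \<Rightarrow> 'a torus" is "(+)"
  unfolding int_equiv_def by (simp add: add_diff_add)

lift_definition uminus_torus :: "'a torus \<Rightarrow> 'a torus" is uminus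
  unfolding int_equiv_def by (metis Ints_minus minus_diff_minus uminus_vec_def vec_lambda_beta)

definition minus_torus :: "'a torus \<Rightarrow> 'a torus \<Rightarrow> 'a torus" where
  "minus_torus x y = x + (- y)"

instance
proof
  fix a b c :: "'a torus"
  show "a + b + c = a + (b + c)" by transfer (simp add: int_equiv_def)
  show "a + b = b + a" by transfer (simp add: int_equiv_def)
  show "0 + a = a" by transfer (simp add: int_equiv_def)
  show "- a + a = 0" by transfer (simp add: int_equiv_def)
  show "a - b = a + - b" by (rule minus_torus_def)
qed

end

instantiation torus :: (finite) metric_space
begin

definition dist_torus :: "'a torus \<Rightarrow> 'a torus \<Rightarrow> real" where
  "dist_torus x y = Inf {norm (a - b) | a b. to_torus a = x \<and> to_torus b = y}"

definition uniformity_torus :: "('a torus \<times> 'a torus) filter" where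
  "uniformity_torus = (INF e\<in>{0 <..}. principal {(x, y). dist x y < e})"

definition open_torus :: "'a torus set \<Rightarrow> bool" where
  "open_torus U = (\<forall>x\<in>U. \<forall>\<^sub>F (x', y) in uniformity. x' = x \<longrightarrow> y \<in> U)"

instance
proof
  let ?D = "\<lambda>x y :: 'a torus. {norm (a - b) | a b. to_torus a = x \<and> to_torus b = y}"
  have bdd: "bdd_below (?D x y)" for x y
    by (rule bdd_belowI[of _ 0]) auto
  have ne: "?D x y \<noteq> {}" for x y
    using to_torus_rep by blast
  have low: "dist x y \<le> norm (a - b)" if "to_torus a = x" "to_torus b = y" for x y :: "'a torus" and a b
    unfolding dist_torus_def by (rule cInf_lower[OF _ bdd]) (use that in auto)
  have approx: "\<exists>a b. to_torus a = x \<and> to_torus b = y \<and> norm (a - b) < e"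
    if "dist x y < e" for x y :: "'a torus" and e
    using cInf_lessD[OF ne that[unfolded dist_torus_def]] by auto
  have nonneg: "0 \<le> dist x y" for x y :: "'a torus"
    unfolding dist_torus_def by (rule cInf_greatest[OF ne]) auto
  fix x y z :: "'a torus"
  show "dist x y = 0 \<longleftrightarrow> x = y"
  proof
    assume "x = y"
    then show "dist x y = 0"
      using low[of "torus_rep x" x "torus_rep x" y] nonneg[of x y] by auto
  next
    assume d0: "dist x y = 0"
    have "int_equiv (torus_rep x) (torus_rep y)"
      unfolding int_equiv_def
    proof (intro allI)
      fix i
      let ?v = "torus_rep x $ i - torus_rep y $ i"
      have "?v \<in> closure \<int>"
        unfolding closure_approachable
      proof (intro allI impI)
        fix e :: real assume "0 < e"
        then obtain a b where ab: "to_torus a = x" "to_torus b = y" "norm (a - b) < e"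
          using approx[of x y e] d0 by auto
        have "int_equiv (torus_rep x) a" "int_equiv b (torus_rep y)"
          using ab by (simp_all flip: to_torus_eq_iff)
        then have "(torus_rep x $ i - a $ i) + (b $ i - torus_rep y $ i) \<in> \<int>"
          unfolding int_equiv_def by (intro Ints_add) auto
        moreover have "dist ((torus_rep x $ i - a $ i) + (b $ i - torus_rep y $ i)) ?v < e"
          using component_le_norm_cart[of "a - b" i] ab(3) by (simp add: dist_real_def)
        ultimately show "\<exists>k\<in>\<int>. dist k ?v < e" by blast
      qed
      then show "?v \<in> \<int>" by (simp add: closed_Ints)
    qed
    then show "x = y" by (metis to_torus_eq_iff to_torus_rep)
  qed
  show "dist x y \<le> dist x z + dist y z"
  proof (rule field_le_epsilon)
    fix e :: real assume e: "0 < e"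
    obtain a b where ab: "to_torus a = x" "to_torus b = z" "norm (a - b) < dist x z + e / 2"
      using approx[of x z "dist x z + e / 2"] e by auto
    obtain c d where cd: "to_torus c = y" "to_torus d = z" "norm (c - d) < dist y z + e / 2"
      using approx[of y z "dist y z + e / 2"] e by auto
    have "int_equiv b d" using ab cd by (simp flip: to_torus_eq_iff)
    then have "to_torus (c + (b - d)) = y"
      using cd(1) by (simp add: to_torus_eq_iff int_equiv_def flip: cd(1))
    then have "dist x y \<le> norm (a - (c + (b - d)))" using low ab(1) by blast
    also have "a - (c + (b - d)) = (a - b) - (c - d)" by simp
    also have "norm \<dots> \<le> norm (a - b) + norm (c - d)" by (rule norm_triangle_ineq4)
    finally show "dist x y \<le> dist x z + dist y z + e" using ab(3) cd(3) by linarith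
  qed
qed (simp_all add: uniformity_torus_def open_torus_def)

end

section \<open>Differential calculus\<close>

text \<open>In finite dimension, continuity of the iterated directional derivatives is continuity of the
  corresponding Frechet derivative.\<close>

primrec cont_diff :: "nat \<Rightarrow> ('a::euclidean_space \<Rightarrow> real) \<Rightarrow> bool" where
  "cont_diff 0 f \<longleftrightarrow> continuous_on UNIV f"
| "cont_diff (Suc k) f \<longleftrightarrow> (\<forall>z. f differentiable (at z)) \<and>
     (\<forall>v. cont_diff k (\<lambda>z. frechet_derivative f (at z) v))"

definition smooth :: "('a::euclidean_space \<Rightarrow> real) \<Rightarrow> bool" where
  "smooth f \<longleftrightarrow> (\<forall>k. cont_diff k f)"

definition gradient :: "(real ^ 'n \<Rightarrow> real) \<Rightarrow> real ^ 'n \<Rightarrow> real ^ 'n" where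
  "gradient f x = (\<chi> i. frechet_derivative f (at x) (axis i 1))"

definition hessian_form :: "(real ^ 'n \<Rightarrow> real) \<Rightarrow> real ^ 'n \<Rightarrow> real ^ 'n \<Rightarrow> real ^ 'n \<Rightarrow> real" where
  "hessian_form f x v w = frechet_derivative (\<lambda>y. frechet_derivative f (at y) v) (at x) w"

definition laplacian :: "(real ^ 'n \<Rightarrow> real) \<Rightarrow> real ^ 'n \<Rightarrow> real" where
  "laplacian f x = (\<Sum>i\<in>UNIV. hessian_form f x (axis i 1) (axis i 1))"

text \<open>Derivatives of functions on the torus are those of the periodic lift; by periodicity the
  choice of the representative is immaterial.\<close>

definition torus_gradient :: "('n torus \<Rightarrow> real) \<Rightarrow> 'n torus \<Rightarrow> real ^ 'n" where
  "torus_gradient f x = gradient (\<lambda>y. f (to_torus y)) (torus_rep x)"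

definition torus_laplacian :: "('n::finite torus \<Rightarrow> real) \<Rightarrow> 'n::finite torus \<Rightarrow> real" where
  "torus_laplacian f x = laplacian (\<lambda>y. f (to_torus y)) (torus_rep x)"

section \<open>Probability measures on the torus\<close>

definition torus_probs :: "'n::finite torus measure set" where
  "torus_probs = {m. prob_space m \<and> sets m = sets borel}"

definition d1 :: "'n::finite torus measure \<Rightarrow> 'n::finite torus measure \<Rightarrow> real" where
  "d1 m1 m2 = (SUP g\<in>{g. 1-lipschitz_on UNIV g}. (\<integral>x. g x \<partial>m1) - (\<integral>x. g x \<partial>m2))"

definition mixture :: "real \<Rightarrow> 'n::finite torus measure \<Rightarrow> 'n::finite torus measure \<Rightarrow> 'n::finite torus measure" where
  "mixture \<theta> m1 m2 = measure_of UNIV (sets borel)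
     (\<lambda>A. ennreal (1 - \<theta>) * emeasure m1 A + ennreal \<theta> * emeasure m2 A)"

definition empirical :: "nat \<Rightarrow> (nat \<Rightarrow> 'n::finite torus) \<Rightarrow> 'n::finite torus measure" where
  "empirical N x = measure_of UNIV (sets borel)
     (\<lambda>A. ennreal (1 / real N) * (\<Sum>i<N. emeasure (return borel (x i)) A))"

lemma emeasure_mixture:
  assumes "m1 \<in> torus_probs" "m2 \<in> torus_probs" "A \<in> sets borel"
  shows "emeasure (mixture \<theta> m1 m2) A
    = ennreal (1 - \<theta>) * emeasure m1 A + ennreal \<theta> * emeasure m2 A"
proof (rule emeasure_measure_of[OF mixture_def])
  have s: "sets m1 = sets borel" "sets m2 = sets borel"
    using assms by (auto simp: torus_probs_def)
  let ?\<mu> = "\<lambda>A. ennreal (1 - \<theta>) * emeasure m1 A + ennreal \<theta> * emeasure m2 A"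
  show "countably_additive (sets (mixture \<theta> m1 m2)) ?\<mu>"
    unfolding countably_additive_def
  proof (intro allI impI)
    fix B :: "nat \<Rightarrow> _"
    assume "range B \<subseteq> sets (mixture \<theta> m1 m2)" "disjoint_family B"
    moreover have "sets (mixture \<theta> m1 m2) = sets borel"
      by (metis mixture_def sets.sets_measure_of_eq space_borel)
    ultimately show "(\<Sum>i. ?\<mu> (B i)) = ?\<mu> (\<Union> (range B))"
      by (subst suminf_add[symmetric]) (simp_all add: s suminf_emeasure)
  qed
  show "A \<in> sets (mixture \<theta> m1 m2)"
    using assms(3) by (metis mixture_def sets.sets_measure_of_eq space_borel)
qed (auto simp: positive_def)

lemma emeasure_empirical:
  assumes "A \<in> sets borel"
  shows "emeasure (empirical N x) A
    = ennreal (1 / real N) * (\<Sum>i<N. emeasure (return borel (x i)) A)"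
proof (rule emeasure_measure_of[OF empirical_def])
  let ?\<mu> = "\<lambda>A. ennreal (1 / real N) * (\<Sum>i<N. emeasure (return borel (x i)) A)"
  have s: "sets (empirical N x) = sets borel"
    by (metis empirical_def sets.sets_measure_of_eq space_borel)
  show "countably_additive (sets (empirical N x)) ?\<mu>"
    unfolding countably_additive_def
  proof (intro allI impI)
    fix B :: "nat \<Rightarrow> _"
    assume B: "range B \<subseteq> sets (empirical N x)" "disjoint_family B"
    have "(\<Sum>j. \<Sum>i<N. emeasure (return borel (x i)) (B j))
        = (\<Sum>i<N. \<Sum>j. emeasure (return borel (x i)) (B j))"
      by (rule suminf_sum) auto
    also have "\<dots> = (\<Sum>i<N. emeasure (return borel (x i)) (\<Union> (range B)))"
      using B by (intro sum.cong refl suminf_emeasure) (auto simp: s)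
    finally show "(\<Sum>j. ?\<mu> (B j)) = ?\<mu> (\<Union> (range B))"
      by simp
  qed
  show "A \<in> sets (empirical N x)" using assms s by simp
qed (auto simp: positive_def)

definition convex_on_probs :: "('n::finite torus measure \<Rightarrow> real) \<Rightarrow> bool" where
  "convex_on_probs F \<longleftrightarrow> (\<forall>m1\<in>torus_probs. \<forall>m2\<in>torus_probs. \<forall>\<theta>\<in>{0..1}.
     F (mixture \<theta> m1 m2) \<le> (1 - \<theta>) * F m1 + \<theta> * F m2)"

definition d1_lipschitz :: "('n::finite torus measure \<Rightarrow> real) \<Rightarrow> bool" where
  "d1_lipschitz F \<longleftrightarrow> (\<exists>K. \<forall>m1\<in>torus_probs. \<forall>m2\<in>torus_probs.
     \<bar>F m1 - F m2\<bar> \<le> K * d1 m1 m2)"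

section \<open>The probabilistic set-up\<close>

text \<open>Only the time interval \<open>[0,T]\<close> is constrained. The filtration is a family of measurable
  spaces; its own measures are irrelevant, probabilities are always taken under \<open>M\<close>.\<close>

definition (in prob_space) brownian_motion ::
    "(real \<Rightarrow> 'a measure) \<Rightarrow> real \<Rightarrow> (real \<Rightarrow> 'a \<Rightarrow> real ^ 'n) \<Rightarrow> bool" where
  "brownian_motion Filt T X \<longleftrightarrow>
     (\<forall>t\<in>{0..T}. X t \<in> borel_measurable (Filt t)) \<and>
     (AE \<omega> in M. X 0 \<omega> = 0) \<and>
     (AE \<omega> in M. continuous_on {0..T} (\<lambda>t. X t \<omega>)) \<and>
     (\<forall>s t. 0 \<le> s \<and> s < t \<and> t \<le> T \<longrightarrow>
        distributed M lborel (\<lambda>\<omega>. X t \<omega> - X s \<omega>)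
          (\<lambda>z. ennreal (\<Prod>i\<in>UNIV. normal_density 0 (sqrt (t - s)) (z $ i))) \<and>
        indep_set (sets (Filt s))
          {(\<lambda>\<omega>. X t \<omega> - X s \<omega>) -` A \<inter> space M | A. A \<in> sets borel})"

locale noise_basis = prob_space M for M :: "'w measure" +
  fixes T :: real
    and Filt :: "real \<Rightarrow> 'w measure"
    and W0 :: "real \<Rightarrow> 'w \<Rightarrow> real ^ 'n"
    and W :: "nat \<Rightarrow> real \<Rightarrow> 'w \<Rightarrow> real ^ 'n"
  assumes T_pos: "0 < T"
    and subalg: "\<And>t. t \<in> {0..T} \<Longrightarrow> subalgebra M (Filt t)"
    and filt_mono: "\<And>s t. 0 \<le> s \<Longrightarrow> s \<le> t \<Longrightarrow> t \<le> T \<Longrightarrow> sets (Filt s) \<subseteq> sets (Filt t)"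
    and filt_right_cont: "\<And>t. 0 \<le> t \<Longrightarrow> t < T \<Longrightarrow> sets (Filt t) = (\<Inter>s\<in>{t<..T}. sets (Filt s))"
    and filt_complete: "\<And>A Z. Z \<in> null_sets M \<Longrightarrow> A \<subseteq> Z \<Longrightarrow> A \<in> sets (Filt 0)"
    and atomless: "\<And>A. A \<in> sets (Filt 0) \<Longrightarrow> 0 < prob A \<Longrightarrow>
          \<exists>B\<in>sets (Filt 0). B \<subseteq> A \<and> 0 < prob B \<and> prob B < prob A"
    and brownian_W0: "brownian_motion Filt T W0"
    and brownian_W: "\<And>i. brownian_motion Filt T (W i)"
    and indep_noises: "indep_vars (\<lambda>_. \<Pi>\<^sub>M t\<in>{0..T}. borel)
          (\<lambda>j \<omega>. \<lambda>t\<in>{0..T}. (case j of None \<Rightarrow> W0 t \<omega> | Some i \<Rightarrow> W i t \<omega>))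
          (UNIV :: nat option set)"

section \<open>The N-particle control problem\<close>

text \<open>A configuration in the N-fold product of the torus is a sequence of which only the entries
  with index below \<open>N\<close> matter; the same holds for controls.\<close>

definition admissible_control ::
    "'w measure \<Rightarrow> (real \<Rightarrow> 'w measure) \<Rightarrow> real \<Rightarrow> nat \<Rightarrow> real
      \<Rightarrow> (nat \<Rightarrow> real \<Rightarrow> 'w \<Rightarrow> real ^ 'n) \<Rightarrow> bool" where
  "admissible_control M Filt T N t0 \<alpha> \<longleftrightarrow> (\<forall>i<N.
     (\<forall>t\<in>{t0..T}. (\<lambda>(s, \<omega>). \<alpha> i s \<omega>)
        \<in> borel_measurable (restrict_space borel {t0..t} \<Otimes>\<^sub>M Filt t)) \<and>
     (\<integral>\<^sup>+\<omega>. (\<integral>\<^sup>+t\<in>{t0..T}. ennreal ((norm (\<alpha> i t \<omega>))\<^sup>2) \<partial>lborel) \<partial>M) < \<infinity>)"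

text \<open>Since the noise is additive, the state equation is solved by direct integration.\<close>

definition state ::
    "(nat \<Rightarrow> real \<Rightarrow> 'w \<Rightarrow> real ^ 'n) \<Rightarrow> real \<Rightarrow> (nat \<Rightarrow> 'n torus)
      \<Rightarrow> (nat \<Rightarrow> real \<Rightarrow> 'w \<Rightarrow> real ^ 'n) \<Rightarrow> nat \<Rightarrow> real \<Rightarrow> 'w \<Rightarrow> 'n torus" where
  "state W t0 x0 \<alpha> i t \<omega> = x0 i + to_torus
     ((\<integral>s\<in>{t0..t}. \<alpha> i s \<omega> \<partial>lborel) + sqrt 2 *\<^sub>R (W i t \<omega> - W i t0 \<omega>))"

definition particle_cost ::
    "'w measure \<Rightarrow> real \<Rightarrow> (nat \<Rightarrow> real \<Rightarrow> 'w \<Rightarrow> real ^ 'n)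
      \<Rightarrow> ('n torus \<Rightarrow> real ^ 'n \<Rightarrow> real) \<Rightarrow> ('n torus measure \<Rightarrow> real) \<Rightarrow> ('n torus measure \<Rightarrow> real)
      \<Rightarrow> nat \<Rightarrow> real \<Rightarrow> (nat \<Rightarrow> 'n torus) \<Rightarrow> (nat \<Rightarrow> real \<Rightarrow> 'w \<Rightarrow> real ^ 'n) \<Rightarrow> real" where
  "particle_cost M T W L F G N t0 x0 \<alpha> =
     (let X = state W t0 x0 \<alpha> in
      \<integral>\<omega>. ((\<integral>t\<in>{t0..T}. ((1 / real N) * (\<Sum>i<N. L (X i t \<omega>) (\<alpha> i t \<omega>))
                 + F (empirical N (\<lambda>i. X i t \<omega>))) \<partial>lborel)
            + G (empirical N (\<lambda>i. X i T \<omega>))) \<partial>M)"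

definition V_value ::
    "'w measure \<Rightarrow> (real \<Rightarrow> 'w measure) \<Rightarrow> real \<Rightarrow> (nat \<Rightarrow> real \<Rightarrow> 'w \<Rightarrow> real ^ 'n)
      \<Rightarrow> ('n torus \<Rightarrow> real ^ 'n \<Rightarrow> real) \<Rightarrow> ('n torus measure \<Rightarrow> real) \<Rightarrow> ('n torus measure \<Rightarrow> real)
      \<Rightarrow> nat \<Rightarrow> real \<Rightarrow> (nat \<Rightarrow> 'n torus) \<Rightarrow> real" where
  "V_value M Filt T W L F G N t0 x0 =
     (INF \<alpha>\<in>{\<alpha>. admissible_control M Filt T N t0 \<alpha>}. particle_cost M T W L F G N t0 x0 \<alpha>)"

section \<open>The mean field control problem\<close>

definition test_function :: "real \<Rightarrow> real \<Rightarrow> (real \<Rightarrow> 'n::finite torus \<Rightarrow> real) \<Rightarrow> bool" where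
  "test_function t0 T \<phi> \<longleftrightarrow>
     smooth (\<lambda>(t, y). \<phi> t (to_torus y)) \<and>
     (\<exists>a b. t0 < a \<and> b < T \<and> (\<forall>t x. t \<notin> {a..b} \<longrightarrow> \<phi> t x = 0))"

text \<open>The initial condition is part of \<open>admissible_pair\<close>: it is meaningful pointwise since \<open>m\<close> is
  continuous in time.\<close>

definition fokker_planck ::
    "real \<Rightarrow> real \<Rightarrow> (real \<Rightarrow> 'n torus measure) \<Rightarrow> (real \<Rightarrow> 'n torus \<Rightarrow> real ^ 'n) \<Rightarrow> bool" where
  "fokker_planck t0 T m \<alpha> \<longleftrightarrow> (\<forall>\<phi>. test_function t0 T \<phi> \<longrightarrow>
     (\<integral>t\<in>{t0..T}. (\<integral>x. (deriv (\<lambda>s. \<phi> s x) t + torus_laplacian (\<phi> t) x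
         + \<alpha> t x \<bullet> torus_gradient (\<phi> t) x) \<partial>m t) \<partial>lborel) = 0)"

definition admissible_pair ::
    "real \<Rightarrow> real \<Rightarrow> 'n torus measure
      \<Rightarrow> (real \<Rightarrow> 'n torus measure) \<Rightarrow> (real \<Rightarrow> 'n torus \<Rightarrow> real ^ 'n) \<Rightarrow> bool" where
  "admissible_pair T t0 m0 m \<alpha> \<longleftrightarrow>
     (\<forall>t\<in>{t0..T}. m t \<in> torus_probs) \<and>
     (\<forall>t\<in>{t0..T}. ((\<lambda>s. d1 (m s) (m t)) \<longlongrightarrow> 0) (at t within {t0..T})) \<and>
     (\<lambda>(t, x). \<alpha> t x) \<in> borel_measurable (restrict_space borel {t0..T} \<Otimes>\<^sub>M borel) \<and>
     (\<integral>\<^sup>+t\<in>{t0..T}. (\<integral>\<^sup>+x. ennreal ((norm (\<alpha> t x))\<^sup>2) \<partial>m t) \<partial>lborel) < \<infinity> \<and>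
     fokker_planck t0 T m \<alpha> \<and> m t0 = m0"

definition mean_field_cost ::
    "real \<Rightarrow> ('n torus \<Rightarrow> real ^ 'n \<Rightarrow> real) \<Rightarrow> ('n torus measure \<Rightarrow> real) \<Rightarrow> ('n torus measure \<Rightarrow> real)
      \<Rightarrow> real \<Rightarrow> (real \<Rightarrow> 'n torus measure) \<Rightarrow> (real \<Rightarrow> 'n torus \<Rightarrow> real ^ 'n) \<Rightarrow> real" where
  "mean_field_cost T L F G t0 m \<alpha> =
     (\<integral>t\<in>{t0..T}. ((\<integral>x. L x (\<alpha> t x) \<partial>m t) + F (m t)) \<partial>lborel) + G (m T)"

definition U_value ::
    "real \<Rightarrow> ('n torus \<Rightarrow> real ^ 'n \<Rightarrow> real) \<Rightarrow> ('n torus measure \<Rightarrow> real) \<Rightarrow> ('n torus measure \<Rightarrow> real)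
      \<Rightarrow> real \<Rightarrow> 'n torus measure \<Rightarrow> real" where
  "U_value T L F G t0 m0 =
     (INF (m, \<alpha>)\<in>{(m, \<alpha>). admissible_pair T t0 m0 m \<alpha>}. mean_field_cost T L F G t0 m \<alpha>)"

section \<open>The Hamiltonian\<close>

text \<open>The supremum is taken in the extended reals, so this includes its finiteness.\<close>

definition is_hamiltonian ::
    "('n torus \<Rightarrow> real ^ 'n \<Rightarrow> real) \<Rightarrow> ('n torus \<Rightarrow> real ^ 'n \<Rightarrow> real) \<Rightarrow> bool" where
  "is_hamiltonian L H \<longleftrightarrow> (\<forall>x p. ereal (H x p) = (SUP a. ereal (- L x a - a \<bullet> p)))"

end

theory Submission
  imports Defs
begin

text \<open>Given an admissible control of the \<open>N\<close> particles, let \<open>m\<^sub>t\<close> be the expectation of the empirical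
  measure at time \<open>t\<close>, and let the feedback \<open>\<alpha>(t, x)\<close> be the conditional expectation of the control
  of a uniformly chosen particle, given its position \<open>x\<close> at time \<open>t\<close>. The Ito formula in mean says that
  \<open>(m, \<alpha>)\<close> solves the Fokker-Planck equation. Jensen's inequality, conditionally for \<open>L\<close> (written as a countable supremum of
  affine functions through \<open>H\<close>) and on the space of measures for \<open>F\<close> and \<open>G\<close>, shows that the mean
  field cost of \<open>(m, \<alpha>)\<close> is at most the cost of the particle control.

  The Ito formula is obtained without stochastic integrals: over a time step \<open>h\<close> a second order Taylor
  expansion has an error of order \<open>sqrt h\<close> times the increment of time plus energy, and these errors
  telescope to \<open>0\<close>.\<close>

section \<open>Analysis on the torus\<close>

text \<open>Several obstacles shape the proof. The feedback must be measurable jointly in time and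
  position, so its conditional expectation is formed once, on the product of time, particle index
  and probability space, given the pair of time and position; the weak equation and the costs only
  see it integrated over time. Convexity of \<open>F\<close> and \<open>G\<close> speaks of two
  measures at a time, and the set of measures carries no sigma-algebra here: measurability and
  Jensen's inequality are both reached by rounding positions to a finite net, so that the empirical
  measure takes finitely many values, while the \<open>d1\<close>-Lipschitz bound absorbs the
  rounding. The control is merely square integrable, so the expectation of a test function along a
  particle need not be differentiable at each instant; the defect over a short interval is instead
  compared with \<open>sqrt h\<close> times an additive function of the interval. Finally, the
  affine minorants of \<open>L\<close> range over a countable set of slopes because an inequality
  between conditional expectations holds only almost surely.\<close>

lemma dist_to_torus_le: "dist (to_torus a) (to_torus b) \<le> norm (a - b)"
  unfolding dist_torus_def by (rule cInf_lower) (auto intro!: bdd_belowI[of _ 0])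

lemma to_torus_add: "to_torus (a + b) = to_torus a + to_torus b"
  by (simp add: plus_torus.abs_eq)

lemma to_torus_shift: "(\<And>i. k $ i \<in> \<int>) \<Longrightarrow> to_torus (a + k) = to_torus a"
  by (simp add: to_torus_eq_iff int_equiv_def)

text \<open>The infimum defining the distance varies both representatives; translating a nearly
  optimal pair by the integer vector \<open>a - a'\<close> makes the prescribed \<open>a\<close> the
  first of them.\<close>

lemma dist_torus_lift:
  fixes y :: "'n::finite torus"
  assumes "dist (to_torus a) y < e"
  obtains b where "to_torus b = y" "norm (a - b) < e"
proof -
  have "{norm (a' - b) | a' b. to_torus a' = to_torus a \<and> to_torus b = y} \<noteq> {}"
    using to_torus_rep by blast
  from cInf_lessD[OF this assms[unfolded dist_torus_def]]
  obtain a' b where ab: "to_torus a' = to_torus a" "to_torus b = y" "norm (a' - b) < e"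
    by auto
  have "int_equiv a a'" using ab(1) to_torus_eq_iff by metis
  then have "to_torus (b + (a - a')) = to_torus b"
    by (intro to_torus_shift) (simp add: int_equiv_def)
  moreover have "norm (a - (b + (a - a'))) < e" using ab(3) by (simp add: algebra_simps)
  ultimately show ?thesis using that ab(2) by metis
qed

lemma continuous_to_torus: "continuous_on UNIV (to_torus :: real ^ 'n::finite \<Rightarrow> _)"
  unfolding continuous_on_iff
  by (metis dist_norm dist_to_torus_le order.strict_trans1 norm_minus_commute)

lemma measurable_to_torus [measurable]: "to_torus \<in> borel_measurable borel"
  by (rule borel_measurable_continuous_onI[OF continuous_to_torus])

text \<open>Points of the torus that are close to \<open>x\<close> have lifts close to
  \<open>torus_rep x\<close>, so continuity of the periodic lift descends to the quotient although
  \<open>torus_rep\<close> itself is an arbitrary choice.\<close>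

lemma continuous_on_torusI:
  fixes g :: "'n::finite torus \<Rightarrow> 'b::metric_space"
  assumes "continuous_on UNIV (\<lambda>y. g (to_torus y))"
  shows "continuous_on UNIV g"
  unfolding continuous_on_iff
proof (intro ballI allI impI)
  fix x :: "'n torus" and e :: real assume "0 < e"
  then obtain d where d: "d > 0"
    "\<And>y. dist y (torus_rep x) < d \<Longrightarrow> dist (g (to_torus y)) (g (to_torus (torus_rep x))) < e"
    using assms unfolding continuous_on_iff by (meson UNIV_I)
  have "dist (g x') (g x) < e" if "dist x' x < d" for x'
  proof -
    have "dist (to_torus (torus_rep x)) x' < d" using that by (simp add: dist_commute)
    then obtain b where "to_torus b = x'" "norm (torus_rep x - b) < d"
      by (rule dist_torus_lift)
    then show ?thesis using d(2)[of b] by (simp add: dist_norm norm_minus_commute)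
  qed
  with d(1) show "\<exists>d>0. \<forall>x'\<in>UNIV. dist x' x < d \<longrightarrow> dist (g x') (g x) < e" by blast
qed

lemma vec_axis_sum: "(w :: real ^ 'n) = (\<Sum>i\<in>UNIV. w $ i *\<^sub>R axis i 1)"
  by (simp add: vec_eq_iff axis_def if_distrib cong: if_cong)

lemma measurable_vec_lambda:
  assumes "\<And>i. (\<lambda>x. g x i) \<in> borel_measurable M"
  shows "(\<lambda>x. (\<chi> i. g x i) :: real ^ 'n) \<in> borel_measurable M"
proof -
  have "(\<lambda>x. \<Sum>i\<in>UNIV. g x i *\<^sub>R axis i 1 :: real ^ 'n) \<in> borel_measurable M"
    using assms by measurable
  then show ?thesis by (subst vec_axis_sum) simp
qed

lemma le_one_plus_square: "(x :: real) \<le> 1 + x\<^sup>2"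
  using zero_le_power2[of "x - 1/2"] by (simp add: power2_eq_square algebra_simps)

text \<open>A closed fundamental domain: opposite faces are identified by the quotient, but
  closedness makes it compact.\<close>

definition unit_cell :: "(real ^ 'n) set" where "unit_cell = {y. \<forall>i. 0 \<le> y $ i \<and> y $ i \<le> 1}"

lemma compact_unit_cell: "compact (unit_cell :: (real ^ 'n) set)"
proof -
  have "unit_cell = cbox 0 (1 :: real ^ 'n)" by (auto simp: unit_cell_def mem_box_cart)
  with compact_cbox[of 0 "1 :: real ^ 'n"] show ?thesis by (rule_tac ssubst)
qed

lemma unit_cell_cover: "\<exists>k. (\<forall>i. k $ i \<in> \<int>) \<and> y + k \<in> unit_cell"
  by (rule exI[of _ "\<chi> i. - of_int \<lfloor>y $ i\<rfloor>"]) (auto simp: unit_cell_def, linarith)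

lemma compact_UNIV_torus: "compact (UNIV :: 'n::finite torus set)"
proof -
  have "(UNIV :: 'n torus set) = to_torus ` unit_cell"
  proof (rule set_eqI, simp)
    fix x :: "'n torus"
    obtain k where k: "\<And>i. k $ i \<in> \<int>" "torus_rep x + k \<in> unit_cell"
      using unit_cell_cover by blast
    have "x = to_torus (torus_rep x + k)" using to_torus_shift[OF k(1)] by simp
    then show "x \<in> to_torus ` unit_cell" using k(2) by blast
  qed
  then show ?thesis
    using compact_continuous_image[OF continuous_on_subset[OF continuous_to_torus]] compact_unit_cell
    by (metis subset_UNIV)
qed

lemma continuous_on_torus_bounded:
  fixes g :: "'n::finite torus \<Rightarrow> real"
  assumes "continuous_on UNIV g"
  obtains B where "B \<ge> 0" "\<And>x. \<bar>g x\<bar> \<le> B"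
proof -
  have "bounded (range g)"
    using compact_continuous_image[OF assms compact_UNIV_torus] by (rule compact_imp_bounded)
  then obtain B where "\<And>x. \<bar>g x\<bar> \<le> B" by (auto simp: bounded_iff)
  then show ?thesis using that[of "max B 0"] by (metis max.cobounded2 max.coboundedI1)
qed

text \<open>Total boundedness provides finitely many centres; each point is sent to the first centre
  in the list whose ball contains it, which keeps the rounding map measurable.\<close>

lemma torus_discretization:
  assumes "e > 0"
  obtains D :: "'n::finite torus \<Rightarrow> 'n torus"
  where "finite (range D)" "D \<in> borel_measurable borel" "\<And>x. dist (D x) x < e"
proof -
  obtain K where K: "finite K" "(UNIV :: 'n torus set) \<subseteq> (\<Union>x\<in>K. ball x e)"
    using compact_UNIV_torus[unfolded compact_eq_totally_bounded] assms by blast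
  obtain xs where xs: "set xs = K" using finite_list[OF K(1)] by blast
  have "\<exists>D. finite (range D) \<and> D \<in> borel_measurable borel \<and> (\<forall>x\<in>(\<Union>x\<in>set ys. ball x e). dist (D x) x < e)"
    for ys :: "'n torus list"
  proof (induction ys)
    case Nil
    show ?case by (rule exI[of _ "\<lambda>_. 0"]) auto
  next
    case (Cons y ys)
    then obtain D where D: "finite (range D)" "D \<in> borel_measurable borel"
      "\<forall>x\<in>(\<Union>x\<in>set ys. ball x e). dist (D x) x < e" by blast
    let ?D = "\<lambda>x. if x \<in> ball y e then y else D x"
    have "range ?D \<subseteq> insert y (range D)" by auto
    then have "finite (range ?D)" using D(1) by (meson finite.insertI finite_subset)
    moreover have "?D \<in> borel_measurable borel"
      using D(2) by (intro measurable_If_set) auto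
    moreover have "\<forall>x\<in>(\<Union>x\<in>set (y # ys). ball x e). dist (?D x) x < e"
      using D(3) by auto
    ultimately show ?case by blast
  qed
  from this[of xs] show ?thesis using that K(2) xs by blast
qed

section \<open>Probability measures and the distance d1\<close>

lemma torus_probsD:
  assumes "m \<in> torus_probs"
  shows "prob_space m" "sets m = sets borel" "space m = UNIV"
  using assms sets_eq_imp_space_eq[of m borel] by (auto simp: torus_probs_def)

lemma distr_torus_probs:
  "prob_space M \<Longrightarrow> X \<in> borel_measurable M \<Longrightarrow> distr M borel X \<in> torus_probs"
  by (auto simp: torus_probs_def intro: prob_space.prob_space_distr)

lemma lipschitz_torus_measurable:
  "1-lipschitz_on UNIV (g :: 'n::finite torus \<Rightarrow> real) \<Longrightarrow> g \<in> borel_measurable borel"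
  by (intro borel_measurable_continuous_onI lipschitz_on_continuous_on)

lemma torus_integrable:
  fixes g :: "'n::finite torus \<Rightarrow> real"
  assumes m: "m \<in> torus_probs" and g: "g \<in> borel_measurable borel" "\<And>x. \<bar>g x\<bar> \<le> B"
  shows "integrable m g"
proof -
  interpret prob_space m by (rule torus_probsD[OF m])
  show ?thesis
    by (rule integrable_const_bound[of _ B]) (use g torus_probsD[OF m] in \<open>auto cong: measurable_cong_sets\<close>)
qed

text \<open>On a compact torus a 1-Lipschitz function stays within \<open>D\<close> of its value at
  0, so the supremum in \<open>d1\<close> is over a bounded set; the zero function makes it
  nonnegative.\<close>

lemma d1_nonneg_bounded:
  obtains D where "D \<ge> 0"
    "\<And>m1 m2 :: 'n::finite torus measure. m1 \<in> torus_probs \<Longrightarrow> m2 \<in> torus_probs \<Longrightarrow> 0 \<le> d1 m1 m2 \<and> d1 m1 m2 \<le> D"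
proof -
  have "continuous_on UNIV (\<lambda>x :: 'n torus. dist x 0)" by (intro continuous_intros)
  then obtain D where D: "D \<ge> 0" "\<And>x :: 'n torus. \<bar>dist x 0\<bar> \<le> D"
    by (rule continuous_on_torus_bounded) auto
  have le: "(\<integral>x. g x \<partial>m1) - (\<integral>x. g x \<partial>m2) \<le> 2 * D"
    if g: "1-lipschitz_on UNIV g" and m: "m1 \<in> torus_probs" "m2 \<in> torus_probs"
    for g and m1 m2 :: "'n torus measure"
  proof -
    have b: "\<bar>g x - g 0\<bar> \<le> D" for x
      using lipschitz_onD[OF g, of x 0] D(2)[of x] by (simp add: dist_real_def)
    have gm: "g \<in> borel_measurable borel" by (rule lipschitz_torus_measurable[OF g])
    have ig: "integrable m' g" if "m' \<in> torus_probs" for m'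
    proof (rule torus_integrable[OF that gm])
      show "\<bar>g x\<bar> \<le> \<bar>g 0\<bar> + D" for x using b[of x] by linarith
    qed
    interpret m1: prob_space m1 by (rule torus_probsD[OF m(1)])
    interpret m2: prob_space m2 by (rule torus_probsD[OF m(2)])
    have "(\<integral>x. g x \<partial>m1) \<le> (\<integral>x. g 0 + D \<partial>m1)"
      by (intro integral_mono ig m) (use b in \<open>auto simp: abs_le_iff algebra_simps\<close>)
    moreover have "(\<integral>x. g 0 - D \<partial>m2) \<le> (\<integral>x. g x \<partial>m2)"
      by (intro integral_mono ig m) (use b in \<open>auto simp: abs_le_iff algebra_simps\<close>)
    ultimately show ?thesis by (simp add: m1.prob_space m2.prob_space)
  qed
  have "0 \<le> d1 m1 m2 \<and> d1 m1 m2 \<le> 2 * D"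
    if m: "m1 \<in> torus_probs" "m2 \<in> torus_probs" for m1 m2 :: "'n torus measure"
  proof
    have z: "(\<lambda>_. 0) \<in> {g :: 'n torus \<Rightarrow> real. 1-lipschitz_on UNIV g}"
      using lipschitz_on_le[OF lipschitz_on_constant[of UNIV "0::real"], of 1] by simp
    have "(\<integral>x. 0 \<partial>m1) - (\<integral>x. 0 \<partial>m2) \<le> d1 m1 m2"
      unfolding d1_def by (rule cSUP_upper2[OF _ z]) (auto intro!: bdd_aboveI[of _ "2 * D"] le m)
    then show "0 \<le> d1 m1 m2" by simp
    show "d1 m1 m2 \<le> 2 * D"
      unfolding d1_def by (rule cSUP_least) (use z le m in auto)
  qed
  then show ?thesis using that[of "2 * D"] D(1) by simp
qed

lemma d1_leI:
  fixes m1 m2 :: "'a::finite torus measure"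
  assumes "\<And>g. 1-lipschitz_on UNIV g \<Longrightarrow> (\<integral>x. g x \<partial>m1) - (\<integral>x. g x \<partial>m2) \<le> c"
  shows "d1 m1 m2 \<le> c"
  unfolding d1_def
proof (rule cSUP_least)
  show "{g :: 'a torus \<Rightarrow> real. 1-lipschitz_on UNIV g} \<noteq> {}"
    using lipschitz_on_le[OF lipschitz_on_constant[of UNIV "0::real"], of 1] by fastforce
qed (auto intro: assms)

lemma lipschitz_torus_bounded:
  fixes g :: "'n::finite torus \<Rightarrow> real"
  assumes "1-lipschitz_on UNIV g"
  obtains B where "B \<ge> 0" "\<And>x. \<bar>g x\<bar> \<le> B"
  using continuous_on_torus_bounded lipschitz_on_continuous_on[OF assms] by blast

text \<open>The pair \<open>(X, Y)\<close> is a coupling of the two laws, and the cost of any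
  coupling dominates \<open>d1\<close>. The majorant \<open>q\<close> is left free so that a bound
  in terms of second moments can be inserted.\<close>

lemma d1_distr_le:
  fixes X Y :: "'w \<Rightarrow> 'n::finite torus"
  assumes "prob_space M" and X: "X \<in> borel_measurable M" and Y: "Y \<in> borel_measurable M"
    and q: "integrable M q" "AE \<omega> in M. dist (X \<omega>) (Y \<omega>) \<le> q \<omega>"
  shows "d1 (distr M borel X) (distr M borel Y) \<le> (\<integral>\<omega>. q \<omega> \<partial>M)"
proof (rule d1_leI)
  interpret prob_space M by fact
  fix g :: "'n torus \<Rightarrow> real" assume g: "1-lipschitz_on UNIV g"
  note gm [measurable] = lipschitz_torus_measurable[OF g]
  note [measurable] = X Y
  obtain B where B: "\<And>x. \<bar>g x\<bar> \<le> B" using lipschitz_torus_bounded[OF g] by blast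
  have i: "integrable M (\<lambda>\<omega>. g (X \<omega>))" "integrable M (\<lambda>\<omega>. g (Y \<omega>))"
    by (rule integrable_const_bound[of _ B]; use B in auto)+
  have "(\<integral>x. g x \<partial>distr M borel X) - (\<integral>x. g x \<partial>distr M borel Y) = (\<integral>\<omega>. g (X \<omega>) - g (Y \<omega>) \<partial>M)"
    by (simp add: integral_distr i)
  also have "\<dots> \<le> (\<integral>\<omega>. q \<omega> \<partial>M)"
  proof (rule integral_mono_AE[OF _ q(1)])
    show "AE \<omega> in M. g (X \<omega>) - g (Y \<omega>) \<le> q \<omega>"
      using q(2)
    proof eventually_elim
      case (elim \<omega>)
      then show ?case using lipschitz_onD[OF g, of "X \<omega>" "Y \<omega>"] by (simp add: dist_real_def)
    qed
  qed (use i in auto)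
  finally show "(\<integral>x. g x \<partial>distr M borel X) - (\<integral>x. g x \<partial>distr M borel Y) \<le> (\<integral>\<omega>. q \<omega> \<partial>M)" .
qed

text \<open>The constant in \<open>d1_lipschitz\<close> carries no sign; its absolute value serves
  equally well because \<open>d1\<close> is nonnegative.\<close>

lemma d1_lipschitzE:
  fixes F :: "'n::finite torus measure \<Rightarrow> real"
  assumes "d1_lipschitz F"
  obtains K where "K \<ge> 0" "\<And>m1 m2. m1 \<in> torus_probs \<Longrightarrow> m2 \<in> torus_probs \<Longrightarrow> \<bar>F m1 - F m2\<bar> \<le> K * d1 m1 m2"
proof -
  obtain K where K: "\<forall>m1\<in>torus_probs. \<forall>m2\<in>torus_probs. \<bar>F m1 - F m2\<bar> \<le> K * d1 m1 m2"
    using assms by (auto simp: d1_lipschitz_def)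
  have "\<bar>F m1 - F m2\<bar> \<le> \<bar>K\<bar> * d1 m1 m2" if m: "m1 \<in> torus_probs" "m2 \<in> torus_probs" for m1 m2
  proof -
    have "0 \<le> d1 m1 m2" using d1_nonneg_bounded m by metis
    then have "K * d1 m1 m2 \<le> \<bar>K\<bar> * d1 m1 m2" by (intro mult_right_mono) auto
    then show ?thesis using K m by force
  qed
  then show ?thesis using that[of "\<bar>K\<bar>"] by simp
qed

text \<open>Every measure is compared with the Dirac mass at 0, at uniformly bounded
  \<open>d1\<close>-distance.\<close>

lemma d1_lipschitz_bounded:
  fixes F :: "'n::finite torus measure \<Rightarrow> real"
  assumes "d1_lipschitz F"
  obtains B where "B \<ge> 0" "\<And>m. m \<in> torus_probs \<Longrightarrow> \<bar>F m\<bar> \<le> B"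
proof -
  obtain K where K: "K \<ge> 0" "\<And>m1 m2. m1 \<in> torus_probs \<Longrightarrow> m2 \<in> torus_probs \<Longrightarrow> \<bar>F m1 - F m2\<bar> \<le> K * d1 m1 m2"
    using d1_lipschitzE[OF assms] by blast
  obtain D where D: "D \<ge> 0" "\<And>m1 m2 :: 'n torus measure. m1 \<in> torus_probs \<Longrightarrow> m2 \<in> torus_probs \<Longrightarrow> 0 \<le> d1 m1 m2 \<and> d1 m1 m2 \<le> D"
    using d1_nonneg_bounded by blast
  let ?m = "return borel 0 :: 'n torus measure"
  have m0: "?m \<in> torus_probs" by (auto simp: torus_probs_def intro: prob_space_return)
  have "\<bar>F m\<bar> \<le> \<bar>F ?m\<bar> + K * D" if m: "m \<in> torus_probs" for m
  proof -
    have "K * d1 m ?m \<le> K * D" using D(2)[OF m m0] K(1) by (intro mult_left_mono) auto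
    then show ?thesis using K(2)[OF m m0] by (smt (verit))
  qed
  then show ?thesis using that[of "\<bar>F ?m\<bar> + K * D"] K(1) D(1) by simp
qed

lemma sets_empirical [simp]: "sets (empirical N x) = sets borel"
  by (metis empirical_def sets.sets_measure_of_eq space_borel)

lemma sets_mixture [simp]: "sets (mixture \<theta> m1 m2) = sets borel"
  by (metis mixture_def sets.sets_measure_of_eq space_borel)

text \<open>As the law of \<open>x\<close> at a uniformly chosen index, the empirical measure falls
  under the coupling bound. For \<open>N = 0\<close> there would be no uniform index.\<close>

lemma empirical_eq_distr:
  assumes "N \<ge> 1"
  shows "empirical N x = distr (measure_pmf (pmf_of_set {..<N})) borel x"
proof (rule measure_eqI)
  fix A assume "A \<in> sets (empirical N x)"
  then have A: "A \<in> sets borel" by simp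
  have ne: "{..<N} \<noteq> {}" using assms by (auto simp: lessThan_empty_iff)
  have "emeasure (empirical N x) A = ennreal (1 / real N) * ennreal (\<Sum>i<N. indicator A (x i))"
    using A by (simp add: emeasure_empirical) (simp add: indicator_def sum.If_cases ennreal_of_nat_eq_real_of_nat)
  also have "\<dots> = ennreal ((\<Sum>i<N. indicator A (x i)) / real N)"
    by (subst ennreal_mult[symmetric]) (auto intro!: sum_nonneg)
  also have "(\<Sum>i<N. indicator A (x i)) = real (card ({..<N} \<inter> x -` A))"
    by (simp add: indicator_def sum.If_cases) (simp add: Int_def vimage_def)
  also have "ennreal (\<dots> / real N) = emeasure (distr (measure_pmf (pmf_of_set {..<N})) borel x) A"
        using ne A by (subst emeasure_distr) (simp_all add: emeasure_pmf_of_set Int_commute)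
  finally show "emeasure (empirical N x) A = emeasure (distr (measure_pmf (pmf_of_set {..<N})) borel x) A" .
qed simp

lemma empirical_torus_probs: "N \<ge> 1 \<Longrightarrow> empirical N x \<in> torus_probs"
  by (simp add: empirical_eq_distr distr_torus_probs measure_pmf.prob_space_axioms)

lemma d1_empirical_le:
  fixes x y :: "nat \<Rightarrow> 'n::finite torus"
  assumes "N \<ge> 1" "\<And>i. i < N \<Longrightarrow> dist (x i) (y i) \<le> e"
  shows "d1 (empirical N x) (empirical N y) \<le> e"
proof -
  have "AE i in measure_pmf (pmf_of_set {..<N}). dist (x i) (y i) \<le> e"
    using assms by (subst AE_measure_pmf_iff, subst set_pmf_of_set) (auto simp: lessThan_empty_iff)
  from d1_distr_le[OF measure_pmf.prob_space_axioms _ _ _ this]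
  show ?thesis using assms(1) by (simp add: empirical_eq_distr)
qed

section \<open>Taylor estimates for smooth periodic functions\<close>

lemma cont_diff_SucD:
  assumes "cont_diff (Suc k) f"
  shows "f differentiable (at z)" "cont_diff k (\<lambda>z. frechet_derivative f (at z) v)"
  using assms by auto

lemma cont_diff_continuous: "cont_diff k f \<Longrightarrow> continuous_on UNIV f"
proof (cases k)
  case (Suc j)
  assume "cont_diff k f"
  then have "\<forall>z. f differentiable (at z)" using Suc by simp
  then show ?thesis
    by (meson continuous_at_imp_continuous_on differentiable_imp_continuous_within)
qed simp

lemma frechet_derivative_Basis_sum:
  fixes f :: "'a::euclidean_space \<Rightarrow> real"
  assumes "f differentiable (at z)"
  shows "frechet_derivative f (at z) w = (\<Sum>b\<in>Basis. (w \<bullet> b) * frechet_derivative f (at z) b)"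
proof -
  have lin: "linear (frechet_derivative f (at z))"
    by (rule linear_frechet_derivative[OF assms])
  have "frechet_derivative f (at z) w = frechet_derivative f (at z) (\<Sum>b\<in>Basis. (w \<bullet> b) *\<^sub>R b)"
    by (simp add: euclidean_representation)
  also have "\<dots> = (\<Sum>b\<in>Basis. (w \<bullet> b) * frechet_derivative f (at z) b)"
    using lin by (simp add: linear_sum linear_scale)
  finally show ?thesis .
qed

lemma line_derivative:
  fixes f :: "'a::real_normed_vector \<Rightarrow> real"
  assumes "\<And>z. f differentiable (at z)"
  shows "((\<lambda>s. f (z + s *\<^sub>R w)) has_real_derivative frechet_derivative f (at (z + s *\<^sub>R w)) w) (at s)"
proof -
  have "(f has_derivative frechet_derivative f (at (z + s *\<^sub>R w))) (at (z + s *\<^sub>R w))"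
    using assms frechet_derivative_works by blast
  moreover have "((\<lambda>s. z + s *\<^sub>R w) has_derivative (\<lambda>h. h *\<^sub>R w)) (at s)"
    by (auto intro!: derivative_eq_intros)
  ultimately have "((\<lambda>s. f (z + s *\<^sub>R w)) has_derivative (\<lambda>h. frechet_derivative f (at (z + s *\<^sub>R w)) (h *\<^sub>R w))) (at s)"
    by (rule has_derivative_compose[rotated])
  moreover have "frechet_derivative f (at (z + s *\<^sub>R w)) (h *\<^sub>R w) = frechet_derivative f (at (z + s *\<^sub>R w)) w * h" for h
    using linear_frechet_derivative[OF assms] by (simp add: linear_scale mult.commute)
  ultimately show ?thesis by (simp add: has_field_derivative_def)
qed

text \<open>Such a function lives in effect on the compact product of a time interval and the torus,
  so continuity alone bounds it. The class is stable under differentiation, which yields bounds for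
  all derivatives at once.\<close>

definition periodic_cutoff :: "real \<Rightarrow> real \<Rightarrow> (real \<times> (real ^ 'n) \<Rightarrow> real) \<Rightarrow> bool" where
  "periodic_cutoff a b f \<longleftrightarrow> (\<forall>t y k. (\<forall>i. k $ i \<in> \<int>) \<longrightarrow> f (t, y + k) = f (t, y)) \<and>
     (\<forall>t y. t \<notin> {a..b} \<longrightarrow> f (t, y) = 0)"

lemma periodic_cutoff_bounded:
  assumes per: "periodic_cutoff a b f" and cont: "continuous_on UNIV f"
  obtains B where "B \<ge> 0" "\<And>z. \<bar>f z\<bar> \<le> B"
proof -
  have "compact ({a..b} \<times> (unit_cell :: (real ^ 'a) set))"
    by (intro compact_Times compact_unit_cell compact_Icc)
  then have "bounded (f ` ({a..b} \<times> unit_cell))"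
    using compact_continuous_image[OF continuous_on_subset[OF cont]] compact_imp_bounded by blast
  then obtain B where B: "\<And>z. z \<in> {a..b} \<times> unit_cell \<Longrightarrow> \<bar>f z\<bar> \<le> B"
    by (auto simp: bounded_iff)
  have "\<bar>f (t, y)\<bar> \<le> max B 0" for t y
  proof (cases "t \<in> {a..b}")
    case True
    obtain k where k: "\<forall>i. k $ i \<in> \<int>" "y + k \<in> unit_cell" using unit_cell_cover by blast
    have "f (t, y) = f (t, y + k)" using per k(1) by (simp add: periodic_cutoff_def)
    then show ?thesis using B[of "(t, y + k)"] k(2) True by auto
  next
    case False
    then show ?thesis using per by (simp add: periodic_cutoff_def)
  qed
  then show ?thesis using that[of "max B 0"] by auto
qed

text \<open>Periodicity passes to the derivative because \<open>f\<close> is unchanged by an integer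
  translation. Outside \<open>{a..b}\<close> the function vanishes on an open set, hence so does its
  derivative.\<close>

lemma periodic_cutoff_derivative:
  assumes per: "periodic_cutoff a b f" and diff: "\<And>z. f differentiable (at z)"
  shows "periodic_cutoff a b (\<lambda>z. frechet_derivative f (at z) v)"
  unfolding periodic_cutoff_def
proof (intro conjI allI impI)
  fix t and y k :: "real ^ 'a" assume k: "\<forall>i. k $ i \<in> \<int>"
  have shift: "(\<lambda>z. f (z + (0, k))) = f"
    using per k by (auto simp: periodic_cutoff_def fun_eq_iff)
  have "(f has_derivative frechet_derivative f (at ((t, y) + (0, k)))) (at ((t, y) + (0, k)))"
    using diff frechet_derivative_works by blast
  moreover have "((\<lambda>z. z + (0, k)) has_derivative (\<lambda>h. h)) (at (t, y))"
    by (auto intro!: derivative_eq_intros)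
  ultimately have "((\<lambda>z. f (z + (0, k))) has_derivative (\<lambda>h. frechet_derivative f (at ((t, y) + (0, k))) h)) (at (t, y))"
    by (rule has_derivative_compose[rotated])
  then have "frechet_derivative f (at ((t, y) + (0, k))) = frechet_derivative f (at (t, y))"
    unfolding shift using frechet_derivative_at by blast
  then show "frechet_derivative f (at (t, y + k)) v = frechet_derivative f (at (t, y)) v" by simp
next
  fix t and y :: "real ^ 'a" assume t: "t \<notin> {a..b}"
  have op: "open ((- {a..b}) \<times> (UNIV :: (real ^ 'a) set))" by (intro open_Times) auto
  have "(f has_derivative (\<lambda>_. 0)) (at (t, y))"
    by (rule has_derivative_transform_within_open[of "\<lambda>_. 0" _ _ _ "(- {a..b}) \<times> UNIV"])
      (use t op per in \<open>auto simp: periodic_cutoff_def\<close>)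
  then show "frechet_derivative f (at (t, y)) v = 0"
    using frechet_derivative_at by (metis (full_types))
qed

lemma periodic_cutoff_smooth_derivative:
  assumes "periodic_cutoff a b f" "smooth f"
  shows "periodic_cutoff a b (\<lambda>z. frechet_derivative f (at z) v)"
    and "smooth (\<lambda>z. frechet_derivative f (at z) v)"
proof -
  have cd: "cont_diff (Suc k) f" for k using assms(2) by (simp add: smooth_def)
  show "periodic_cutoff a b (\<lambda>z. frechet_derivative f (at z) v)"
    using cont_diff_SucD(1)[OF cd] assms(1) by (rule periodic_cutoff_derivative[rotated])
  show "smooth (\<lambda>z. frechet_derivative f (at z) v)"
    using cont_diff_SucD(2)[OF cd] by (simp add: smooth_def)
qed

lemma smooth_differentiable: "smooth f \<Longrightarrow> f differentiable (at z)"
  unfolding smooth_def using cont_diff_SucD(1) by blast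

lemma smooth_continuous: "smooth f \<Longrightarrow> continuous_on UNIV f"
  unfolding smooth_def using cont_diff_continuous by blast

lemma directional_derivative_bound:
  fixes f :: "real \<times> (real ^ 'n) \<Rightarrow> real"
  assumes "periodic_cutoff a b f" "smooth f"
  obtains B where "B \<ge> 0" "\<And>z w. \<bar>frechet_derivative f (at z) w\<bar> \<le> B * norm w"
proof -
  have "\<exists>B\<ge>0. \<forall>z. \<bar>frechet_derivative f (at z) e\<bar> \<le> B" for e
    using periodic_cutoff_bounded[OF periodic_cutoff_smooth_derivative(1)[OF assms]
        smooth_continuous[OF periodic_cutoff_smooth_derivative(2)[OF assms]], of e] by metis
  then obtain B where B: "\<And>e. B e \<ge> 0" "\<And>e z. \<bar>frechet_derivative f (at z) e\<bar> \<le> B e" by metis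
  have "\<bar>frechet_derivative f (at z) w\<bar> \<le> (\<Sum>e\<in>Basis. B e) * norm w" for z w
  proof -
    have "\<bar>frechet_derivative f (at z) w\<bar> \<le> (\<Sum>e\<in>Basis. \<bar>(w \<bullet> e) * frechet_derivative f (at z) e\<bar>)"
      by (subst frechet_derivative_Basis_sum[OF smooth_differentiable[OF assms(2)]]) (rule sum_abs)
    also have "\<dots> \<le> (\<Sum>e\<in>Basis. norm w * B e)"
      unfolding abs_mult by (intro sum_mono mult_mono B Basis_le_norm) auto
    finally show ?thesis by (simp add: sum_distrib_right mult.commute sum_distrib_left)
  qed
  then show ?thesis using that[of "\<Sum>e\<in>Basis. B e"] B(1) by (simp add: sum_nonneg)
qed

lemma smooth_lipschitz:
  fixes f :: "real \<times> (real ^ 'n) \<Rightarrow> real"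
  assumes "periodic_cutoff a b f" "smooth f"
  obtains K where "K \<ge> 0" "\<And>z w. \<bar>f (z + w) - f z\<bar> \<le> K * norm w"
proof -
  obtain B where B: "B \<ge> 0" "\<And>z w. \<bar>frechet_derivative f (at z) w\<bar> \<le> B * norm w"
    using directional_derivative_bound[OF assms] by blast
  have "\<bar>f (z + w) - f z\<bar> \<le> B * norm w" for z w
  proof -
    obtain s where "f (z + 1 *\<^sub>R w) - f (z + 0 *\<^sub>R w) = (1 - 0) * frechet_derivative f (at (z + s *\<^sub>R w)) w"
      using MVT2[of 0 1 "\<lambda>s. f (z + s *\<^sub>R w)" "\<lambda>s. frechet_derivative f (at (z + s *\<^sub>R w)) w"]
        line_derivative[OF smooth_differentiable[OF assms(2)]] by auto
    then show ?thesis using B(2) by simp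
  qed
  then show ?thesis using that B(1) by blast
qed

text \<open>The mean value theorem turns the increment into a derivative at an intermediate point,
  and each directional derivative along the basis is Lipschitz. The constant is not sharp.\<close>

lemma smooth_taylor1:
  fixes f :: "real \<times> (real ^ 'n) \<Rightarrow> real"
  assumes "periodic_cutoff a b f" "smooth f"
  obtains K where "K \<ge> 0" "\<And>z w. \<bar>f (z + w) - f z - frechet_derivative f (at z) w\<bar> \<le> K * (norm w)\<^sup>2"
proof -
  let ?D = "\<lambda>e z. frechet_derivative f (at z) e"
  have "\<exists>K\<ge>0. \<forall>z w. \<bar>?D e (z + w) - ?D e z\<bar> \<le> K * norm w" for e
    using smooth_lipschitz[OF periodic_cutoff_smooth_derivative[OF assms], of e] by metis
  then obtain K where K: "\<And>e. K e \<ge> 0" "\<And>e z w. \<bar>?D e (z + w) - ?D e z\<bar> \<le> K e * norm w" by metis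
  have D: "\<bar>?D w (z + s *\<^sub>R w) - ?D w z\<bar> \<le> (\<Sum>e\<in>Basis. K e) * (norm w)\<^sup>2" if s: "0 \<le> s" "s \<le> 1" for z w s
  proof -
    have "?D w (z + s *\<^sub>R w) - ?D w z = (\<Sum>e\<in>Basis. (w \<bullet> e) * (?D e (z + s *\<^sub>R w) - ?D e z))"
      unfolding frechet_derivative_Basis_sum[OF smooth_differentiable[OF assms(2)], of _ w]
      by (simp add: sum_subtractf right_diff_distrib)
    then have "\<bar>?D w (z + s *\<^sub>R w) - ?D w z\<bar> \<le> (\<Sum>e\<in>Basis. \<bar>(w \<bullet> e) * (?D e (z + s *\<^sub>R w) - ?D e z)\<bar>)"
      by (simp only: sum_abs)
    also have "\<dots> \<le> (\<Sum>e\<in>Basis. norm w * (K e * norm w))"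
      unfolding abs_mult
    proof (intro sum_mono mult_mono Basis_le_norm)
      fix e :: "real \<times> (real ^ 'n)"
      have "norm (s *\<^sub>R w) \<le> norm w" using s by (simp add: mult_left_le_one_le)
      then have "K e * norm (s *\<^sub>R w) \<le> K e * norm w" by (intro mult_left_mono K(1))
      then show "\<bar>?D e (z + s *\<^sub>R w) - ?D e z\<bar> \<le> K e * norm w"
        using K(2)[where e=e and z=z and w="s *\<^sub>R w"] by linarith
    qed auto
    finally show ?thesis by (simp add: sum_distrib_right mult.commute sum_distrib_left power2_eq_square mult.left_commute)
  qed
  have "\<bar>f (z + w) - f z - ?D w z\<bar> \<le> (\<Sum>e\<in>Basis. K e) * (norm w)\<^sup>2" for z w
  proof -
    obtain s where "0 < s" "s < 1" "f (z + 1 *\<^sub>R w) - f (z + 0 *\<^sub>R w) = (1 - 0) * frechet_derivative f (at (z + s *\<^sub>R w)) w"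
      using MVT2[of 0 1 "\<lambda>s. f (z + s *\<^sub>R w)" "\<lambda>s. frechet_derivative f (at (z + s *\<^sub>R w)) w"]
        line_derivative[OF smooth_differentiable[OF assms(2)]] by auto
    then show ?thesis using D[where s=s and w=w and z=z] by simp
  qed
  then show ?thesis using that[of "\<Sum>e\<in>Basis. K e"] K(1) by (simp add: sum_nonneg)
qed

lemma smooth_taylor2:
  fixes f :: "real \<times> (real ^ 'n) \<Rightarrow> real"
  assumes "periodic_cutoff a b f" "smooth f"
  obtains K where "K \<ge> 0"
    "\<And>z w. \<bar>f (z + w) - f z - frechet_derivative f (at z) w
        - (1/2) * frechet_derivative (\<lambda>z. frechet_derivative f (at z) w) (at z) w\<bar> \<le> K * (norm w)^3"
proof -
  let ?D = "\<lambda>e z. frechet_derivative f (at z) e"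
  let ?DD = "\<lambda>e e' z. frechet_derivative (?D e) (at z) e'"
  have sD: "periodic_cutoff a b (?D e)" "smooth (?D e)" for e
    using periodic_cutoff_smooth_derivative[OF assms] by auto
  have "\<exists>K\<ge>0. \<forall>z w. \<bar>?D e (z + w) - ?D e z - ?DD e w z\<bar> \<le> K * (norm w)\<^sup>2" for e
    using smooth_taylor1[OF sD, of e] by metis
  then obtain K where K: "\<And>e. K e \<ge> 0"
    "\<And>e z w. \<bar>?D e (z + w) - ?D e z - ?DD e w z\<bar> \<le> K e * (norm w)\<^sup>2" by metis
  have Dw: "?D w = (\<lambda>z. \<Sum>e\<in>Basis. (w \<bullet> e) * ?D e z)" for w
    by (rule ext) (rule frechet_derivative_Basis_sum[OF smooth_differentiable[OF assms(2)]])
  have DDw: "?DD w w' z = (\<Sum>e\<in>Basis. (w \<bullet> e) * ?DD e w' z)" for w w' z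
  proof -
    have "(?D e has_derivative (\<lambda>h. ?DD e h z)) (at z)" for e
      using smooth_differentiable[OF sD(2), of e z] by (simp add: frechet_derivative_works)
    then have "((\<lambda>z. \<Sum>e\<in>Basis. (w \<bullet> e) * ?D e z) has_derivative (\<lambda>h. \<Sum>e\<in>Basis. (w \<bullet> e) * ?DD e h z)) (at z)"
      by (intro has_derivative_sum has_derivative_mult_right)
    then have "(\<lambda>h. \<Sum>e\<in>Basis. (w \<bullet> e) * ?DD e h z) = (\<lambda>h. ?DD w h z)"
      unfolding Dw[of w] by (rule frechet_derivative_at)
    then show ?thesis by metis
  qed
  have lin: "?DD e (s *\<^sub>R w) z = s * ?DD e w z" for e s w z
    using linear_frechet_derivative[OF smooth_differentiable[OF sD(2)]] by (simp add: linear_scale)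
  have D: "\<bar>?D w (z + s *\<^sub>R w) - ?D w z - s * ?DD w w z\<bar> \<le> (\<Sum>e\<in>Basis. K e) * (norm w)^3"
    if s: "0 \<le> s" "s \<le> 1" for z w s
  proof -
    have "?D w (z + s *\<^sub>R w) - ?D w z - s * ?DD w w z
      = (\<Sum>e\<in>Basis. (w \<bullet> e) * (?D e (z + s *\<^sub>R w) - ?D e z - ?DD e (s *\<^sub>R w) z))"
    proof -
      have 1: "?D w z' = (\<Sum>e\<in>Basis. (w \<bullet> e) * ?D e z')" for z'
        by (rule fun_cong[OF Dw])
      show ?thesis
        unfolding lin DDw[where w=w and w'=w and z=z] 1[of z] 1[of "z + s *\<^sub>R w"]
        unfolding sum_distrib_left sum_subtractf[symmetric]
        by (rule sum.cong[OF refl]) (simp only: right_diff_distrib mult.left_commute[of s])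
    qed
    then have "\<bar>?D w (z + s *\<^sub>R w) - ?D w z - s * ?DD w w z\<bar>
        \<le> (\<Sum>e\<in>Basis. \<bar>(w \<bullet> e) * (?D e (z + s *\<^sub>R w) - ?D e z - ?DD e (s *\<^sub>R w) z)\<bar>)"
      by (simp only: sum_abs)
    also have "\<dots> \<le> (\<Sum>e\<in>Basis. norm w * (K e * (norm w)\<^sup>2))"
      unfolding abs_mult
    proof (intro sum_mono mult_mono Basis_le_norm)
      fix e :: "real \<times> (real ^ 'n)"
      have "norm (s *\<^sub>R w) \<le> norm w" using s by (simp add: mult_left_le_one_le)
      then have "K e * (norm (s *\<^sub>R w))\<^sup>2 \<le> K e * (norm w)\<^sup>2" by (intro mult_left_mono K(1) power_mono) auto
      then show "\<bar>?D e (z + s *\<^sub>R w) - ?D e z - ?DD e (s *\<^sub>R w) z\<bar> \<le> K e * (norm w)\<^sup>2"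
        using K(2)[where e=e and z=z and w="s *\<^sub>R w"] by linarith
    qed auto
    also have "\<dots> = (\<Sum>e\<in>Basis. K e) * (norm w)^3"
      unfolding sum_distrib_right by (rule sum.cong) (simp_all add: power2_eq_square power3_eq_cube)
    finally show ?thesis .
  qed
  have "\<bar>f (z + w) - f z - ?D w z - (1/2) * ?DD w w z\<bar> \<le> (\<Sum>e\<in>Basis. K e) * (norm w)^3" for z w
  proof -
    \<comment> \<open>Subtracting the quadratic Taylor polynomial along the segment makes the
      derivative of \<open>?g\<close> exactly the remainder estimated in \<open>D\<close>; one
      application of the mean value theorem on the unit interval finishes.\<close>
    let ?g = "\<lambda>s. f (z + s *\<^sub>R w) - s * ?D w z - s\<^sup>2 / 2 * ?DD w w z"
    have g: "(?g has_real_derivative (?D w (z + s *\<^sub>R w) - ?D w z - s * ?DD w w z)) (at s)" for s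
    proof (intro DERIV_diff line_derivative[OF smooth_differentiable[OF assms(2)]])
      show "((\<lambda>s. s * ?D w z) has_real_derivative ?D w z) (at s)"
        using DERIV_cmult_right[OF DERIV_ident, of "?D w z"] by (simp only: mult_1)
      have "((\<lambda>s. s\<^sup>2 / 2) has_real_derivative s) (at s)"
        by (auto intro!: derivative_eq_intros)
      then show "((\<lambda>s. s\<^sup>2 / 2 * ?DD w w z) has_real_derivative s * ?DD w w z) (at s)"
        by (rule DERIV_cmult_right)
    qed
    obtain s where s: "0 < s" "s < 1" "?g 1 - ?g 0 = (1 - 0) * (?D w (z + s *\<^sub>R w) - ?D w z - s * ?DD w w z)"
      using MVT2[of 0 1 ?g "\<lambda>s. ?D w (z + s *\<^sub>R w) - ?D w z - s * ?DD w w z", OF zero_less_one g] by blast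
    have "f (z + w) - f z - ?D w z - (1/2) * ?DD w w z = ?D w (z + s *\<^sub>R w) - ?D w z - s * ?DD w w z"
      using s(3) by simp
    then show ?thesis using D[where s=s and w=w and z=z] s(1,2) by linarith
  qed
  then show ?thesis using that[of "\<Sum>e\<in>Basis. K e"] K(1) by (simp add: sum_nonneg)
qed

text \<open>All that the probabilistic part uses of a test function. \<open>f0\<close>,
  \<open>f1\<close> and \<open>f2\<close> stand for the time derivative, the spatial gradient and
  the spatial Hessian, and one constant \<open>K\<close> bounds the Taylor errors, the values and
  the Lipschitz moduli.\<close>

definition taylor_bounds ::
    "real \<Rightarrow> (real \<times> (real ^ 'n) \<Rightarrow> real) \<Rightarrow> (real \<times> (real ^ 'n) \<Rightarrow> real)
      \<Rightarrow> ('n \<Rightarrow> real \<times> (real ^ 'n) \<Rightarrow> real) \<Rightarrow> ('n \<Rightarrow> 'n \<Rightarrow> real \<times> (real ^ 'n) \<Rightarrow> real) \<Rightarrow> bool" where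
  "taylor_bounds K f f0 f1 f2 \<longleftrightarrow> K \<ge> 0 \<and>
     (\<forall>t h y. \<bar>f (t + h, y) - f (t, y) - h * f0 (t, y)\<bar> \<le> K * h\<^sup>2) \<and>
     (\<forall>t y w. \<bar>f (t, y + w) - f (t, y) - (\<Sum>i\<in>UNIV. w $ i * f1 i (t, y))\<bar> \<le> K * (norm w)\<^sup>2) \<and>
     (\<forall>t y w. \<bar>f (t, y + w) - f (t, y) - (\<Sum>i\<in>UNIV. w $ i * f1 i (t, y))
         - (1/2) * (\<Sum>i\<in>UNIV. \<Sum>j\<in>UNIV. w $ i * w $ j * f2 i j (t, y))\<bar> \<le> K * (norm w) ^ 3) \<and>
     (\<forall>q \<in> {f, f0} \<union> range f1 \<union> (\<Union>i. range (f2 i)). continuous_on UNIV q \<and> (\<forall>z. \<bar>q z\<bar> \<le> K) \<and>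
         (\<forall>t y s x. \<bar>q (s, x) - q (t, y)\<bar> \<le> K * (\<bar>s - t\<bar> + norm (x - y))))"

lemma taylor_boundsD:
  assumes "taylor_bounds K f f0 f1 f2"
  shows "K \<ge> 0"
    and "\<bar>f (t + h, y) - f (t, y) - h * f0 (t, y)\<bar> \<le> K * h\<^sup>2"
    and "\<bar>f (t, y + w) - f (t, y) - (\<Sum>i\<in>UNIV. w $ i * f1 i (t, y))\<bar> \<le> K * (norm w)\<^sup>2"
    and "\<bar>f (t, y + w) - f (t, y) - (\<Sum>i\<in>UNIV. w $ i * f1 i (t, y))
         - (1/2) * (\<Sum>i\<in>UNIV. \<Sum>j\<in>UNIV. w $ i * w $ j * f2 i j (t, y))\<bar> \<le> K * (norm w) ^ 3"
    and "q \<in> {f, f0} \<union> range f1 \<union> (\<Union>i. range (f2 i)) \<Longrightarrow> continuous_on UNIV q"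
    and "q \<in> {f, f0} \<union> range f1 \<union> (\<Union>i. range (f2 i)) \<Longrightarrow> \<bar>q z\<bar> \<le> K"
    and "q \<in> {f, f0} \<union> range f1 \<union> (\<Union>i. range (f2 i)) \<Longrightarrow>
       \<bar>q (s, x) - q (t, y)\<bar> \<le> K * (\<bar>s - t\<bar> + norm (x - y))"
  using assms unfolding taylor_bounds_def by blast+

lemma frechet_derivative_space_sum:
  fixes f :: "real \<times> (real ^ 'n) \<Rightarrow> real"
  assumes "f differentiable (at z)"
  shows "frechet_derivative f (at z) (0, w) = (\<Sum>i\<in>UNIV. w $ i * frechet_derivative f (at z) (0, axis i 1))"
proof -
  have lin: "linear (frechet_derivative f (at z))" by (rule linear_frechet_derivative[OF assms])
  have "(0::real, w) = (\<Sum>i\<in>UNIV. w $ i *\<^sub>R (0, axis i 1))"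
    by (simp add: sum_prod flip: vec_axis_sum)
  then have "frechet_derivative f (at z) (0, w) = frechet_derivative f (at z) (\<Sum>i\<in>UNIV. w $ i *\<^sub>R (0, axis i 1))"
    by (rule arg_cong)
  also have "\<dots> = (\<Sum>i\<in>UNIV. w $ i * frechet_derivative f (at z) (0, axis i 1))"
    using lin by (simp only: linear_sum linear_scale real_scaleR_def)
  finally show ?thesis .
qed

lemma smooth_taylor_bounds:
  fixes f :: "real \<times> (real ^ 'n) \<Rightarrow> real"
  assumes f: "periodic_cutoff a b f" "smooth f"
  obtains K where "taylor_bounds K f (\<lambda>z. frechet_derivative f (at z) (1, 0))
    (\<lambda>i z. frechet_derivative f (at z) (0, axis i 1))
    (\<lambda>i j z. frechet_derivative (\<lambda>z. frechet_derivative f (at z) (0, axis i 1)) (at z) (0, axis j 1))"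
proof -
  let ?D = "\<lambda>v z. frechet_derivative f (at z) v"
  let ?f1 = "\<lambda>i. ?D (0, axis i 1)"
  let ?DD = "\<lambda>v w z. frechet_derivative (?D v) (at z) w"
  let ?f2 = "\<lambda>i j. ?DD (0, axis i 1) (0, axis j 1)"
  let ?Q = "{f, ?D (1, 0)} \<union> range ?f1 \<union> (\<Union>i. range (?f2 i))"
  note sD = periodic_cutoff_smooth_derivative[OF f]
  note sDD = periodic_cutoff_smooth_derivative[OF sD]
  \<comment> \<open>Differentiating the coordinate expansion of \<open>?D (0, w)\<close> expands the
    second derivative in its first direction; the second direction is expanded later by
    linearity.\<close>
  have sDw: "?DD (0, w) (0, w') z = (\<Sum>i\<in>UNIV. w $ i * ?DD (0, axis i 1) (0, w') z)" for w w' z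
  proof -
    have "(?D e has_derivative (\<lambda>h. ?DD e h z)) (at z)" for e
      using smooth_differentiable[OF sD(2), of e z] by (simp add: frechet_derivative_works)
    then have "((\<lambda>z. \<Sum>i\<in>UNIV. w $ i * ?f1 i z) has_derivative (\<lambda>h. \<Sum>i\<in>UNIV. w $ i * ?DD (0, axis i 1) h z)) (at z)"
      by (intro has_derivative_sum has_derivative_mult_right)
    moreover have "(\<lambda>z. \<Sum>i\<in>UNIV. w $ i * ?f1 i z) = ?D (0, w)"
      by (rule ext) (rule frechet_derivative_space_sum[OF smooth_differentiable[OF f(2)], symmetric])
    ultimately have "(?D (0, w) has_derivative (\<lambda>h. \<Sum>i\<in>UNIV. w $ i * ?DD (0, axis i 1) h z)) (at z)"
      by (simp only:)
    then have "(\<lambda>h. \<Sum>i\<in>UNIV. w $ i * ?DD (0, axis i 1) h z) = (\<lambda>h. ?DD (0, w) h z)"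
      by (rule frechet_derivative_at)
    then show ?thesis by metis
  qed
  have finQ: "finite ?Q" by auto
  have Q: "periodic_cutoff a b q \<and> smooth q" if "q \<in> ?Q" for q
    using that f sD sDD by auto
  have "\<exists>K. K \<ge> 0 \<and> (\<forall>z. \<bar>q z\<bar> \<le> K) \<and> (\<forall>z w. \<bar>q (z + w) - q z\<bar> \<le> K * norm w)" if q: "q \<in> ?Q" for q
  proof -
    obtain K1 where K1: "K1 \<ge> 0" "\<And>z. \<bar>q z\<bar> \<le> K1"
      using periodic_cutoff_bounded[of a b q] smooth_continuous[of q] Q[OF q] by metis
    obtain K2 where K2: "K2 \<ge> 0" "\<And>z w. \<bar>q (z + w) - q z\<bar> \<le> K2 * norm w"
      using smooth_lipschitz[of a b q] Q[OF q] by metis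
    have "\<bar>q (z + w) - q z\<bar> \<le> (K1 + K2) * norm w" for z w
      using K2(2)[of z w] mult_right_mono[of K2 "K1 + K2" "norm w"] K1(1) by auto
    moreover have "\<bar>q z\<bar> \<le> K1 + K2" for z using K1(2)[of z] K2(1) by linarith
    ultimately show ?thesis using K1(1) K2(1) by (intro exI[of _ "K1 + K2"]) auto
  qed
  then have "\<forall>q\<in>?Q. \<exists>K. K \<ge> 0 \<and> (\<forall>z. \<bar>q z\<bar> \<le> K) \<and> (\<forall>z w. \<bar>q (z + w) - q z\<bar> \<le> K * norm w)"
    by blast
  then obtain k where k: "\<forall>q\<in>?Q. k q \<ge> 0 \<and> (\<forall>z. \<bar>q z\<bar> \<le> k q) \<and> (\<forall>z w. \<bar>q (z + w) - q z\<bar> \<le> k q * norm w)"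
    by (rule bchoice[THEN exE])
  obtain K1 where K1: "K1 \<ge> 0" "\<And>z w. \<bar>f (z + w) - f z - ?D w z\<bar> \<le> K1 * (norm w)\<^sup>2"
    using smooth_taylor1[OF f] by blast
  obtain K2 where K2: "K2 \<ge> 0" "\<And>z w. \<bar>f (z + w) - f z - ?D w z - (1/2) * ?DD w w z\<bar> \<le> K2 * (norm w)^3"
    using smooth_taylor2[OF f] by blast
  \<comment> \<open>A sum of nonnegative constants dominates each of them, so a single
    \<open>K\<close> serves both Taylor estimates and every member of the finite family
    \<open>?Q\<close>.\<close>
  define K where "K = K1 + K2 + (\<Sum>q\<in>?Q. k q)"
  have sk: "0 \<le> (\<Sum>q\<in>?Q. k q)" using k by (intro sum_nonneg) blast
  have K1K: "K1 \<le> K" and K2K: "K2 \<le> K" and K0: "0 \<le> K"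
    using sk K1(1) K2(1) by (auto simp: K_def)
  have kK: "k q \<le> K" if "q \<in> ?Q" for q
  proof -
    have "k q \<le> (\<Sum>q\<in>?Q. k q)" by (rule member_le_sum[OF that _ finQ]) (use k in blast)
    then show ?thesis using K1(1) K2(1) by (simp add: K_def)
  qed
  have "taylor_bounds K f (?D (1, 0)) ?f1 ?f2"
    unfolding taylor_bounds_def
  proof (intro conjI allI ballI K0)
    fix t h :: real and y
    have "(h, 0) = h *\<^sub>R (1, 0::real^'n)" by simp
    then have e: "?D (h, 0) (t, y) = h * ?D (1, 0) (t, y)"
      using linear_scale[OF linear_frechet_derivative[OF smooth_differentiable[OF f(2), of "(t, y)"]], of h "(1, 0)"]
      by simp
    have "\<bar>f (t + h, y) - f (t, y) - h * ?D (1, 0) (t, y)\<bar> \<le> K1 * h\<^sup>2"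
      using K1(2)[of "(t, y)" "(h, 0)"] by (simp add: e norm_Pair)
    then show "\<bar>f (t + h, y) - f (t, y) - h * ?D (1, 0) (t, y)\<bar> \<le> K * h\<^sup>2"
      using mult_right_mono[OF K1K, of "h\<^sup>2"] by simp
  next
    fix t :: real and y w :: "real ^ 'n"
    have "\<bar>f (t, y + w) - f (t, y) - ?D (0, w) (t, y)\<bar> \<le> K1 * (norm w)\<^sup>2"
      using K1(2)[of "(t, y)" "(0, w)"] by (simp add: norm_Pair)
    then show "\<bar>f (t, y + w) - f (t, y) - (\<Sum>i\<in>UNIV. w $ i * ?f1 i (t, y))\<bar> \<le> K * (norm w)\<^sup>2"
      using mult_right_mono[OF K1K zero_le_power2, of "norm w"]
        frechet_derivative_space_sum[OF smooth_differentiable[OF f(2)], of "(t, y)" w] by linarith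
  next
    fix t :: real and y w :: "real ^ 'n"
    have "\<bar>f (t, y + w) - f (t, y) - ?D (0, w) (t, y) - (1/2) * ?DD (0, w) (0, w) (t, y)\<bar> \<le> K2 * (norm w)^3"
      using K2(2)[of "(t, y)" "(0, w)"] by (simp add: norm_Pair)
    moreover have "?DD (0, w) (0, w) (t, y) = (\<Sum>i\<in>UNIV. \<Sum>j\<in>UNIV. w $ i * w $ j * ?f2 i j (t, y))"
    proof -
      have "?DD (0, axis i 1) (0, w) (t, y) = (\<Sum>j\<in>UNIV. w $ j * ?f2 i j (t, y))" for i
        by (rule frechet_derivative_space_sum[OF smooth_differentiable[OF sD(2)]])
      then have "(\<Sum>i\<in>UNIV. w $ i * ?DD (0, axis i 1) (0, w) (t, y)) = (\<Sum>i\<in>UNIV. \<Sum>j\<in>UNIV. w $ i * w $ j * ?f2 i j (t, y))"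
        by (simp only: sum_distrib_left mult.assoc)
      with sDw[where w=w and w'=w and z="(t, y)"] show ?thesis by (rule trans)
    qed
    moreover have "?D (0, w) (t, y) = (\<Sum>i\<in>UNIV. w $ i * ?f1 i (t, y))"
      by (rule frechet_derivative_space_sum[OF smooth_differentiable[OF f(2)]])
    ultimately show "\<bar>f (t, y + w) - f (t, y) - (\<Sum>i\<in>UNIV. w $ i * ?f1 i (t, y))
         - (1/2) * (\<Sum>i\<in>UNIV. \<Sum>j\<in>UNIV. w $ i * w $ j * ?f2 i j (t, y))\<bar> \<le> K * (norm w) ^ 3"
      using mult_right_mono[OF K2K zero_le_power[OF norm_ge_zero], of w 3] by linarith
  next
    fix q assume q: "q \<in> ?Q"
    have kq: "\<forall>z. \<bar>q z\<bar> \<le> k q" "\<forall>z w. \<bar>q (z + w) - q z\<bar> \<le> k q * norm w"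
      using bspec[OF k q] by simp_all
    show "continuous_on UNIV q" using Q[OF q] smooth_continuous by blast
    show "\<bar>q z\<bar> \<le> K" for z using kq(1) kK[OF q] by (meson order_trans)
    show "\<bar>q (s, x) - q (t, y)\<bar> \<le> K * (\<bar>s - t\<bar> + norm (x - y))" for t y s x
    proof -
      have "\<bar>q ((t, y) + (s - t, x - y)) - q (t, y)\<bar> \<le> k q * norm (s - t, x - y)"
        by (rule kq(2)[rule_format])
      also have "\<dots> \<le> K * (\<bar>s - t\<bar> + norm (x - y))"
        using kK[OF q] K0 norm_Pair_le[of "s - t" "x - y"] by (intro mult_mono) auto
      finally show ?thesis by simp
    qed
  qed
  then show ?thesis using that by blast
qed

section \<open>Integrals over time intervals and the pathwise second order expansion\<close>

lemma set_integral_split_Icc: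
  fixes g :: "real \<Rightarrow> 'b::{banach, second_countable_topology}"
  assumes g: "set_integrable lborel {a..c} g" and "a \<le> b" "b \<le> c"
  shows "(\<integral>r\<in>{a..c}. g r \<partial>lborel) = (\<integral>r\<in>{a..b}. g r \<partial>lborel) + (\<integral>r\<in>{b..c}. g r \<partial>lborel)"
proof -
  have s: "{a..c} = {a..b} \<union> {b<..c}" using assms by auto
  have 1: "set_integrable lborel {a..b} g" "set_integrable lborel {b<..c} g"
    using assms by (auto intro: set_integrable_subset[OF g])
  have "(\<integral>r\<in>{a..c}. g r \<partial>lborel) = (\<integral>r\<in>{a..b}. g r \<partial>lborel) + (\<integral>r\<in>{b<..c}. g r \<partial>lborel)"
    unfolding s by (rule set_integral_Un[OF _ 1]) auto
  also have "(\<integral>r\<in>{b<..c}. g r \<partial>lborel) = (\<integral>r\<in>{b..c}. g r \<partial>lborel)"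
  proof (rule set_integral_cong_set)
    show "set_borel_measurable lborel {b<..c} g" using 1(2) unfolding set_integrable_def set_borel_measurable_def
      by (rule borel_measurable_integrable)
    have "set_integrable lborel {b..c} g" using assms by (auto intro: set_integrable_subset[OF g])
    then show "set_borel_measurable lborel {b..c} g" unfolding set_integrable_def set_borel_measurable_def
      by (rule borel_measurable_integrable)
    show "AE x in lborel. (x \<in> {b..c}) = (x \<in> {b<..c})"
      using AE_lborel_singleton[of b] by eventually_elim auto
  qed
  finally show ?thesis .
qed

lemma set_integrable_const_Icc [simp]: "set_integrable lborel {s..t::real} (\<lambda>_. c :: real)"
  by (auto simp: set_integrable_def emeasure_lborel_Icc_eq intro!: integrable_real_indicator)

lemma set_integral_const_Icc: "s \<le> t \<Longrightarrow> (\<integral>r\<in>{s..t}. c \<partial>lborel) = (t - s) * (c :: real)"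
  by (simp add: set_lebesgue_integral_def)

lemma set_integrable_of_square:
  fixes g :: "real \<Rightarrow> 'b::{banach, second_countable_topology}"
  assumes "g \<in> borel_measurable lborel" "set_integrable lborel {s..t} (\<lambda>r. (norm (g r))\<^sup>2)"
  shows "set_integrable lborel {s..t} g"
proof -
  have "set_integrable lborel {s..t} (\<lambda>r. 1 + (norm (g r))\<^sup>2)"
    using assms(2) by (intro set_integral_add) auto
  then show ?thesis unfolding set_integrable_def
  proof (rule Bochner_Integration.integrable_bound)
    show "AE r in lborel. norm (indicat_real {s..t} r *\<^sub>R g r) \<le> norm (indicat_real {s..t} r *\<^sub>R (1 + (norm (g r))\<^sup>2))"
    proof (rule AE_I2)
      fix r
      have "norm (g r) \<le> 1 + (norm (g r))\<^sup>2"
        by (rule le_one_plus_square)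
      then show "norm (indicat_real {s..t} r *\<^sub>R g r) \<le> norm (indicat_real {s..t} r *\<^sub>R (1 + (norm (g r))\<^sup>2))"
        by (auto simp: indicator_def)
    qed
  qed (use assms(1) in measurable)
qed

text \<open>Cauchy-Schwarz, read off from the nonnegativity of the integral of the squared deviation
  of \<open>norm (g r)\<close> from its mean \<open>I / ?h\<close>.\<close>

lemma set_integral_norm_square_le:
  fixes g :: "real \<Rightarrow> 'b::{banach, second_countable_topology}"
  assumes st: "s < t" and m: "g \<in> borel_measurable lborel"
    and sq: "set_integrable lborel {s..t} (\<lambda>r. (norm (g r))\<^sup>2)"
  shows "(norm (\<integral>r\<in>{s..t}. g r \<partial>lborel))\<^sup>2 \<le> (t - s) * (\<integral>r\<in>{s..t}. (norm (g r))\<^sup>2 \<partial>lborel)"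
proof -
  let ?h = "t - s" and ?S = "\<integral>r\<in>{s..t}. (norm (g r))\<^sup>2 \<partial>lborel"
  define I where "I = (\<integral>r\<in>{s..t}. norm (g r) \<partial>lborel)"
  have g: "set_integrable lborel {s..t} g" by (rule set_integrable_of_square[OF m sq])
  have n: "set_integrable lborel {s..t} (\<lambda>r. norm (g r))" by (rule set_integrable_norm[OF g])
  have "0 \<le> (\<integral>r\<in>{s..t}. (norm (g r) - I / ?h)\<^sup>2 \<partial>lborel)"
    unfolding set_lebesgue_integral_def by (intro integral_nonneg_AE AE_I2) auto
  also have "\<dots> = (\<integral>r\<in>{s..t}. ((norm (g r))\<^sup>2 - 2 * I / ?h * norm (g r)) + (I / ?h)\<^sup>2 \<partial>lborel)"
    by (intro set_lebesgue_integral_cong) (auto simp: power2_diff)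
  also have "\<dots> = (?S - 2 * I / ?h * I) + ?h * (I / ?h)\<^sup>2"
    using st sq n by (simp add: set_integral_add set_integral_diff set_integral_const_Icc I_def set_integrable_mult_right)
  also have "\<dots> = ?S - I\<^sup>2 / ?h"
  proof -
    have "(?S - 2 * I / h * I) + h * (I / h)\<^sup>2 = ?S - I\<^sup>2 / h" if "h \<noteq> 0" for h
      using that by (simp add: power2_eq_square field_simps)
    then show ?thesis using st by simp
  qed
  finally have "I\<^sup>2 \<le> ?h * ?S" using st by (simp add: field_simps)
  moreover have "norm (\<integral>r\<in>{s..t}. g r \<partial>lborel) \<le> I"
    unfolding I_def by (rule set_integral_norm_bound[OF g])
  ultimately show ?thesis by (meson norm_ge_zero order_trans power_mono)
qed

lemma vec_nth_measurable [measurable]: "(\<lambda>v :: real ^ 'n. v $ i) \<in> borel_measurable borel"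
  by (intro borel_measurable_continuous_onI continuous_intros)

lemma set_integral_sum_UNIV:
  fixes g :: "'i::finite \<Rightarrow> 'a \<Rightarrow> real"
  assumes "\<And>i. set_integrable N A (g i)"
  shows "set_integrable N A (\<lambda>x. \<Sum>i\<in>UNIV. g i x)"
    and "(\<integral>x\<in>A. (\<Sum>i\<in>UNIV. g i x) \<partial>N) = (\<Sum>i\<in>UNIV. \<integral>x\<in>A. g i x \<partial>N)"
proof -
  have e: "indicat_real A x *\<^sub>R (\<Sum>i\<in>UNIV. g i x) = (\<Sum>i\<in>UNIV. indicat_real A x *\<^sub>R g i x)" for x
    by (rule scaleR_sum_right)
  show "set_integrable N A (\<lambda>x. \<Sum>i\<in>UNIV. g i x)"
    using assms unfolding set_integrable_def e by (intro Bochner_Integration.integrable_sum) auto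
  show "(\<integral>x\<in>A. (\<Sum>i\<in>UNIV. g i x) \<partial>N) = (\<Sum>i\<in>UNIV. \<integral>x\<in>A. g i x \<partial>N)"
    using assms unfolding set_integrable_def set_lebesgue_integral_def e
    by (intro Bochner_Integration.integral_sum) auto
qed

lemma ito_pathwise:
  fixes y \<alpha> :: "real \<Rightarrow> real ^ 'n"
  assumes tb: "taylor_bounds K f f0 f1 f2" and st: "s < t" "t - s \<le> 1"
    and \<alpha>: "\<alpha> \<in> borel_measurable lborel" "set_integrable lborel {s..t} (\<lambda>r. (norm (\<alpha> r))\<^sup>2)"
    and y: "y \<in> borel_measurable lborel"
    and yt: "set_integrable lborel {s..t} (\<lambda>r. (norm (y t - y r))\<^sup>2)"
    and ys: "set_integrable lborel {s..t} (\<lambda>r. (norm (y s - y r))\<^sup>2)"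
    and incr: "y t = y s + (\<integral>r\<in>{s..t}. \<alpha> r \<partial>lborel) + \<beta>"
  defines "u \<equiv> \<lambda>r. f0 (r, y r) + (\<Sum>i\<in>UNIV. f2 i i (r, y r)) + (\<Sum>i\<in>UNIV. \<alpha> r $ i * f1 i (r, y r))"
  shows "\<bar>f (t, y t) - f (s, y s) - (\<integral>r\<in>{s..t}. u r \<partial>lborel)
      - ((\<Sum>i\<in>UNIV. \<beta> $ i * f1 i (s, y s))
         + ((1/2) * (\<Sum>i\<in>UNIV. \<Sum>j\<in>UNIV. \<beta> $ i * \<beta> $ j * f2 i j (s, y s)) - (t - s) * (\<Sum>i\<in>UNIV. f2 i i (s, y s))))\<bar>
    \<le> K * (t - s)\<^sup>2 + K * (t - s) * (\<integral>r\<in>{s..t}. (norm (\<alpha> r))\<^sup>2 \<partial>lborel) + K * (norm \<beta>)^3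
      + K * (real CARD('n) + 1) * (4 * sqrt (t - s) * ((t - s) + (\<integral>r\<in>{s..t}. (norm (\<alpha> r))\<^sup>2 \<partial>lborel))
          + ((\<integral>r\<in>{s..t}. (norm (y t - y r))\<^sup>2 \<partial>lborel) + (\<integral>r\<in>{s..t}. (norm (y s - y r))\<^sup>2 \<partial>lborel)) / sqrt (t - s))"
    (is "\<bar>?d - ?m\<bar> \<le> _ + ?c * (4 * sqrt (t - s) * ((t - s) + ?S) + (?Qt + ?Qs) / sqrt (t - s))")
    and "set_integrable lborel {s..t} u"
proof -
  note tb' = taylor_boundsD[OF tb]
  note [measurable] = \<alpha>(1) y
  let ?n = "real CARD('n)" and ?h = "t - s" and ?\<rho> = "sqrt (t - s)"
  have K: "K \<ge> 0" by (rule tb'(1))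
  have h: "?h > 0" and \<rho>: "?\<rho> > 0" using st by auto
  have \<rho>\<rho>: "?\<rho> * ?\<rho> = ?h" using h by simp
  have h\<rho>: "?h \<le> ?\<rho>"
  proof -
    have "?\<rho> * ?\<rho> \<le> ?\<rho> * 1" using st \<rho> by (intro mult_left_mono) auto
    then show ?thesis unfolding \<rho>\<rho> by simp
  qed
  have Q: "q \<in> {f, f0} \<union> range f1 \<union> (\<Union>i. range (f2 i)) \<Longrightarrow> q \<in> borel_measurable borel" for q
    by (rule borel_measurable_continuous_onI) (rule tb'(5))
  have fm: "f0 \<in> borel_measurable borel" "f1 i \<in> borel_measurable borel" "f2 i j \<in> borel_measurable borel" for i j
    by (rule Q; blast)+
  have pairm: "(\<lambda>r. (r, y r)) \<in> borel_measurable lborel"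
    by (subst borel_prod[symmetric]) measurable
  have um: "u \<in> borel_measurable lborel"
    unfolding u_def
    by (intro borel_measurable_add borel_measurable_sum borel_measurable_times measurable_compose[OF pairm]
        measurable_compose[OF \<alpha>(1) vec_nth_measurable]) (rule fm)+
  have ai: "set_integrable lborel {s..t} \<alpha>" by (rule set_integrable_of_square[OF \<alpha>])
  have an: "\<bar>\<alpha> r $ i\<bar> \<le> norm (\<alpha> r)" for r i by (rule component_le_norm_cart)
  have b0: "\<bar>f0 z\<bar> \<le> K" and b1: "\<bar>f1 i z\<bar> \<le> K" and b2: "\<bar>f2 i j z\<bar> \<le> K" for i j z
    by (rule tb'(6); blast)+
  have l0: "\<bar>f0 (s', x) - f0 (t', x')\<bar> \<le> K * (\<bar>s' - t'\<bar> + norm (x - x'))"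
    and l1: "\<bar>f1 i (s', x) - f1 i (t', x')\<bar> \<le> K * (\<bar>s' - t'\<bar> + norm (x - x'))"
    and l2: "\<bar>f2 i j (s', x) - f2 i j (t', x')\<bar> \<le> K * (\<bar>s' - t'\<bar> + norm (x - x'))"
    for i j s' t' x x'
    by (rule tb'(7); blast)+
  have ub: "\<bar>u r\<bar> \<le> K * (1 + ?n) + K * ?n * (1 + (norm (\<alpha> r))\<^sup>2)" for r
  proof -
    have "\<bar>\<Sum>i\<in>UNIV. f2 i i (r, y r)\<bar> \<le> ?n * K"
      by (rule order_trans[OF sum_abs sum_bounded_above]) (rule b2)
    moreover have "\<bar>\<Sum>i\<in>UNIV. \<alpha> r $ i * f1 i (r, y r)\<bar> \<le> ?n * (norm (\<alpha> r) * K)"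
    proof -
      have "\<bar>\<Sum>i\<in>UNIV. \<alpha> r $ i * f1 i (r, y r)\<bar> \<le> (\<Sum>i\<in>UNIV. \<bar>\<alpha> r $ i * f1 i (r, y r)\<bar>)" by (rule sum_abs)
      also have "\<dots> \<le> of_nat (card (UNIV :: 'n set)) * (norm (\<alpha> r) * K)"
        by (rule sum_bounded_above) (simp add: abs_mult an b1 mult_mono)
      finally show ?thesis .
    qed
    moreover have "?n * (norm (\<alpha> r) * K) \<le> ?n * ((1 + (norm (\<alpha> r))\<^sup>2) * K)"
      by (intro mult_left_mono mult_right_mono le_one_plus_square K) auto
    ultimately show ?thesis using b0[of "(r, y r)"] unfolding u_def by (simp add: algebra_simps)
  qed
  show ui: "set_integrable lborel {s..t} u"
  proof -
    have "set_integrable lborel {s..t} (\<lambda>r. K * (1 + ?n) + K * ?n * (1 + (norm (\<alpha> r))\<^sup>2))"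
      by (intro set_integral_add set_integrable_mult_right \<alpha>(2) set_integrable_const_Icc)
    then show ?thesis unfolding set_integrable_def
    proof (rule Bochner_Integration.integrable_bound)
      show "AE r in lborel. norm (indicat_real {s..t} r *\<^sub>R u r)
        \<le> norm (indicat_real {s..t} r *\<^sub>R (K * (1 + ?n) + K * ?n * (1 + (norm (\<alpha> r))\<^sup>2)))"
      proof (rule AE_I2)
        fix r
        show "norm (indicat_real {s..t} r *\<^sub>R u r)
          \<le> norm (indicat_real {s..t} r *\<^sub>R (K * (1 + ?n) + K * ?n * (1 + (norm (\<alpha> r))\<^sup>2)))"
          using order_trans[OF ub abs_ge_self, of r] by (auto simp: indicator_def)
      qed
    qed (use um in measurable)
  qed
  define A where "A = (\<integral>r\<in>{s..t}. \<alpha> r \<partial>lborel)"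
  have aci: "set_integrable lborel {s..t} (\<lambda>r. \<alpha> r $ i)" for i
    using integrable_bounded_linear[OF bounded_linear_vec_nth, OF ai[unfolded set_integrable_def], of i]
    unfolding set_integrable_def by simp
  have Ai: "A $ i = (\<integral>r\<in>{s..t}. \<alpha> r $ i \<partial>lborel)" for i
    using integral_bounded_linear[OF bounded_linear_vec_nth ai[unfolded set_integrable_def], of i]
    unfolding A_def set_lebesgue_integral_def by simp
  \<comment> \<open>The integrand with coefficients frozen at the points where the Taylor moves
    evaluate them: \<open>f0\<close> and \<open>f1\<close> at the end position \<open>y t\<close>,
    \<open>f2\<close> at the starting position \<open>y s\<close>, all at time
    \<open>s\<close>.\<close>
  let ?v = "\<lambda>r. f0 (s, y t) + (\<Sum>i\<in>UNIV. f2 i i (s, y s)) + (\<Sum>i\<in>UNIV. \<alpha> r $ i * f1 i (s, y t))"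
  have vi: "set_integrable lborel {s..t} ?v"
    using aci by (intro set_integral_add set_integrable_const_Icc set_integral_sum_UNIV set_integrable_mult_left) auto
  have v: "(\<integral>r\<in>{s..t}. ?v r \<partial>lborel) = ?h * f0 (s, y t) + ?h * (\<Sum>i\<in>UNIV. f2 i i (s, y s)) + (\<Sum>i\<in>UNIV. A $ i * f1 i (s, y t))"
  proof -
    have "(\<integral>r\<in>{s..t}. (\<Sum>i\<in>UNIV. \<alpha> r $ i * f1 i (s, y t)) \<partial>lborel) = (\<Sum>i\<in>UNIV. A $ i * f1 i (s, y t))"
      using aci by (subst set_integral_sum_UNIV) (auto simp: Ai)
    moreover have "set_integrable lborel {s..t} (\<lambda>r. \<Sum>i\<in>UNIV. \<alpha> r $ i * f1 i (s, y t))"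
      using aci by (intro set_integral_sum_UNIV set_integrable_mult_left) auto
    ultimately show ?thesis
      using st by (simp add: set_integral_add set_integral_const_Icc)
  qed
  let ?w = "\<lambda>r. ?c * (4 * ?\<rho> * (1 + (norm (\<alpha> r))\<^sup>2) + ((norm (y t - y r))\<^sup>2 + (norm (y s - y r))\<^sup>2) / ?\<rho>)"
  have w1: "set_integrable lborel {s..t} (\<lambda>r. 4 * ?\<rho> * (1 + (norm (\<alpha> r))\<^sup>2))"
    by (intro set_integral_add set_integrable_mult_right \<alpha>(2) set_integrable_const_Icc)
  have w2: "set_integrable lborel {s..t} (\<lambda>r. (norm (y t - y r))\<^sup>2 + (norm (y s - y r))\<^sup>2)"
    by (intro set_integral_add yt ys)
  have wi: "set_integrable lborel {s..t} ?w"
    by (intro set_integral_add set_integrable_mult_right set_integrable_divide \<alpha>(2) yt ys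
        set_integrable_const_Icc impI)
  have w: "(\<integral>r\<in>{s..t}. ?w r \<partial>lborel) = ?c * (4 * ?\<rho> * (?h + ?S) + (?Qt + ?Qs) / ?\<rho>)"
  proof -
    have "(\<integral>r\<in>{s..t}. 4 * ?\<rho> * (1 + (norm (\<alpha> r))\<^sup>2) + ((norm (y t - y r))\<^sup>2 + (norm (y s - y r))\<^sup>2) / ?\<rho> \<partial>lborel)
      = (\<integral>r\<in>{s..t}. 4 * ?\<rho> * (1 + (norm (\<alpha> r))\<^sup>2) \<partial>lborel) + (\<integral>r\<in>{s..t}. ((norm (y t - y r))\<^sup>2 + (norm (y s - y r))\<^sup>2) / ?\<rho> \<partial>lborel)"
      by (intro set_integral_add(2)[OF w1] set_integrable_divide w2)
    also have "(\<integral>r\<in>{s..t}. ((norm (y t - y r))\<^sup>2 + (norm (y s - y r))\<^sup>2) / ?\<rho> \<partial>lborel) = (?Qt + ?Qs) / ?\<rho>"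
      using set_integral_add(2)[OF yt ys] by simp
    also have "(\<integral>r\<in>{s..t}. 4 * ?\<rho> * (1 + (norm (\<alpha> r))\<^sup>2) \<partial>lborel) = 4 * ?\<rho> * (?h + ?S)"
      using set_integral_add(2)[OF set_integrable_const_Icc \<alpha>(2), of 1] set_integral_const_Icc[of s t 1] st by simp
    finally show ?thesis by simp
  qed
  have diff: "\<bar>?v r - u r\<bar> \<le> ?w r" if r: "r \<in> {s..t}" for r
  proof -
    let ?Yt = "norm (y t - y r)" and ?Ys = "norm (y s - y r)" and ?a = "norm (\<alpha> r)"
    have sr: "\<bar>s - r\<bar> \<le> ?\<rho>" using r h\<rho> by auto
    have e0: "\<bar>f0 (s, y t) - f0 (r, y r)\<bar> \<le> K * (?\<rho> + ?Yt)"
      using l0[of s "y t" r "y r"] mult_left_mono[OF add_right_mono[OF sr], of K ?Yt] K by linarith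
    have e2: "\<bar>\<Sum>i\<in>UNIV. f2 i i (s, y s) - f2 i i (r, y r)\<bar> \<le> ?n * (K * (?\<rho> + ?Ys))"
    proof -
      have "\<bar>\<Sum>i\<in>UNIV. f2 i i (s, y s) - f2 i i (r, y r)\<bar> \<le> (\<Sum>i\<in>UNIV. \<bar>f2 i i (s, y s) - f2 i i (r, y r)\<bar>)"
        by (rule sum_abs)
      also have "\<dots> \<le> of_nat (card (UNIV :: 'n set)) * (K * (?\<rho> + ?Ys))"
      proof (rule sum_bounded_above)
        fix i show "\<bar>f2 i i (s, y s) - f2 i i (r, y r)\<bar> \<le> K * (?\<rho> + ?Ys)"
          using l2[of i i s "y s" r "y r"] mult_left_mono[OF add_right_mono[OF sr], of K ?Ys] K by linarith
      qed
      finally show ?thesis .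
    qed
    have e1: "\<bar>\<Sum>i\<in>UNIV. \<alpha> r $ i * (f1 i (s, y t) - f1 i (r, y r))\<bar> \<le> ?n * (?a * (K * (?\<rho> + ?Yt)))"
    proof -
      have "\<bar>\<Sum>i\<in>UNIV. \<alpha> r $ i * (f1 i (s, y t) - f1 i (r, y r))\<bar> \<le> (\<Sum>i\<in>UNIV. \<bar>\<alpha> r $ i * (f1 i (s, y t) - f1 i (r, y r))\<bar>)"
        by (rule sum_abs)
      also have "\<dots> \<le> of_nat (card (UNIV :: 'n set)) * (?a * (K * (?\<rho> + ?Yt)))"
      proof (rule sum_bounded_above)
        fix i
        have "\<bar>f1 i (s, y t) - f1 i (r, y r)\<bar> \<le> K * (?\<rho> + ?Yt)"
          using l1[of i s "y t" r "y r"] mult_left_mono[OF add_right_mono[OF sr], of K ?Yt] K by linarith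
        then show "\<bar>\<alpha> r $ i * (f1 i (s, y t) - f1 i (r, y r))\<bar> \<le> ?a * (K * (?\<rho> + ?Yt))"
          unfolding abs_mult by (intro mult_mono an) auto
      qed
      finally show ?thesis .
    qed
    \<comment> \<open>The weight \<open>?\<rho>\<close>, the square root of the step, is the
      balanced one: mean squared displacements are of order \<open>?h\<close>, so dividing their
      time integral by \<open>?\<rho>\<close> leaves order \<open>?\<rho> * ?h\<close>, while the
      energy receives the factor \<open>?\<rho>\<close>.\<close>
    have young: "2 * x * z \<le> ?\<rho> * x\<^sup>2 + z\<^sup>2 / ?\<rho>" for x z :: real
    proof -
      have "0 \<le> (?\<rho> * x - z)\<^sup>2 / ?\<rho>" using \<rho> by (intro divide_nonneg_nonneg) auto
      also have "(p * x - z)\<^sup>2 / p = p * x\<^sup>2 + z\<^sup>2 / p - 2 * x * z" if "p > 0" for p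
        using that by (simp add: power2_eq_square field_simps)
      then have "(?\<rho> * x - z)\<^sup>2 / ?\<rho> = ?\<rho> * x\<^sup>2 + z\<^sup>2 / ?\<rho> - 2 * x * z" using \<rho> by blast
      finally show ?thesis by simp
    qed
    have a1: "?\<rho> * ?a \<le> ?\<rho> * (1 + ?a\<^sup>2)" using \<rho> by (intro mult_left_mono le_one_plus_square) auto
    have "\<bar>?v r - u r\<bar> = \<bar>(f0 (s, y t) - f0 (r, y r)) + (\<Sum>i\<in>UNIV. f2 i i (s, y s) - f2 i i (r, y r))
        + (\<Sum>i\<in>UNIV. \<alpha> r $ i * (f1 i (s, y t) - f1 i (r, y r)))\<bar>"
      unfolding u_def by (simp add: sum_subtractf right_diff_distrib)
    then have "\<bar>?v r - u r\<bar> \<le> K * (?\<rho> + ?Yt) + ?n * (K * (?\<rho> + ?Ys)) + ?n * (?a * (K * (?\<rho> + ?Yt)))"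
      using e0 e1 e2 by linarith
    also have "\<dots> = K * ((?\<rho> + ?Yt) + ?n * ((?\<rho> + ?Ys) + (?\<rho> * ?a + ?a * ?Yt)))" by (simp add: algebra_simps)
    also have "\<dots> \<le> K * ((?n + 1) * (4 * ?\<rho> * (1 + ?a\<^sup>2) + (?Yt\<^sup>2 + ?Ys\<^sup>2) / ?\<rho>))"
    proof (rule mult_left_mono[OF _ K])
      let ?W = "4 * ?\<rho> * (1 + ?a\<^sup>2) + (?Yt\<^sup>2 + ?Ys\<^sup>2) / ?\<rho>"
      have W: "?W = 4 * ?\<rho> + 4 * (?\<rho> * ?a\<^sup>2) + ?Yt\<^sup>2 / ?\<rho> + ?Ys\<^sup>2 / ?\<rho>"
        by (simp add: algebra_simps add_divide_distrib)
      have pos: "0 \<le> ?\<rho> * ?a\<^sup>2" "0 \<le> ?Yt\<^sup>2 / ?\<rho>" "0 \<le> ?Ys\<^sup>2 / ?\<rho>" using \<rho> by auto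
      have 1: "?\<rho> + ?Yt \<le> ?W"
      proof -
        have "2 * ?Yt \<le> ?\<rho> + ?Yt\<^sup>2 / ?\<rho>" using young[of 1 ?Yt] by simp
        then show ?thesis using pos \<rho> unfolding W by linarith
      qed
      have 2: "(?\<rho> + ?Ys) + (?\<rho> * ?a + ?a * ?Yt) \<le> ?W"
      proof -
        have "2 * (?a * ?Yt) \<le> ?\<rho> * ?a\<^sup>2 + ?Yt\<^sup>2 / ?\<rho>" using young[of ?a ?Yt] by (simp only: mult.assoc)
        moreover have "2 * ?Ys \<le> ?\<rho> + ?Ys\<^sup>2 / ?\<rho>" using young[of 1 ?Ys] by simp
        moreover have "?\<rho> * ?a \<le> ?\<rho> + ?\<rho> * ?a\<^sup>2" using a1 by (simp add: distrib_left)
        ultimately show ?thesis using pos \<rho> unfolding W by linarith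
      qed
      show "(?\<rho> + ?Yt) + ?n * ((?\<rho> + ?Ys) + (?\<rho> * ?a + ?a * ?Yt)) \<le> (?n + 1) * ?W"
        using mult_left_mono[OF 2, of ?n] 1 by (simp only: distrib_right mult_1) linarith
    qed
    finally show ?thesis by (simp only: mult.assoc)
  qed
  have D4: "\<bar>(\<integral>r\<in>{s..t}. ?v r \<partial>lborel) - (\<integral>r\<in>{s..t}. u r \<partial>lborel)\<bar> \<le> ?c * (4 * ?\<rho> * (?h + ?S) + (?Qt + ?Qs) / ?\<rho>)"
  proof -
    have "(\<integral>r\<in>{s..t}. ?v r \<partial>lborel) - (\<integral>r\<in>{s..t}. u r \<partial>lborel) = (\<integral>r\<in>{s..t}. ?v r - u r \<partial>lborel)"
      by (rule set_integral_diff(2)[OF vi ui, symmetric])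
    then have "\<bar>(\<integral>r\<in>{s..t}. ?v r \<partial>lborel) - (\<integral>r\<in>{s..t}. u r \<partial>lborel)\<bar> \<le> (\<integral>r\<in>{s..t}. \<bar>?v r - u r\<bar> \<partial>lborel)"
      using set_integral_norm_bound[OF set_integral_diff(1)[OF vi ui]] by simp
    also have "\<dots> \<le> (\<integral>r\<in>{s..t}. ?w r \<partial>lborel)"
    proof (rule set_integral_mono[OF _ wi diff])
      show "set_integrable lborel {s..t} (\<lambda>r. \<bar>?v r - u r\<bar>)"
        using set_integrable_abs[OF set_integral_diff(1)[OF vi ui]] .
    qed
    finally show ?thesis unfolding w .
  qed
  have A: "(norm A)\<^sup>2 \<le> ?h * ?S"
    unfolding A_def by (rule set_integral_norm_square_le[OF st(1) \<alpha>])
  have D1: "\<bar>f (t, y t) - f (s, y t) - ?h * f0 (s, y t)\<bar> \<le> K * ?h\<^sup>2"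
    using tb'(2)[of s ?h "y t"] by simp
  have D2: "\<bar>f (s, y s + \<beta>) - f (s, y t) + (\<Sum>i\<in>UNIV. A $ i * f1 i (s, y t))\<bar> \<le> K * ?h * ?S"
  proof -
    \<comment> \<open>Expanding at \<open>y t\<close> in the direction \<open>- A\<close> removes
      the drift and leaves the pure noise increment from \<open>y s\<close>.\<close>
    have "y t + - A = y s + \<beta>" using incr by (simp add: A_def)
    then have "\<bar>f (s, y s + \<beta>) - f (s, y t) + (\<Sum>i\<in>UNIV. A $ i * f1 i (s, y t))\<bar> \<le> K * (norm A)\<^sup>2"
      using tb'(3)[of s "y t" "- A"] by (simp add: sum_negf)
    also have "\<dots> \<le> K * (?h * ?S)" by (rule mult_left_mono[OF A K])
    finally show ?thesis by (simp only: mult.assoc)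
  qed
  have D3: "\<bar>f (s, y s + \<beta>) - f (s, y s) - (\<Sum>i\<in>UNIV. \<beta> $ i * f1 i (s, y s))
      - (1/2) * (\<Sum>i\<in>UNIV. \<Sum>j\<in>UNIV. \<beta> $ i * \<beta> $ j * f2 i j (s, y s))\<bar> \<le> K * (norm \<beta>)^3"
    by (rule tb'(4))
  show "\<bar>?d - ?m\<bar> \<le> K * ?h\<^sup>2 + K * ?h * ?S + K * (norm \<beta>)^3 + ?c * (4 * ?\<rho> * (?h + ?S) + (?Qt + ?Qs) / ?\<rho>)"
    using D1 D2 D3 D4 unfolding v by linarith
qed

section \<open>The Ito formula in mean\<close>

lemma indicator_fst_measurable:
  "(\<lambda>x. indicat_real {s..t :: real} (fst x)) \<in> borel_measurable (lborel \<Otimes>\<^sub>M N)"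
  by (rule measurable_compose[OF measurable_fst]) simp

text \<open>One particle, reduced to what the mean formula consumes: the noise enters through its
  first two moments tested against bounded functions of the position at the start of the step, and
  through bounds on its second and fourth moments. The increment identity holds almost surely for
  each pair of times separately. \<open>B s t\<close> is the increment before the factor
  \<open>sqrt 2\<close>.\<close>

locale drift_diffusion = prob_space M for M :: "'w measure" +
  fixes a b c :: real and \<alpha> Y :: "real \<Rightarrow> 'w \<Rightarrow> real ^ 'n" and B :: "real \<Rightarrow> real \<Rightarrow> 'w \<Rightarrow> real ^ 'n"
  assumes ab: "a \<le> b" and c: "c \<ge> 0"
    and \<alpha>_meas [measurable]: "(\<lambda>(t, \<omega>). \<alpha> t \<omega>) \<in> borel_measurable (lborel \<Otimes>\<^sub>M M)"
    and \<alpha>_int: "integrable (lborel \<Otimes>\<^sub>M M) (\<lambda>(t, \<omega>). (norm (\<alpha> t \<omega>))\<^sup>2)"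
    and Y_meas [measurable]: "(\<lambda>(t, \<omega>). Y t \<omega>) \<in> borel_measurable (lborel \<Otimes>\<^sub>M M)"
    and B_meas: "\<And>s t. a \<le> s \<Longrightarrow> s < t \<Longrightarrow> t \<le> b \<Longrightarrow> B s t \<in> borel_measurable M"
    and incr: "\<And>s t. a \<le> s \<Longrightarrow> s < t \<Longrightarrow> t \<le> b \<Longrightarrow>
      AE \<omega> in M. Y t \<omega> = Y s \<omega> + (\<integral>r\<in>{s..t}. \<alpha> r \<omega> \<partial>lborel) + sqrt 2 *\<^sub>R B s t \<omega>"
    and B_first: "\<And>s t \<eta> C i. a \<le> s \<Longrightarrow> s < t \<Longrightarrow> t \<le> b \<Longrightarrow> \<eta> \<in> borel_measurable borel \<Longrightarrow> (\<And>y. \<bar>\<eta> y :: real\<bar> \<le> C) \<Longrightarrow>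
      has_bochner_integral M (\<lambda>\<omega>. \<eta> (Y s \<omega>) * B s t \<omega> $ i) 0"
    and B_second: "\<And>s t \<eta> C i j. a \<le> s \<Longrightarrow> s < t \<Longrightarrow> t \<le> b \<Longrightarrow> \<eta> \<in> borel_measurable borel \<Longrightarrow> (\<And>y. \<bar>\<eta> y :: real\<bar> \<le> C) \<Longrightarrow>
      has_bochner_integral M (\<lambda>\<omega>. \<eta> (Y s \<omega>) * (B s t \<omega> $ i * B s t \<omega> $ j))
        ((if i = j then t - s else 0) * (\<integral>\<omega>. \<eta> (Y s \<omega>) \<partial>M))"
    and B_norm2: "\<And>s t. a \<le> s \<Longrightarrow> s < t \<Longrightarrow> t \<le> b \<Longrightarrow>
      integrable M (\<lambda>\<omega>. (norm (B s t \<omega>))\<^sup>2) \<and> (\<integral>\<omega>. (norm (B s t \<omega>))\<^sup>2 \<partial>M) \<le> c * (t - s)"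
    and B_norm4: "\<And>s t. a \<le> s \<Longrightarrow> s < t \<Longrightarrow> t \<le> b \<Longrightarrow>
      integrable M (\<lambda>\<omega>. (norm (B s t \<omega>))^4) \<and> (\<integral>\<omega>. (norm (B s t \<omega>))^4 \<partial>M) \<le> c * (t - s)\<^sup>2"
begin

sublocale pair: pair_sigma_finite lborel M ..

definition energy :: "real \<Rightarrow> real \<Rightarrow> 'w \<Rightarrow> real" where
  "energy s t \<omega> = (\<integral>r\<in>{s..t}. (norm (\<alpha> r \<omega>))\<^sup>2 \<partial>lborel)"

lemma \<alpha>_path_measurable: "\<omega> \<in> space M \<Longrightarrow> (\<lambda>r. \<alpha> r \<omega>) \<in> borel_measurable lborel"
  using measurable_compose[OF measurable_Pair2' \<alpha>_meas] by simp

lemma Y_path_measurable: "\<omega> \<in> space M \<Longrightarrow> (\<lambda>r. Y r \<omega>) \<in> borel_measurable lborel"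
  using measurable_compose[OF measurable_Pair2' Y_meas] by simp

lemma Y_measurable [measurable]: "Y t \<in> borel_measurable M"
  using measurable_compose[OF measurable_Pair1' Y_meas, of t] by simp

lemma restricted_integrable:
  fixes g :: "real \<Rightarrow> 'w \<Rightarrow> real"
  assumes "integrable (lborel \<Otimes>\<^sub>M M) (\<lambda>(r, \<omega>). g r \<omega>)"
  shows "integrable (lborel \<Otimes>\<^sub>M M) (\<lambda>(r, \<omega>). indicat_real {s..t} r *\<^sub>R g r \<omega>)"
proof (rule Bochner_Integration.integrable_bound[OF assms])
  have "(\<lambda>(r, \<omega>). g r \<omega>) \<in> borel_measurable (lborel \<Otimes>\<^sub>M M)"
    using assms by (rule borel_measurable_integrable)
  then show "(\<lambda>(r, \<omega>). indicat_real {s..t} r *\<^sub>R g r \<omega>) \<in> borel_measurable (lborel \<Otimes>\<^sub>M M)"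
    unfolding case_prod_unfold by (intro borel_measurable_scaleR indicator_fst_measurable)
qed (auto simp: indicator_def)

lemma energy_path: "AE \<omega> in M. set_integrable lborel {s..t} (\<lambda>r. (norm (\<alpha> r \<omega>))\<^sup>2)"
  unfolding set_integrable_def using pair.AE_integrable_snd[OF restricted_integrable[OF \<alpha>_int]] by simp

lemma energy_integrable: "integrable M (energy s t)"
  unfolding energy_def set_lebesgue_integral_def
  using pair.integrable_snd[OF restricted_integrable[OF \<alpha>_int]] by simp

lemma energy_nonneg: "0 \<le> energy s t \<omega>"
  unfolding energy_def set_lebesgue_integral_def by (intro integral_nonneg_AE AE_I2) auto

lemma energy_split:
  assumes "r \<le> s" "s \<le> t"
  shows "(\<integral>\<omega>. energy r t \<omega> \<partial>M) = (\<integral>\<omega>. energy r s \<omega> \<partial>M) + (\<integral>\<omega>. energy s t \<omega> \<partial>M)"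
proof -
  have "(\<integral>\<omega>. energy r t \<omega> \<partial>M) = (\<integral>\<omega>. energy r s \<omega> + energy s t \<omega> \<partial>M)"
  proof (rule integral_cong_AE)
    show "AE \<omega> in M. energy r t \<omega> = energy r s \<omega> + energy s t \<omega>"
      using energy_path[of r t] unfolding energy_def
      by eventually_elim (rule set_integral_split_Icc[OF _ assms])
  qed (use energy_integrable in \<open>auto intro!: borel_measurable_add borel_measurable_integrable\<close>)
  then show ?thesis by (simp add: energy_integrable)
qed

text \<open>The constant comes from \<open>displacement\<close>: the squared increment is at most
  twice the squared drift integral plus four times the squared noise, and Cauchy-Schwarz bounds the
  squared drift integral by the step times the energy.\<close>

definition c_disp :: real where "c_disp = 2 * (\<integral>\<omega>. energy a b \<omega> \<partial>M) + 4 * c"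

lemma c_disp_nonneg: "0 \<le> c_disp"
  unfolding c_disp_def using c energy_nonneg by (simp add: integral_nonneg_AE)

lemma displacement:
  assumes st: "a \<le> s" "s \<le> t" "t \<le> b" and h1: "t - s \<le> 1"
  shows "integrable M (\<lambda>\<omega>. (norm (Y t \<omega> - Y s \<omega>))\<^sup>2)"
    and "(\<integral>\<omega>. (norm (Y t \<omega> - Y s \<omega>))\<^sup>2 \<partial>M) \<le> c_disp * (t - s)"
proof -
  have "integrable M (\<lambda>\<omega>. (norm (Y t \<omega> - Y s \<omega>))\<^sup>2) \<and> (\<integral>\<omega>. (norm (Y t \<omega> - Y s \<omega>))\<^sup>2 \<partial>M) \<le> c_disp * (t - s)"
  proof (cases "s = t")
    case False
    then have lt: "s < t" using st by simp
    let ?R = "\<lambda>\<omega>. 2 * ((t - s) * energy s t \<omega>) + 4 * (norm (B s t \<omega>))\<^sup>2"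
    note B2 = B_norm2[OF st(1) lt st(3)]
    have R: "integrable M ?R" using B2 energy_integrable by simp
    have le: "AE \<omega> in M. (norm (Y t \<omega> - Y s \<omega>))\<^sup>2 \<le> ?R \<omega>"
      using incr[OF st(1) lt st(3)] energy_path[of s t] AE_space
    proof eventually_elim
      case (elim \<omega>)
      let ?A = "\<integral>r\<in>{s..t}. \<alpha> r \<omega> \<partial>lborel"
      have "(norm ?A)\<^sup>2 \<le> (t - s) * energy s t \<omega>"
        unfolding energy_def by (rule set_integral_norm_square_le[OF lt \<alpha>_path_measurable[OF elim(3)] elim(2)])
      moreover have "(norm (x + sqrt 2 *\<^sub>R y))\<^sup>2 \<le> 2 * (norm x)\<^sup>2 + 4 * (norm y)\<^sup>2" for x y :: "real ^ 'n"
      proof -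
        have "(norm (x + sqrt 2 *\<^sub>R y))\<^sup>2 \<le> (norm x + sqrt 2 * norm y)\<^sup>2"
          using norm_triangle_ineq[of x "sqrt 2 *\<^sub>R y"] by (intro power_mono) auto
        also have "\<dots> \<le> 2 * (norm x)\<^sup>2 + 2 * (sqrt 2 * norm y)\<^sup>2"
          using zero_le_power2[of "norm x - sqrt 2 * norm y"] by (simp add: power2_sum power2_diff)
        finally show ?thesis by (simp add: power_mult_distrib)
      qed
      moreover have "Y t \<omega> - Y s \<omega> = ?A + sqrt 2 *\<^sub>R B s t \<omega>" using elim(1) by simp
      ultimately show ?case by (smt (verit))
    qed
    have i: "integrable M (\<lambda>\<omega>. (norm (Y t \<omega> - Y s \<omega>))\<^sup>2)"
    proof (rule Bochner_Integration.integrable_bound[OF R])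
      show "AE \<omega> in M. norm ((norm (Y t \<omega> - Y s \<omega>))\<^sup>2) \<le> norm (?R \<omega>)"
        using le by eventually_elim simp
    qed measurable
    have "(\<integral>\<omega>. (norm (Y t \<omega> - Y s \<omega>))\<^sup>2 \<partial>M) \<le> (\<integral>\<omega>. ?R \<omega> \<partial>M)"
      by (rule integral_mono_AE[OF i R le])
    also have "\<dots> = 2 * ((t - s) * (\<integral>\<omega>. energy s t \<omega> \<partial>M)) + 4 * (\<integral>\<omega>. (norm (B s t \<omega>))\<^sup>2 \<partial>M)"
      using B2 energy_integrable by simp
    also have "\<dots> \<le> 2 * ((t - s) * (\<integral>\<omega>. energy a b \<omega> \<partial>M)) + 4 * (c * (t - s))"
    proof -
      have nn: "0 \<le> (\<integral>\<omega>. energy x y \<omega> \<partial>M)" for x y by (simp add: integral_nonneg_AE energy_nonneg)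
      have "(\<integral>\<omega>. energy s t \<omega> \<partial>M) \<le> (\<integral>\<omega>. energy a b \<omega> \<partial>M)"
        using energy_split[of a s b] energy_split[of s t b] st nn[of a s] nn[of t b] by linarith
      then show ?thesis using B2 st(2) by (intro add_mono mult_left_mono) auto
    qed
    finally show ?thesis using i by (simp add: c_disp_def algebra_simps)
  qed auto
  then show "integrable M (\<lambda>\<omega>. (norm (Y t \<omega> - Y s \<omega>))\<^sup>2)"
    "(\<integral>\<omega>. (norm (Y t \<omega> - Y s \<omega>))\<^sup>2 \<partial>M) \<le> c_disp * (t - s)" by auto
qed

text \<open>Tonelli's theorem turns a bound on the expectation at each time into integrability in
  time of almost every path. It is meant for squared displacements.\<close>

lemma time_averaged:
  fixes q :: "real \<Rightarrow> 'w \<Rightarrow> real"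
  assumes st: "s \<le> t" and q: "(\<lambda>(r, \<omega>). q r \<omega>) \<in> borel_measurable (lborel \<Otimes>\<^sub>M M)"
    and nn: "\<And>r \<omega>. 0 \<le> q r \<omega>"
    and bd: "\<forall>r\<in>{s..t}. integrable M (q r) \<and> (\<integral>\<omega>. q r \<omega> \<partial>M) \<le> C"
  shows "AE \<omega> in M. set_integrable lborel {s..t} (\<lambda>r. q r \<omega>)"
    and "integrable M (\<lambda>\<omega>. \<integral>r\<in>{s..t}. q r \<omega> \<partial>lborel)"
    and "(\<integral>\<omega>. (\<integral>r\<in>{s..t}. q r \<omega> \<partial>lborel) \<partial>M) \<le> C * (t - s)"
proof -
  let ?g = "\<lambda>(r, \<omega>). indicat_real {s..t} r *\<^sub>R q r \<omega>"
  have m: "?g \<in> borel_measurable (lborel \<Otimes>\<^sub>M M)"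
    using q unfolding case_prod_unfold by (intro borel_measurable_scaleR indicator_fst_measurable)
  have C: "0 \<le> C"
  proof -
    have "0 \<le> (\<integral>\<omega>. q s \<omega> \<partial>M)" by (intro integral_nonneg_AE AE_I2 nn)
    then show ?thesis using bspec[OF bd, of s] st by fastforce
  qed
  have e: "(\<integral>\<omega>. ?g (r, \<omega>) \<partial>M) = indicat_real {s..t} r * (\<integral>\<omega>. q r \<omega> \<partial>M)" for r
    by simp
  have mi: "(\<lambda>r. \<integral>\<omega>. ?g (r, \<omega>) \<partial>M) \<in> borel_measurable lborel"
    using borel_measurable_lebesgue_integral[of "\<lambda>r \<omega>. indicat_real {s..t} r *\<^sub>R q r \<omega>" lborel] m by simp
  have bi: "integrable lborel (\<lambda>r. indicat_real {s..t} r *\<^sub>R C)"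
    using set_integrable_const_Icc[of s t C] by (simp add: set_integrable_def)
  have le: "(\<integral>\<omega>. ?g (r, \<omega>) \<partial>M) \<le> indicat_real {s..t} r *\<^sub>R C" for r
    using bd by (auto simp: indicator_def)
  have nng: "0 \<le> (\<integral>\<omega>. ?g (r, \<omega>) \<partial>M)" for r using nn by (intro integral_nonneg_AE AE_I2) (auto simp: indicator_def)
  have i1: "integrable lborel (\<lambda>r. \<integral>\<omega>. ?g (r, \<omega>) \<partial>M)"
    by (rule Bochner_Integration.integrable_bound[OF bi mi])
      (use le nng C in \<open>auto intro!: AE_I2 order_trans[OF _ abs_ge_self]\<close>)
  have n: "norm (?g (r, \<omega>)) = ?g (r, \<omega>)" for r \<omega> using nn by (auto simp: indicator_def)
  have ig: "integrable (lborel \<Otimes>\<^sub>M M) ?g"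
  proof (rule pair.Fubini_integrable[OF m])
    show "integrable lborel (\<lambda>r. \<integral>\<omega>. norm (?g (r, \<omega>)) \<partial>M)" using i1 by (simp only: n)
    show "AE r in lborel. integrable M (\<lambda>\<omega>. ?g (r, \<omega>))"
      using bd by (intro AE_I2) (auto simp: indicator_def)
  qed
  then have ig': "integrable (lborel \<Otimes>\<^sub>M M) (case_prod (\<lambda>r \<omega>. indicat_real {s..t} r *\<^sub>R q r \<omega>))" .
  show "AE \<omega> in M. set_integrable lborel {s..t} (\<lambda>r. q r \<omega>)"
    unfolding set_integrable_def by (rule pair.AE_integrable_snd[OF ig'])
  show "integrable M (\<lambda>\<omega>. \<integral>r\<in>{s..t}. q r \<omega> \<partial>lborel)"
    unfolding set_lebesgue_integral_def by (rule pair.integrable_snd[OF ig'])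
  have "(\<integral>\<omega>. (\<integral>r\<in>{s..t}. q r \<omega> \<partial>lborel) \<partial>M) = (\<integral>r. (\<integral>\<omega>. indicat_real {s..t} r *\<^sub>R q r \<omega> \<partial>M) \<partial>lborel)"
    unfolding set_lebesgue_integral_def using pair.Fubini_integral[OF ig'] by simp
  also have "\<dots> \<le> (\<integral>r. indicat_real {s..t} r *\<^sub>R C \<partial>lborel)"
    by (rule integral_mono) (use i1 bi le in auto)
  also have "\<dots> = C * (t - s)"
    using set_integral_const_Icc[OF st, of C] by (simp add: set_lebesgue_integral_def mult.commute)
  finally show "(\<integral>\<omega>. (\<integral>r\<in>{s..t}. q r \<omega> \<partial>lborel) \<partial>M) \<le> C * (t - s)" .
qed

text \<open>The generator of the controlled diffusion applied to \<open>f\<close>. The Laplacian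
  appears without the factor one half because the noise is \<open>sqrt 2\<close> times a standard
  one.\<close>

definition drift_of ::
    "(real \<times> (real ^ 'n) \<Rightarrow> real) \<Rightarrow> ('n \<Rightarrow> real \<times> (real ^ 'n) \<Rightarrow> real)
      \<Rightarrow> ('n \<Rightarrow> 'n \<Rightarrow> real \<times> (real ^ 'n) \<Rightarrow> real) \<Rightarrow> real \<Rightarrow> 'w \<Rightarrow> real" where
  "drift_of f0 f1 f2 r \<omega> = f0 (r, Y r \<omega>) + (\<Sum>i\<in>UNIV. f2 i i (r, Y r \<omega>))
     + (\<Sum>i\<in>UNIV. \<alpha> r \<omega> $ i * f1 i (r, Y r \<omega>))"

text \<open>In expectation the bracketed terms of \<open>ito_pathwise\<close> disappear by
  \<open>B_first\<close> and \<open>B_second\<close>. In the constant, \<open>6 * c\<close> collects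
  \<open>2 * c\<close> and \<open>4 * c\<close> from the second and fourth moments that control the
  cubic error, and \<open>2 * c_disp\<close> the displacements from the two ends of the step; each
  contributes at order \<open>sqrt (t - s) * (t - s)\<close>.\<close>

lemma ito_increment:
  assumes tb: "taylor_bounds K f f0 f1 f2" and st: "a \<le> s" "s < t" "t \<le> b" and h1: "t - s \<le> 1"
    and ui: "integrable M (\<lambda>\<omega>. \<integral>r\<in>{s..t}. drift_of f0 f1 f2 r \<omega> \<partial>lborel)"
  shows "\<bar>(\<integral>\<omega>. f (t, Y t \<omega>) \<partial>M) - (\<integral>\<omega>. f (s, Y s \<omega>) \<partial>M)
        - (\<integral>\<omega>. (\<integral>r\<in>{s..t}. drift_of f0 f1 f2 r \<omega> \<partial>lborel) \<partial>M)\<bar>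
    \<le> K * (1 + 6 * c + (real CARD('n) + 1) * (4 + 2 * c_disp)) * sqrt (t - s) * ((t - s) + (\<integral>\<omega>. energy s t \<omega> \<partial>M))"
proof -
  let ?h = "t - s" and ?\<rho> = "sqrt (t - s)" and ?u = "drift_of f0 f1 f2" and ?n = "real CARD('n)"
  let ?\<beta> = "\<lambda>\<omega>. sqrt 2 *\<^sub>R B s t \<omega>"
  let ?U = "\<lambda>\<omega>. \<integral>r\<in>{s..t}. ?u r \<omega> \<partial>lborel"
  note tb' = taylor_boundsD[OF tb]
  have K: "K \<ge> 0" by (rule tb'(1))
  have h: "?h > 0" and \<rho>: "?\<rho> > 0" using st by auto
  have \<rho>\<rho>: "?\<rho> * ?\<rho> = ?h" using h by simp
  have h\<rho>: "?h \<le> ?\<rho>"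
  proof -
    have "?\<rho> * ?\<rho> \<le> ?\<rho> * 1" using h1 \<rho> by (intro mult_left_mono) auto
    then show ?thesis unfolding \<rho>\<rho> by simp
  qed
  have cP: "continuous_on UNIV (Pair s' :: real ^ 'n \<Rightarrow> _)" for s' :: real by (intro continuous_intros)
  have Qm: "(\<lambda>y. q (s', y)) \<in> borel_measurable borel" if q: "q \<in> {f, f0} \<union> range f1 \<union> (\<Union>i. range (f2 i))" for q s'
    by (rule borel_measurable_continuous_onI[OF continuous_on_compose2[OF tb'(5)[OF q] cP]]) simp
  have fm: "(\<lambda>y. f (s', y)) \<in> borel_measurable borel" "(\<lambda>y. f1 i (s', y)) \<in> borel_measurable borel"
    "(\<lambda>y. f2 i j (s', y)) \<in> borel_measurable borel" for s' i j
    by (rule Qm; blast)+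
  have fb: "\<bar>f z\<bar> \<le> K" and b1: "\<bar>f1 i z\<bar> \<le> K" and b2: "\<bar>f2 i j z\<bar> \<le> K" for i j z
    by (rule tb'(6); blast)+
  have fi: "integrable M (\<lambda>\<omega>. f (s', Y s' \<omega>))" for s'
    by (rule integrable_const_bound[of _ K]) (use fb measurable_compose[OF Y_measurable fm(1)] in auto)
  have B1: "has_bochner_integral M (\<lambda>\<omega>. \<Sum>i\<in>UNIV. ?\<beta> \<omega> $ i * f1 i (s, Y s \<omega>)) 0"
  proof -
    have "has_bochner_integral M (\<lambda>\<omega>. sqrt 2 * (f1 i (s, Y s \<omega>) * B s t \<omega> $ i)) (sqrt 2 * 0)" for i
      by (intro has_bochner_integral_mult_right B_first[OF st fm(2) b1])
    then have "has_bochner_integral M (\<lambda>\<omega>. \<Sum>i\<in>UNIV. sqrt 2 * (f1 i (s, Y s \<omega>) * B s t \<omega> $ i)) (\<Sum>i\<in>(UNIV::'n set). sqrt 2 * 0)"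
      by (intro has_bochner_integral_sum)
    then show ?thesis by (simp add: mult_ac)
  qed
  have f2i: "integrable M (\<lambda>\<omega>. f2 i j (s, Y s \<omega>))" for i j
    by (rule integrable_const_bound[of _ K]) (use b2 measurable_compose[OF Y_measurable fm(3)] in auto)
  have B2: "has_bochner_integral M (\<lambda>\<omega>. (1/2) * (\<Sum>i\<in>UNIV. \<Sum>j\<in>UNIV. ?\<beta> \<omega> $ i * ?\<beta> \<omega> $ j * f2 i j (s, Y s \<omega>)) - ?h * (\<Sum>i\<in>UNIV. f2 i i (s, Y s \<omega>))) 0"
  proof -
    have "has_bochner_integral M (\<lambda>\<omega>. \<Sum>i\<in>UNIV. \<Sum>j\<in>UNIV. f2 i j (s, Y s \<omega>) * (B s t \<omega> $ i * B s t \<omega> $ j))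
      (\<Sum>i\<in>UNIV. \<Sum>j\<in>UNIV. (if i = j then ?h else 0) * (\<integral>\<omega>. f2 i j (s, Y s \<omega>) \<partial>M))"
      by (intro has_bochner_integral_sum B_second[OF st fm(3) b2])
    moreover have "(\<Sum>i\<in>UNIV. \<Sum>j\<in>UNIV. (if i = j then ?h else 0) * (\<integral>\<omega>. f2 i j (s, Y s \<omega>) \<partial>M))
      = ?h * (\<Sum>i\<in>UNIV. (\<integral>\<omega>. f2 i i (s, Y s \<omega>) \<partial>M))"
      by (simp add: if_distrib[where f="\<lambda>x. x * _"] sum_distrib_left cong: if_cong)
    moreover have "(1/2) * (\<Sum>i\<in>UNIV. \<Sum>j\<in>UNIV. ?\<beta> \<omega> $ i * ?\<beta> \<omega> $ j * f2 i j (s, Y s \<omega>))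
      = (\<Sum>i\<in>UNIV. \<Sum>j\<in>UNIV. f2 i j (s, Y s \<omega>) * (B s t \<omega> $ i * B s t \<omega> $ j))" for \<omega>
    proof -
      have "(1/2) * (?\<beta> \<omega> $ i * ?\<beta> \<omega> $ j * f2 i j (s, Y s \<omega>)) = f2 i j (s, Y s \<omega>) * (B s t \<omega> $ i * B s t \<omega> $ j)" for i j
      proof -
        have "(sqrt 2 * x) * (sqrt 2 * y) = 2 * (x * y)" for x y :: real
          using real_sqrt_mult_self[of 2] by (simp add: mult_ac)
        then show ?thesis by simp
      qed
      then show ?thesis by (simp only: sum_distrib_left)
    qed
    moreover have "has_bochner_integral M (\<lambda>\<omega>. ?h * (\<Sum>i\<in>UNIV. f2 i i (s, Y s \<omega>))) (?h * (\<Sum>i\<in>UNIV. (\<integral>\<omega>. f2 i i (s, Y s \<omega>) \<partial>M)))"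
      by (intro has_bochner_integral_mult_right has_bochner_integral_sum has_bochner_integral_integrable f2i)
    ultimately show ?thesis
      using has_bochner_integral_diff by fastforce
  qed
  let ?m = "\<lambda>\<omega>. (\<Sum>i\<in>UNIV. ?\<beta> \<omega> $ i * f1 i (s, Y s \<omega>))
         + ((1/2) * (\<Sum>i\<in>UNIV. \<Sum>j\<in>UNIV. ?\<beta> \<omega> $ i * ?\<beta> \<omega> $ j * f2 i j (s, Y s \<omega>)) - ?h * (\<Sum>i\<in>UNIV. f2 i i (s, Y s \<omega>)))"
  have m: "integrable M ?m" "(\<integral>\<omega>. ?m \<omega> \<partial>M) = 0"
    using has_bochner_integral_add[OF B1 B2] by (simp_all add: has_bochner_integral_iff)
  let ?qt = "\<lambda>r \<omega>. (norm (Y t \<omega> - Y r \<omega>))\<^sup>2" and ?qs = "\<lambda>r \<omega>. (norm (Y s \<omega> - Y r \<omega>))\<^sup>2"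
  let ?Qt = "\<lambda>\<omega>. \<integral>r\<in>{s..t}. ?qt r \<omega> \<partial>lborel" and ?Qs = "\<lambda>\<omega>. \<integral>r\<in>{s..t}. ?qs r \<omega> \<partial>lborel"
  have Cle: "c_disp * (x - y) \<le> c_disp * ?h" if "x - y \<le> ?h" for x y
    using that c_disp_nonneg by (rule mult_left_mono)
  have qtb: "\<forall>r\<in>{s..t}. integrable M (?qt r) \<and> (\<integral>\<omega>. ?qt r \<omega> \<partial>M) \<le> c_disp * ?h"
  proof
    fix r assume r: "r \<in> {s..t}"
    show "integrable M (?qt r) \<and> (\<integral>\<omega>. ?qt r \<omega> \<partial>M) \<le> c_disp * ?h"
      using displacement[of r t] r st h1 Cle[of t r] by auto
  qed
  have qsb: "\<forall>r\<in>{s..t}. integrable M (?qs r) \<and> (\<integral>\<omega>. ?qs r \<omega> \<partial>M) \<le> c_disp * ?h"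
  proof
    fix r assume r: "r \<in> {s..t}"
    show "integrable M (?qs r) \<and> (\<integral>\<omega>. ?qs r \<omega> \<partial>M) \<le> c_disp * ?h"
      using displacement[of s r] r st h1 Cle[of r s] by (auto simp: norm_minus_commute)
  qed
  have mY: "(\<lambda>(r, \<omega>). (norm (Y s' \<omega> - Y r \<omega>))\<^sup>2) \<in> borel_measurable (lborel \<Otimes>\<^sub>M M)" for s'
    using Y_meas by (simp add: case_prod_unfold) measurable
  note Qt = time_averaged[OF less_imp_le[OF st(2)] mY[of t] zero_le_power2 qtb]
  note Qs = time_averaged[OF less_imp_le[OF st(2)] mY[of s] zero_le_power2 qsb]
  note N2 = B_norm2[OF st] and N4 = B_norm4[OF st]
  \<comment> \<open>The pathwise bound with the cubic noise term already replaced by second and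
    fourth moments, the ones whose integrals are bounded in the locale.\<close>
  let ?R = "\<lambda>\<omega>. K * ?h\<^sup>2 + K * ?h * energy s t \<omega> + K * (?\<rho> * (norm (B s t \<omega>))\<^sup>2 * 2 + 4 * (norm (B s t \<omega>))^4 / ?\<rho>)
      + K * (real CARD('n) + 1) * (4 * ?\<rho> * (?h + energy s t \<omega>) + (?Qt \<omega> + ?Qs \<omega>) / ?\<rho>)"
  let ?D = "\<lambda>\<omega>. f (t, Y t \<omega>) - f (s, Y s \<omega>) - ?U \<omega> - ?m \<omega>"
  have R: "integrable M ?R" using N2 N4 Qt(2) Qs(2) energy_integrable by simp
  have D: "integrable M ?D" using fi ui m(1) by simp
  have DR: "AE \<omega> in M. \<bar>?D \<omega>\<bar> \<le> ?R \<omega>"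
    using incr[OF st] energy_path[of s t] Qt(1) Qs(1) AE_space
  proof eventually_elim
    case (elim \<omega>)
    have "\<bar>?D \<omega>\<bar> \<le> K * ?h\<^sup>2 + K * ?h * energy s t \<omega> + K * (norm (?\<beta> \<omega>))^3
      + K * (real CARD('n) + 1) * (4 * ?\<rho> * (?h + energy s t \<omega>) + (?Qt \<omega> + ?Qs \<omega>) / ?\<rho>)"
      unfolding energy_def drift_of_def
      by (rule ito_pathwise(1)[OF tb st(2) h1 \<alpha>_path_measurable[OF elim(5)] elim(2) Y_path_measurable[OF elim(5)] elim(3,4,1)])
    moreover have "K * (norm (?\<beta> \<omega>))^3 \<le> K * (?\<rho> * (norm (B s t \<omega>))\<^sup>2 * 2 + 4 * (norm (B s t \<omega>))^4 / ?\<rho>)"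
    proof (rule mult_left_mono[OF _ K])
      let ?x = "norm (?\<beta> \<omega>)"
      have x2: "?x\<^sup>2 = 2 * (norm (B s t \<omega>))\<^sup>2" by (simp add: power_mult_distrib)
      have x4: "?x^4 = 4 * (norm (B s t \<omega>))^4"
      proof -
        have "?x^4 = (?x\<^sup>2)\<^sup>2" by (simp only: flip: power_mult) simp
        then show ?thesis unfolding x2 by (simp add: power_mult_distrib flip: power_mult)
      qed
      \<comment> \<open>After cancelling a square this is \<open>p * x\<close> against
        \<open>p\<^sup>2 + x\<^sup>2\<close>. With \<open>p\<close> the square root of the step,
        both terms on the right have the same order in expectation.\<close>
      have y: "x^3 \<le> p * x\<^sup>2 + x^4 / p" if "p > 0" for p x :: real
      proof -
        have "2 * (p * x) \<le> p\<^sup>2 + x\<^sup>2" using zero_le_power2[of "p - x"] by (simp add: power2_diff)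
        moreover have "0 \<le> p\<^sup>2 + x\<^sup>2" by simp
        ultimately have "p * x \<le> p\<^sup>2 + x\<^sup>2" by linarith
        then have "x\<^sup>2 * (p * x) \<le> x\<^sup>2 * (p\<^sup>2 + x\<^sup>2)" by (intro mult_left_mono) auto
        then have "p * x^3 \<le> p * (p * x\<^sup>2) + x^4"
          by (simp add: power2_eq_square power3_eq_cube power4_eq_xxxx algebra_simps)
        then show ?thesis using that by (simp add: field_simps)
      qed
      show "?x^3 \<le> ?\<rho> * (norm (B s t \<omega>))\<^sup>2 * 2 + 4 * (norm (B s t \<omega>))^4 / ?\<rho>"
        using y[OF \<rho>, of ?x] unfolding x2 x4 by (simp only: mult_ac)
    qed
    ultimately show ?case by linarith
  qed
  have "\<bar>\<integral>\<omega>. ?D \<omega> \<partial>M\<bar> \<le> (\<integral>\<omega>. \<bar>?D \<omega>\<bar> \<partial>M)" by (rule integral_abs_bound)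
  moreover have "(\<integral>\<omega>. \<bar>?D \<omega>\<bar> \<partial>M) \<le> (\<integral>\<omega>. ?R \<omega> \<partial>M)"
    by (rule integral_mono_AE[OF integrable_abs[OF D] R DR])
  moreover have "(\<integral>\<omega>. ?D \<omega> \<partial>M) = (\<integral>\<omega>. f (t, Y t \<omega>) \<partial>M) - (\<integral>\<omega>. f (s, Y s \<omega>) \<partial>M) - (\<integral>\<omega>. ?U \<omega> \<partial>M)"
    using fi ui m by (simp only: Bochner_Integration.integral_diff Bochner_Integration.integrable_diff diff_0_right)
  moreover have "(\<integral>\<omega>. ?R \<omega> \<partial>M) \<le> K * (1 + 6 * c + (real CARD('n) + 1) * (4 + 2 * c_disp)) * ?\<rho> * (?h + (\<integral>\<omega>. energy s t \<omega> \<partial>M))"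
  proof -
    define e where "e = (\<integral>\<omega>. energy s t \<omega> \<partial>M)"
    have e: "0 \<le> e" unfolding e_def by (simp add: integral_nonneg_AE energy_nonneg)
    have "(\<integral>\<omega>. ?R \<omega> \<partial>M) = K * ?h\<^sup>2 + K * ?h * e + K * (?\<rho> * (\<integral>\<omega>. (norm (B s t \<omega>))\<^sup>2 \<partial>M) * 2 + 4 * (\<integral>\<omega>. (norm (B s t \<omega>))^4 \<partial>M) / ?\<rho>)
      + K * (real CARD('n) + 1) * (4 * ?\<rho> * (?h + e) + ((\<integral>\<omega>. ?Qt \<omega> \<partial>M) + (\<integral>\<omega>. ?Qs \<omega> \<partial>M)) / ?\<rho>)"
      using N2 N4 Qt(2) Qs(2) energy_integrable by (simp add: e_def prob_space)
    also have "\<dots> \<le> K * (?\<rho> * ?h) + K * (?\<rho> * e) + K * (?\<rho> * (c * ?h) * 2 + 4 * (c * ?h\<^sup>2) / ?\<rho>)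
      + K * (real CARD('n) + 1) * (4 * ?\<rho> * (?h + e) + (c_disp * ?h * ?h + c_disp * ?h * ?h) / ?\<rho>)"
    proof (intro add_mono)
      have "?h\<^sup>2 \<le> ?\<rho> * ?h" using h\<rho> h by (simp add: power2_eq_square mult_right_mono)
      then show "K * ?h\<^sup>2 \<le> K * (?\<rho> * ?h)" using K by (rule mult_left_mono)
      have "?h * e \<le> ?\<rho> * e" using h\<rho> e by (rule mult_right_mono)
      then show "K * ?h * e \<le> K * (?\<rho> * e)" using K by (simp only: mult.assoc mult_left_mono)
      have "?\<rho> * (\<integral>\<omega>. (norm (B s t \<omega>))\<^sup>2 \<partial>M) \<le> ?\<rho> * (c * ?h)"
        using N2 \<rho> by (intro mult_left_mono) auto
      moreover have "4 * (\<integral>\<omega>. (norm (B s t \<omega>))^4 \<partial>M) / ?\<rho> \<le> 4 * (c * ?h\<^sup>2) / ?\<rho>"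
        using N4 \<rho> by (intro divide_right_mono) auto
      ultimately show "K * (?\<rho> * (\<integral>\<omega>. (norm (B s t \<omega>))\<^sup>2 \<partial>M) * 2 + 4 * (\<integral>\<omega>. (norm (B s t \<omega>))^4 \<partial>M) / ?\<rho>)
          \<le> K * (?\<rho> * (c * ?h) * 2 + 4 * (c * ?h\<^sup>2) / ?\<rho>)"
        using K by (intro mult_left_mono) linarith+
      have "((\<integral>\<omega>. ?Qt \<omega> \<partial>M) + (\<integral>\<omega>. ?Qs \<omega> \<partial>M)) / ?\<rho> \<le> (c_disp * ?h * ?h + c_disp * ?h * ?h) / ?\<rho>"
        using Qt(3) Qs(3) \<rho> by (intro divide_right_mono add_mono) auto
      then show "K * (real CARD('n) + 1) * (4 * ?\<rho> * (?h + e) + ((\<integral>\<omega>. ?Qt \<omega> \<partial>M) + (\<integral>\<omega>. ?Qs \<omega> \<partial>M)) / ?\<rho>)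
        \<le> K * (real CARD('n) + 1) * (4 * ?\<rho> * (?h + e) + (c_disp * ?h * ?h + c_disp * ?h * ?h) / ?\<rho>)"
        using K by (intro mult_left_mono add_left_mono) auto
    qed
    also have "\<dots> = K * (?\<rho> * (?h + e + 6 * c * ?h + (?n + 1) * (4 * (?h + e) + 2 * c_disp * ?h)))"
    proof -
      have "K * (p * (p * p)) + K * (p * e) + K * (p * (c * (p * p)) * 2 + 4 * (c * (p * p)\<^sup>2) / p)
          + K * m * (4 * p * (p * p + e) + (c_disp * (p * p) * (p * p) + c_disp * (p * p) * (p * p)) / p)
        = K * (p * (p * p + e + 6 * c * (p * p) + m * (4 * (p * p + e) + 2 * c_disp * (p * p))))" if "p > 0" for p m
        using that by (simp add: power2_eq_square field_simps)
      from this[OF \<rho>, of "?n + 1"] show ?thesis unfolding \<rho>\<rho> by (simp only: of_nat_add of_nat_1)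
    qed
    also have "\<dots> \<le> K * (?\<rho> * ((1 + 6 * c + (?n + 1) * (4 + 2 * c_disp)) * (?h + e)))"
    proof (intro mult_left_mono[OF _ K] mult_left_mono)
      have "0 \<le> 6 * c * e" "0 \<le> (?n + 1) * (2 * c_disp * e)" using c c_disp_nonneg e by auto
      then show "?h + e + 6 * c * ?h + (?n + 1) * (4 * (?h + e) + 2 * c_disp * ?h)
        \<le> (1 + 6 * c + (?n + 1) * (4 + 2 * c_disp)) * (?h + e)"
        by (simp add: algebra_simps)
    qed (use \<rho> in auto)
    finally show ?thesis unfolding e_def by (simp only: mult_ac)
  qed
  ultimately show ?thesis by linarith
qed

end

text \<open>Over \<open>N\<close> equal steps the increments of \<open>\<Psi>\<close> telescope
  while the factor \<open>sqrt ((b - a) / N)\<close> is common to all of them; the total bound tends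
  to 0 for any \<open>\<Psi>\<close>.\<close>

lemma sqrt_modulus_const:
  fixes \<Phi> \<Psi> :: "real \<Rightarrow> real"
  assumes ab: "a \<le> b" and C: "C \<ge> 0"
    and le: "\<And>s t. a \<le> s \<Longrightarrow> s < t \<Longrightarrow> t \<le> b \<Longrightarrow> t - s \<le> 1 \<Longrightarrow> \<bar>\<Phi> t - \<Phi> s\<bar> \<le> C * sqrt (t - s) * (\<Psi> t - \<Psi> s)"
  shows "\<Phi> b = \<Phi> a"
proof (cases "a = b")
  case False
  then have lt: "a < b" using ab by simp
  define \<tau> where "\<tau> N k = a + real k * ((b - a) / real N)" for N k :: nat
  have bd: "\<bar>\<Phi> b - \<Phi> a\<bar> \<le> C * sqrt ((b - a) / real N) * (\<Psi> b - \<Psi> a)" if N: "N > 0" "(b - a) / real N \<le> 1" for N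
  proof -
    have step: "\<tau> N (Suc k) - \<tau> N k = (b - a) / real N" for k
      unfolding \<tau>_def of_nat_Suc distrib_right by simp
    have "\<bar>\<Phi> (\<tau> N k) - \<Phi> a\<bar> \<le> C * sqrt ((b - a) / real N) * (\<Psi> (\<tau> N k) - \<Psi> a)" if "k \<le> N" for k
      using that
    proof (induction k)
      case 0
      show ?case by (simp add: \<tau>_def)
    next
      case (Suc k)
      have "real (Suc k) * ((b - a) / real N) \<le> real N * ((b - a) / real N)"
        using Suc.prems lt by (intro mult_right_mono) auto
      then have "\<tau> N (Suc k) \<le> b" using N by (simp add: \<tau>_def)
      moreover have "\<tau> N k < \<tau> N (Suc k)" using step[of k] lt N by (smt (verit) divide_pos_pos of_nat_0_less_iff)
      moreover have "a \<le> \<tau> N k" using lt by (simp add: \<tau>_def)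
      ultimately have "\<bar>\<Phi> (\<tau> N (Suc k)) - \<Phi> (\<tau> N k)\<bar> \<le> C * sqrt ((b - a) / real N) * (\<Psi> (\<tau> N (Suc k)) - \<Psi> (\<tau> N k))"
        using le[of "\<tau> N k" "\<tau> N (Suc k)"] N(2) unfolding step by blast
      then show ?case using Suc by (simp add: right_diff_distrib)
    qed
    from this[of N] show ?thesis using N by (simp add: \<tau>_def)
  qed
  have "(\<lambda>N. C * sqrt ((b - a) / real N) * (\<Psi> b - \<Psi> a)) \<longlonglongrightarrow> C * sqrt 0 * (\<Psi> b - \<Psi> a)"
    by (intro tendsto_intros tendsto_divide_0[OF tendsto_const] filterlim_real_sequentially filterlim_at_top_imp_at_infinity)
  moreover have "eventually (\<lambda>N. \<bar>\<Phi> b - \<Phi> a\<bar> \<le> C * sqrt ((b - a) / real N) * (\<Psi> b - \<Psi> a)) sequentially"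
    using eventually_gt_at_top[of "nat \<lceil>b - a\<rceil>"]
  proof eventually_elim
    case (elim N)
    then have N: "b - a \<le> real N" by linarith
    have "N > 0" using elim by simp
    then show ?case using bd[of N] N by simp
  qed
  ultimately have "\<bar>\<Phi> b - \<Phi> a\<bar> \<le> C * sqrt 0 * (\<Psi> b - \<Psi> a)"
    by (intro tendsto_le[OF sequentially_bot _ tendsto_const]) auto
  then show ?thesis by simp
qed simp

context drift_diffusion
begin

text \<open>The defect \<open>?\<Phi>\<close> between the mean of \<open>f\<close> and the
  integrated drift has increments bounded as in \<open>sqrt_modulus_const\<close>, with elapsed time
  plus expected energy as the additive function; hence it is constant.\<close>

theorem ito_mean:
  assumes tb: "taylor_bounds K f f0 f1 f2"
    and ui: "integrable (lborel \<Otimes>\<^sub>M M) (\<lambda>(r, \<omega>). indicat_real {a..b} r *\<^sub>R drift_of f0 f1 f2 r \<omega>)"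
  shows "(\<integral>\<omega>. f (b, Y b \<omega>) \<partial>M) - (\<integral>\<omega>. f (a, Y a \<omega>) \<partial>M)
     = (\<integral>\<omega>. (\<integral>r\<in>{a..b}. drift_of f0 f1 f2 r \<omega> \<partial>lborel) \<partial>M)"
proof -
  let ?u = "drift_of f0 f1 f2"
  let ?U = "\<lambda>s t. \<integral>\<omega>. (\<integral>r\<in>{s..t}. ?u r \<omega> \<partial>lborel) \<partial>M"
  let ?\<Phi> = "\<lambda>t. (\<integral>\<omega>. f (t, Y t \<omega>) \<partial>M) - ?U a t"
  let ?\<Psi> = "\<lambda>t. t + (\<integral>\<omega>. energy a t \<omega> \<partial>M)"
  let ?C = "K * (1 + 6 * c + (real CARD('n) + 1) * (4 + 2 * c_disp))"
  have sub: "integrable (lborel \<Otimes>\<^sub>M M) (\<lambda>(r, \<omega>). indicat_real {s..t} r *\<^sub>R ?u r \<omega>)"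
    if "a \<le> s" "t \<le> b" for s t
  proof -
    have "integrable (lborel \<Otimes>\<^sub>M M) (\<lambda>(r, \<omega>). indicat_real {s..t} r *\<^sub>R (indicat_real {a..b} r *\<^sub>R ?u r \<omega>))"
      by (rule restricted_integrable[OF ui])
    also have "(\<lambda>(r, \<omega>). indicat_real {s..t} r *\<^sub>R (indicat_real {a..b} r *\<^sub>R ?u r \<omega>)) = (\<lambda>(r, \<omega>). indicat_real {s..t} r *\<^sub>R ?u r \<omega>)"
      using that by (auto simp: indicator_def fun_eq_iff)
    finally show ?thesis .
  qed
  have Ui: "integrable M (\<lambda>\<omega>. \<integral>r\<in>{s..t}. ?u r \<omega> \<partial>lborel)" if "a \<le> s" "t \<le> b" for s t
    unfolding set_lebesgue_integral_def by (rule pair.integrable_snd[OF sub[OF that]])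
  have split: "?U a t = ?U a s + ?U s t" if "a \<le> s" "s \<le> t" "t \<le> b" for s t
  proof -
    have "?U a t = (\<integral>\<omega>. (\<integral>r\<in>{a..s}. ?u r \<omega> \<partial>lborel) + (\<integral>r\<in>{s..t}. ?u r \<omega> \<partial>lborel) \<partial>M)"
    proof (rule integral_cong_AE)
      have "AE \<omega> in M. set_integrable lborel {a..t} (\<lambda>r. ?u r \<omega>)"
        unfolding set_integrable_def by (rule pair.AE_integrable_snd[OF sub]) (use that in auto)
      then show "AE \<omega> in M. (\<integral>r\<in>{a..t}. ?u r \<omega> \<partial>lborel) = (\<integral>r\<in>{a..s}. ?u r \<omega> \<partial>lborel) + (\<integral>r\<in>{s..t}. ?u r \<omega> \<partial>lborel)"
        by eventually_elim (rule set_integral_split_Icc[OF _ that(1,2)])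
    qed (use that in \<open>auto intro!: borel_measurable_add borel_measurable_integrable Ui\<close>)
    then show ?thesis using Ui that by simp
  qed
  have "?\<Phi> b = ?\<Phi> a"
  proof (rule sqrt_modulus_const[OF ab, of ?C ?\<Phi> ?\<Psi>])
    show "0 \<le> ?C" using taylor_boundsD(1)[OF tb] c c_disp_nonneg by (intro mult_nonneg_nonneg add_nonneg_nonneg) auto
    fix s t assume st: "a \<le> s" "s < t" "t \<le> b" "t - s \<le> 1"
    have "\<bar>(\<integral>\<omega>. f (t, Y t \<omega>) \<partial>M) - (\<integral>\<omega>. f (s, Y s \<omega>) \<partial>M) - ?U s t\<bar>
      \<le> ?C * sqrt (t - s) * ((t - s) + (\<integral>\<omega>. energy s t \<omega> \<partial>M))"
      using st by (intro ito_increment[OF tb] Ui) auto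
    moreover have "?\<Psi> t - ?\<Psi> s = (t - s) + (\<integral>\<omega>. energy s t \<omega> \<partial>M)"
      using energy_split[of a s t] st by simp
    moreover have "?\<Phi> t - ?\<Phi> s = (\<integral>\<omega>. f (t, Y t \<omega>) \<partial>M) - (\<integral>\<omega>. f (s, Y s \<omega>) \<partial>M) - ?U s t"
      using split[of s t] st by simp
    ultimately show "\<bar>?\<Phi> t - ?\<Phi> s\<bar> \<le> ?C * sqrt (t - s) * (?\<Psi> t - ?\<Psi> s)"
      by (simp only:)
  qed
  moreover have "?U a a = 0"
  proof -
    have "(\<integral>r\<in>{a..a}. ?u r \<omega> \<partial>lborel) = 0" for \<omega>
      unfolding set_lebesgue_integral_def
      by (rule integral_eq_zero_AE) (use AE_lborel_singleton[of a] in \<open>eventually_elim, auto simp: indicator_def\<close>)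
    then show ?thesis by simp
  qed
  ultimately show ?thesis by simp
qed

end

section \<open>Moments of Brownian increments\<close>

text \<open>Both sides agree on boxes. The identification allows integrals of products over the
  coordinates to factorise into one-dimensional integrals.\<close>

lemma lborel_vec_eq_distr:
  "(lborel :: (real ^ 'n) measure) = distr (\<Pi>\<^sub>M i\<in>UNIV. lborel) borel (\<lambda>x. \<chi> i. x i)"
proof (rule lborel_eqI)
  interpret product_sigma_finite "\<lambda>_ :: 'n. lborel :: real measure" ..
  fix l u :: "real ^ 'n"
  assume lu: "\<And>b. b \<in> Basis \<Longrightarrow> l \<bullet> b \<le> u \<bullet> b"
  have le: "l $ i \<le> u $ i" for i
    using lu[of "axis i 1"] by (simp add: inner_axis axis_in_Basis_iff)
  have m: "(\<lambda>x. \<chi> i. x i) \<in> (\<Pi>\<^sub>M i\<in>(UNIV::'n set). lborel) \<rightarrow>\<^sub>M (borel :: (real ^ 'n) measure)"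
    by (intro measurable_vec_lambda) measurable
  have "emeasure (distr (\<Pi>\<^sub>M i\<in>UNIV. lborel) borel (\<lambda>x. \<chi> i. x i)) (box l u)
     = emeasure (\<Pi>\<^sub>M i\<in>UNIV. lborel) (\<Pi>\<^sub>E i\<in>UNIV. box (l $ i) (u $ i))"
    by (subst emeasure_distr[OF m])
      (auto intro!: arg_cong[where f="emeasure _"] simp: space_PiM mem_box_cart PiE_def Pi_def)
  also have "\<dots> = (\<Prod>i\<in>UNIV. emeasure lborel (box (l $ i) (u $ i)))"
    by (rule emeasure_PiM) auto
  also have "\<dots> = ennreal (\<Prod>i\<in>UNIV. u $ i - l $ i)"
    by (simp add: le prod_ennreal)
  also have "(\<Prod>i\<in>UNIV. u $ i - l $ i) = (\<Prod>b\<in>Basis. (u - l) \<bullet> b)"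
    by (simp add: Basis_vec_def prod.UNION_disjoint axis_eq_axis inner_axis prod.reindex inj_on_def)
  finally show "emeasure (distr (\<Pi>\<^sub>M i\<in>UNIV. lborel) borel (\<lambda>x. \<chi> i. x i)) (box l u) = ennreal (\<Prod>b\<in>Basis. (u - l) \<bullet> b)" .
qed simp

lemma (in prob_space) gaussian_product_moment:
  fixes D :: "'a \<Rightarrow> real ^ 'n" and q :: "'n \<Rightarrow> real \<Rightarrow> real"
  assumes D: "distributed M lborel D (\<lambda>z. ennreal (\<Prod>i\<in>UNIV. normal_density 0 \<sigma> (z $ i)))"
    and q: "\<And>i. integrable lborel (\<lambda>x. normal_density 0 \<sigma> x * q i x)"
      "\<And>i. q i \<in> borel_measurable borel"
  shows "integrable M (\<lambda>\<omega>. \<Prod>i\<in>UNIV. q i (D \<omega> $ i))"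
    and "(\<integral>\<omega>. (\<Prod>i\<in>UNIV. q i (D \<omega> $ i)) \<partial>M) = (\<Prod>i\<in>UNIV. \<integral>x. normal_density 0 \<sigma> x * q i x \<partial>lborel)"
proof -
  interpret product_sigma_finite "\<lambda>_ :: 'n. lborel :: real measure" ..
  note [measurable] = q(2)
  let ?g = "\<lambda>z :: real ^ 'n. \<Prod>i\<in>UNIV. q i (z $ i)"
  let ?d = "\<lambda>z :: real ^ 'n. \<Prod>i\<in>UNIV. normal_density 0 \<sigma> (z $ i)"
  have m: "(\<lambda>x. \<chi> i. x i) \<in> (\<Pi>\<^sub>M i\<in>(UNIV::'n set). lborel) \<rightarrow>\<^sub>M (borel :: (real ^ 'n) measure)"
    by (intro measurable_vec_lambda) measurable
  have gm: "?g \<in> borel_measurable lborel" by measurable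
  have dm: "?d \<in> borel_measurable lborel" by measurable
  have d0: "AE z in lborel. 0 \<le> ?d z" by (intro AE_I2 prod_nonneg) auto
  have e: "?d z * ?g z = (\<Prod>i\<in>UNIV. normal_density 0 \<sigma> (z $ i) * q i (z $ i))" for z
    by (simp add: prod.distrib)
  have i: "integrable (\<Pi>\<^sub>M i\<in>(UNIV::'n set). lborel) (\<lambda>x. \<Prod>i\<in>UNIV. normal_density 0 \<sigma> (x i) * q i (x i))"
    by (rule product_integrable_prod) (use q in auto)
  have il: "integrable lborel (\<lambda>z. ?d z * ?g z)"
    unfolding lborel_vec_eq_distr e by (subst integrable_distr_eq[OF m]) (use i in auto)
  show "integrable M (\<lambda>\<omega>. ?g (D \<omega>))"
    using il distributed_integrable[OF D gm] dm d0 by (simp add: prod_nonneg)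
  have "(\<integral>\<omega>. ?g (D \<omega>) \<partial>M) = (\<integral>z. ?d z * ?g z \<partial>lborel)"
    by (rule distributed_integral[OF D gm, symmetric]) (simp add: prod_nonneg)
  also have "\<dots> = (\<integral>x. (\<Prod>i\<in>UNIV. normal_density 0 \<sigma> (x i) * q i (x i)) \<partial>(\<Pi>\<^sub>M i\<in>(UNIV::'n set). lborel))"
    unfolding lborel_vec_eq_distr e by (subst integral_distr[OF m]) auto
  also have "\<dots> = (\<Prod>i\<in>UNIV. \<integral>x. normal_density 0 \<sigma> x * q i x \<partial>lborel)"
    by (rule product_integral_prod) (use q in auto)
  finally show "(\<integral>\<omega>. ?g (D \<omega>) \<partial>M) = \<dots>" .
qed

text \<open>Each monomial is a product over all coordinates, with the constant 1 at the coordinates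
  that do not occur; \<open>gaussian_product_moment\<close> then reduces it to moments of the
  one-dimensional normal density.\<close>

lemma (in prob_space) gaussian_moments:
  fixes D :: "'a \<Rightarrow> real ^ 'n" and h :: real
  assumes h: "h > 0" and D: "distributed M lborel D (\<lambda>z. ennreal (\<Prod>i\<in>UNIV. normal_density 0 (sqrt h) (z $ i)))"
  shows "integrable M (\<lambda>\<omega>. D \<omega> $ i)" "(\<integral>\<omega>. D \<omega> $ i \<partial>M) = 0"
    and "integrable M (\<lambda>\<omega>. D \<omega> $ i * D \<omega> $ j)" "(\<integral>\<omega>. D \<omega> $ i * D \<omega> $ j \<partial>M) = (if i = j then h else 0)"
    and "integrable M (\<lambda>\<omega>. (D \<omega> $ i)^4)" "(\<integral>\<omega>. (D \<omega> $ i)^4 \<partial>M) = 3 * h\<^sup>2"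
proof -
  have s: "sqrt h > 0" using h by simp
  have I: "integrable lborel (\<lambda>x. normal_density 0 (sqrt h) x * x^k)" for k
    using integrable_normal_moment[OF s, of 0 k] by simp
  have m0: "(\<integral>x. normal_density 0 (sqrt h) x \<partial>lborel) = 1" using integral_normal_density[OF s] by simp
  have m1: "(\<integral>x. normal_density 0 (sqrt h) x * x \<partial>lborel) = 0" using integral_normal_moment_nz_1[OF s, of 0] by simp
  have m2: "(\<integral>x. normal_density 0 (sqrt h) x * x^2 \<partial>lborel) = h"
    using integral_normal_moment_even[OF s, of 0 1] h by simp
  have m4: "(\<integral>x. normal_density 0 (sqrt h) x * x^4 \<partial>lborel) = 3 * h^2"
    using integral_normal_moment_even[OF s, of 0 2] h by (simp add: fact_numeral power2_eq_square field_simps)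
  have prod1: "(\<Prod>j\<in>UNIV. if j = i then p j else 1) = p i" for i and p :: "'n \<Rightarrow> real" by simp
  have one: "integrable M (\<lambda>\<omega>. (D \<omega> $ i)^k)"
    "(\<integral>\<omega>. (D \<omega> $ i)^k \<partial>M) = (\<integral>x. normal_density 0 (sqrt h) x * x^k \<partial>lborel)" for i k
  proof -
    let ?q = "\<lambda>j x :: real. if j = i then x^k else 1"
    have iq: "integrable lborel (\<lambda>x. normal_density 0 (sqrt h) x * ?q j x)" for j
      using I[of k] I[of 0] by (cases "j = i") auto
    have e: "(\<Prod>j\<in>UNIV. ?q j (D \<omega> $ j)) = (D \<omega> $ i)^k" for \<omega> by simp
    have "(\<Prod>j\<in>UNIV. \<integral>x. normal_density 0 (sqrt h) x * ?q j x \<partial>lborel)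
      = (\<Prod>j\<in>UNIV. if j = i then \<integral>x. normal_density 0 (sqrt h) x * x^k \<partial>lborel else 1)"
      by (intro prod.cong) (auto simp: m0)
    then show "integrable M (\<lambda>\<omega>. (D \<omega> $ i)^k)"
      "(\<integral>\<omega>. (D \<omega> $ i)^k \<partial>M) = (\<integral>x. normal_density 0 (sqrt h) x * x^k \<partial>lborel)"
      using gaussian_product_moment[OF D, of ?q, OF iq] by (simp_all only: e) auto
  qed
  show "integrable M (\<lambda>\<omega>. D \<omega> $ i)" "(\<integral>\<omega>. D \<omega> $ i \<partial>M) = 0" using one[of i 1] m1 by simp_all
  show "integrable M (\<lambda>\<omega>. (D \<omega> $ i)^4)" "(\<integral>\<omega>. (D \<omega> $ i)^4 \<partial>M) = 3 * h\<^sup>2" using one[of i 4] m4 by simp_all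
  have "integrable M (\<lambda>\<omega>. D \<omega> $ i * D \<omega> $ j) \<and> (\<integral>\<omega>. D \<omega> $ i * D \<omega> $ j \<partial>M) = (if i = j then h else 0)"
  proof (cases "i = j")
    case True
    then show ?thesis using one[of i 2] m2 by (simp add: power2_eq_square)
  next
    case False
    let ?q = "\<lambda>l x :: real. if l = i \<or> l = j then x else 1"
    have iq: "integrable lborel (\<lambda>x. normal_density 0 (sqrt h) x * ?q l x)" for l
      using I[of 1] I[of 0] by (cases "l = i \<or> l = j") auto
    have e: "(\<Prod>l\<in>UNIV. ?q l (D \<omega> $ l)) = D \<omega> $ i * D \<omega> $ j" for \<omega>
    proof -
      have "(\<Prod>l\<in>UNIV. ?q l (D \<omega> $ l)) = (\<Prod>l\<in>{i, j}. D \<omega> $ l)"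
        by (rule prod.mono_neutral_cong_right) auto
      then show ?thesis using False by simp
    qed
    have z: "(\<Prod>l\<in>UNIV. \<integral>x. normal_density 0 (sqrt h) x * ?q l x \<partial>lborel) = 0"
      by (rule prod_zero) (auto intro!: exI[of _ i] simp: m1)
    show ?thesis
      using gaussian_product_moment[OF D, of ?q, OF iq] z False by (simp only: e) auto
  qed
  then show "integrable M (\<lambda>\<omega>. D \<omega> $ i * D \<omega> $ j)" "(\<integral>\<omega>. D \<omega> $ i * D \<omega> $ j \<partial>M) = (if i = j then h else 0)"
    by auto
qed

text \<open>In the fourth moment one factor \<open>CARD('n)\<close> comes from Cauchy-Schwarz
  against the constant vector, the other from the number of coordinates, and
  \<open>3 * h\<^sup>2\<close> is the fourth moment of a single coordinate.\<close>

lemma (in prob_space) gaussian_norm_moments: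
  fixes D :: "'a \<Rightarrow> real ^ 'n" and h :: real
  assumes h: "h > 0" and D: "distributed M lborel D (\<lambda>z. ennreal (\<Prod>i\<in>UNIV. normal_density 0 (sqrt h) (z $ i)))"
  shows "integrable M (\<lambda>\<omega>. (norm (D \<omega>))\<^sup>2)" "(\<integral>\<omega>. (norm (D \<omega>))\<^sup>2 \<partial>M) = CARD('n) * h"
    and "integrable M (\<lambda>\<omega>. (norm (D \<omega>))^4)" "(\<integral>\<omega>. (norm (D \<omega>))^4 \<partial>M) \<le> 3 * (CARD('n))\<^sup>2 * h\<^sup>2"
proof -
  note g = gaussian_moments[OF h D]
  have e: "(norm z)\<^sup>2 = (\<Sum>i\<in>UNIV. z $ i * z $ i)" for z :: "real ^ 'n"
    by (simp add: power2_norm_eq_inner inner_vec_def)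
  show "integrable M (\<lambda>\<omega>. (norm (D \<omega>))\<^sup>2)" "(\<integral>\<omega>. (norm (D \<omega>))\<^sup>2 \<partial>M) = CARD('n) * h"
    unfolding e using g(3,4) by (simp_all add: Bochner_Integration.integral_sum)
  have [measurable]: "D \<in> borel_measurable M" using distributed_measurable[OF D] by simp
  have le: "(norm z)^4 \<le> CARD('n) * (\<Sum>i\<in>UNIV. (z $ i)^4)" for z :: "real ^ 'n"
  proof -
    have "(norm z)^4 = (\<Sum>i\<in>UNIV. 1 * (z $ i)\<^sup>2)\<^sup>2"
    proof -
      have "(norm z)^4 = ((norm z)\<^sup>2)\<^sup>2" by (simp flip: power_mult)
      then show ?thesis unfolding e by (simp add: power2_eq_square[of "z $ _"])
    qed
    also have "\<dots> \<le> (\<Sum>i\<in>(UNIV::'n set). 1\<^sup>2) * (\<Sum>i\<in>UNIV. ((z $ i)\<^sup>2)\<^sup>2)"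
      by (rule Cauchy_Schwarz_ineq_sum)
    finally show ?thesis by (simp flip: power_mult)
  qed
  have i: "integrable M (\<lambda>\<omega>. CARD('n) * (\<Sum>i\<in>UNIV. (D \<omega> $ i)^4))" using g(5) by auto
  show i4: "integrable M (\<lambda>\<omega>. (norm (D \<omega>))^4)"
    by (rule Bochner_Integration.integrable_bound[OF i]) (use le in \<open>auto intro!: AE_I2 order_trans[OF le]\<close>)
  have "(\<integral>\<omega>. (norm (D \<omega>))^4 \<partial>M) \<le> (\<integral>\<omega>. CARD('n) * (\<Sum>i\<in>UNIV. (D \<omega> $ i)^4) \<partial>M)"
    by (rule integral_mono[OF i4 i le])
  also have "\<dots> = 3 * (CARD('n))\<^sup>2 * h\<^sup>2" using g(5,6) by (simp add: power2_eq_square)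
  finally show "(\<integral>\<omega>. (norm (D \<omega>))^4 \<partial>M) \<le> 3 * (CARD('n))\<^sup>2 * h\<^sup>2" .
qed

text \<open>The preimages under \<open>\<xi>\<close> and under \<open>q\<close> composed with
  \<open>D\<close> form subfamilies of the two given independent families. Being stable under
  intersection, they generate independent sigma-algebras, and the expectation of the product
  factorises.\<close>

lemma (in prob_space) indep_set_product_integral:
  fixes D :: "'a \<Rightarrow> 'b::topological_space" and \<xi> :: "'a \<Rightarrow> real" and q :: "'b \<Rightarrow> real"
  assumes ind: "indep_set (sets F) {D -` A \<inter> space M | A. A \<in> sets borel}"
    and F: "subalgebra M F" and xi: "\<xi> \<in> borel_measurable F" "\<And>\<omega>. \<bar>\<xi> \<omega>\<bar> \<le> C"
    and D: "D \<in> borel_measurable M" and q: "q \<in> borel_measurable borel" "integrable M (\<lambda>\<omega>. q (D \<omega>))"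
  shows "integrable M (\<lambda>\<omega>. \<xi> \<omega> * q (D \<omega>))"
    and "(\<integral>\<omega>. \<xi> \<omega> * q (D \<omega>) \<partial>M) = (\<integral>\<omega>. \<xi> \<omega> \<partial>M) * (\<integral>\<omega>. q (D \<omega>) \<partial>M)"
proof -
  note [measurable] = D q(1)
  have xM [measurable]: "\<xi> \<in> borel_measurable M" by (rule measurable_from_subalg[OF F xi(1)])
  have qD: "(\<lambda>\<omega>. q (D \<omega>)) \<in> borel_measurable M" by measurable
  have indep: "indep_var borel \<xi> borel (\<lambda>\<omega>. q (D \<omega>))"
    unfolding indep_var_eq
  proof (intro conjI xM qD)
    have "indep_set {\<xi> -` A \<inter> space M |A. A \<in> sets borel} {(\<lambda>\<omega>. q (D \<omega>)) -` A \<inter> space M |A. A \<in> sets borel}"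
      unfolding indep_set_def
    proof (rule indep_sets_mono_sets[OF ind[unfolded indep_set_def]])
      fix i :: bool
      have "\<xi> -` A \<inter> space M \<in> sets F" if "A \<in> sets borel" for A
        using measurable_sets[OF xi(1) that] F by (simp add: subalgebra_def)
      moreover have "\<exists>A'. (\<lambda>\<omega>. q (D \<omega>)) -` A \<inter> space M = D -` A' \<inter> space M \<and> A' \<in> sets borel"
        if "A \<in> sets borel" for A
        using measurable_sets[OF q(1) that] by (intro exI[of _ "q -` A"]) auto
      ultimately show "(case i of True \<Rightarrow> {\<xi> -` A \<inter> space M |A. A \<in> sets borel}
          | False \<Rightarrow> {(\<lambda>\<omega>. q (D \<omega>)) -` A \<inter> space M |A. A \<in> sets borel})
        \<subseteq> (case i of True \<Rightarrow> sets F | False \<Rightarrow> {D -` A \<inter> space M |A. A \<in> sets borel})"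
        by (auto split: bool.split)
    qed
    then show "indep_set (sigma_sets (space M) {\<xi> -` A \<inter> space M |A. A \<in> sets borel})
       (sigma_sets (space M) {(\<lambda>\<omega>. q (D \<omega>)) -` A \<inter> space M |A. A \<in> sets borel})"
    proof (rule indep_set_sigma_sets)
      show "Int_stable {\<xi> -` A \<inter> space M |A. A \<in> sets borel}"
        unfolding Int_stable_def by safe (rule_tac x="A \<inter> Aa" in exI, auto)
      show "Int_stable {(\<lambda>\<omega>. q (D \<omega>)) -` A \<inter> space M |A. A \<in> sets borel}"
        unfolding Int_stable_def by safe (rule_tac x="A \<inter> Aa" in exI, auto)
    qed
  qed
  have ix: "integrable M \<xi>" by (rule integrable_const_bound[of _ C]) (use xi in auto)
  show "integrable M (\<lambda>\<omega>. \<xi> \<omega> * q (D \<omega>))" by (rule indep_var_integrable[OF indep ix q(2)])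
  show "(\<integral>\<omega>. \<xi> \<omega> * q (D \<omega>) \<partial>M) = (\<integral>\<omega>. \<xi> \<omega> \<partial>M) * (\<integral>\<omega>. q (D \<omega>) \<partial>M)"
    by (rule indep_var_lebesgue_integral[OF indep ix q(2)])
qed

section \<open>Growth of the Lagrangian\<close>

text \<open>The Fenchel-Young inequality in the sign convention of
  \<open>is_hamiltonian\<close>.\<close>

lemma lagrangian_lower:
  assumes "is_hamiltonian L H"
  shows "- H x p - a \<bullet> p \<le> L x a"
proof -
  have "ereal (- L x a - a \<bullet> p) \<le> (SUP a. ereal (- L x a - a \<bullet> p))" by (rule SUP_upper) simp
  also have "\<dots> = ereal (H x p)" using assms by (simp add: is_hamiltonian_def)
  finally show ?thesis by simp
qed

text \<open>Separating the point \<open>(a, L x a - e)\<close> from the epigraph of \<open>L x\<close> yields an affine minorant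
  that is \<open>e\<close>-close at \<open>a\<close>; its slope is \<open>- p\<close>.\<close>

lemma lagrangian_approx:
  fixes L H :: "'n::finite torus \<Rightarrow> real ^ 'n \<Rightarrow> real"
  assumes cont: "continuous_on UNIV (L x)" and conv: "convex_on UNIV (L x)"
    and H: "is_hamiltonian L H" and e: "e > 0"
  obtains p where "L x a - e \<le> - H x p - a \<bullet> p"
proof -
  let ?E = "{z :: (real ^ 'n) \<times> real. L x (fst z) \<le> snd z}"
  have cE: "convex ?E"
    using conv convex_epigraph[of UNIV "L x"] by (simp add: epigraph_def)
  have clE: "closed ?E"
    by (intro closed_Collect_le continuous_on_compose2[OF cont] continuous_intros) auto
  have "(a, L x a - e) \<notin> ?E" using e by simp
  then obtain v \<beta> where v: "v \<bullet> (a, L x a - e) < \<beta>" "\<forall>z\<in>?E. \<beta> < v \<bullet> z"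
    using separating_hyperplane_closed_point[OF cE clE] by blast
  obtain u k where uk: "v = (u, k)" by (cases v)
  have v1: "u \<bullet> a + k * (L x a - e) < \<beta>" using v(1) by (simp add: uk)
  have v2: "\<beta> < u \<bullet> b + k * r" if "L x b \<le> r" for b r using v(2) that by (force simp: uk)
  have k: "k > 0"
  proof -
    have "k * (L x a - e) < k * L x a" using v1 v2[of a "L x a"] by simp
    then have "0 < k * e" by (simp add: right_diff_distrib)
    then show ?thesis using e by (simp add: zero_less_mult_iff)
  qed
  let ?p = "(1 / k) *\<^sub>R u"
  have le: "- L x b - b \<bullet> ?p \<le> - (L x a - e) - a \<bullet> ?p" for b
  proof -
    have "u \<bullet> a + k * (L x a - e) < u \<bullet> b + k * L x b" using v1 v2[of b "L x b"] by simp
    then have "(u \<bullet> a + k * (L x a - e)) / k \<le> (u \<bullet> b + k * L x b) / k"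
      using k by (intro divide_right_mono) auto
    then show ?thesis using k by (simp add: add_divide_distrib inner_commute)
  qed
  have "ereal (H x ?p) = (SUP b. ereal (- L x b - b \<bullet> ?p))" using H by (simp add: is_hamiltonian_def)
  also have "\<dots> \<le> ereal (- (L x a - e) - a \<bullet> ?p)" by (rule SUP_least) (use le in simp)
  finally have "H x ?p \<le> - (L x a - e) - a \<bullet> ?p" by simp
  then show ?thesis using that[of ?p] by linarith
qed

text \<open>Regularity of \<open>H\<close> is given jointly in position and momentum, whereas its
  Hessian in the momentum concerns a slice; slice derivatives are joint derivatives in directions
  \<open>(0, h)\<close>.\<close>

lemma cont_diff_slices:
  fixes g :: "(real ^ 'n) \<times> (real ^ 'n) \<Rightarrow> real"
  assumes "cont_diff 2 g"
  shows "(\<lambda>p. g (y, p)) differentiable (at p)"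
    and "(\<lambda>p. frechet_derivative (\<lambda>p. g (y, p)) (at p) v) differentiable (at p)"
    and "continuous_on UNIV g"
proof -
  have g2: "cont_diff (Suc (Suc 0)) g" using assms by (simp add: numeral_2_eq_2)
  have g1: "g differentiable (at z)" for z by (rule cont_diff_SucD(1)[OF g2])
  have g1': "(\<lambda>z. frechet_derivative g (at z) v) differentiable (at z)" for v z
    by (rule cont_diff_SucD(1)[OF cont_diff_SucD(2)[OF g2]])
  have P: "(Pair y has_derivative (\<lambda>h. (0, h))) (at p)" for p :: "real ^ 'n"
    by (auto intro!: derivative_eq_intros)
  have slice: "((\<lambda>p. f (y, p)) has_derivative (\<lambda>h. frechet_derivative f (at (y, p)) (0, h))) (at p)"
    if "f differentiable (at (y, p))" for f :: "(real ^ 'n) \<times> (real ^ 'n) \<Rightarrow> real" and p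
    using has_derivative_compose[OF P, of f "frechet_derivative f (at (y, p))"] that
    by (simp add: frechet_derivative_works)
  show "(\<lambda>p. g (y, p)) differentiable (at p)" using slice[OF g1] unfolding differentiable_def by blast
  have "frechet_derivative (\<lambda>p. g (y, p)) (at p) v = frechet_derivative g (at (y, p)) (0, v)" for p
    using frechet_derivative_at[OF slice[OF g1]] by metis
  then have "(\<lambda>p. frechet_derivative (\<lambda>p. g (y, p)) (at p) v) = (\<lambda>p. frechet_derivative g (at (y, p)) (0, v))" by blast
  then show "(\<lambda>p. frechet_derivative (\<lambda>p. g (y, p)) (at p) v) differentiable (at p)"
    using slice[OF g1'] unfolding differentiable_def by metis
  show "continuous_on UNIV g" by (rule cont_diff_continuous[OF assms])
qed

text \<open>Along the segment from 0 to \<open>p\<close>, subtracting the linear part at 0 and the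
  quadratic of curvature \<open>c * (p \<bullet> p)\<close> leaves \<open>?k\<close> with zero
  initial slope and nonnegative second derivative, so it is nondecreasing.\<close>

lemma strongly_convex_lower:
  fixes h :: "real ^ 'n \<Rightarrow> real"
  assumes h1: "\<And>p. h differentiable (at p)" and h2: "\<And>v p. (\<lambda>p. frechet_derivative h (at p) v) differentiable (at p)"
    and hess: "\<And>p v. c * (v \<bullet> v) \<le> hessian_form h p v v"
  shows "h 0 + frechet_derivative h (at 0) p + c / 2 * (norm p)\<^sup>2 \<le> h p"
proof -
  let ?d = "frechet_derivative h (at 0) p"
  let ?k = "\<lambda>s. h (0 + s *\<^sub>R p) - (s * ?d + s\<^sup>2 / 2 * (c * (p \<bullet> p)))"
  let ?k1 = "\<lambda>s. frechet_derivative h (at (0 + s *\<^sub>R p)) p - (?d + s * (c * (p \<bullet> p)))"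
  have k: "(?k has_real_derivative ?k1 s) (at s)" for s
  proof (intro DERIV_diff line_derivative[OF h1])
    show "((\<lambda>s. s * ?d + s\<^sup>2 / 2 * (c * (p \<bullet> p))) has_real_derivative ?d + s * (c * (p \<bullet> p))) (at s)"
      by (auto intro!: derivative_eq_intros)
  qed
  have k1: "(?k1 has_real_derivative (hessian_form h (0 + s *\<^sub>R p) p p - c * (p \<bullet> p))) (at s)" for s
    unfolding hessian_form_def
  proof (intro DERIV_diff line_derivative[OF h2])
    show "((\<lambda>s. ?d + s * (c * (p \<bullet> p))) has_real_derivative c * (p \<bullet> p)) (at s)"
      by (auto intro!: derivative_eq_intros)
  qed
  have k1_nn: "0 \<le> ?k1 s" if "0 \<le> s" for s
  proof -
    have "?k1 0 \<le> ?k1 s"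
    proof (rule DERIV_nonneg_imp_nondecreasing[OF that])
      fix r
      show "\<exists>y. (?k1 has_real_derivative y) (at r) \<and> 0 \<le> y"
        using k1[of r] hess[of p "0 + r *\<^sub>R p"] by (intro exI conjI) (assumption, simp only: diff_ge_0_iff_ge)
    qed
    then show ?thesis by simp
  qed
  have "\<exists>y. (?k has_real_derivative y) (at r) \<and> 0 \<le> y" if "0 \<le> r" for r
    using k[of r] k1_nn[OF that] by blast
  then have "?k 0 \<le> ?k 1"
    using DERIV_nonneg_imp_nondecreasing[of 0 1 ?k] by simp
  then show ?thesis by (simp add: power2_norm_eq_inner)
qed

text \<open>The Legendre transform reverses bounds: the bound on \<open>H\<close> at momentum 0
  gives the lower bound on \<open>L\<close>, and the quadratic lower bound on \<open>H\<close> from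
  strong convexity gives a quadratic upper bound on \<open>L\<close>. Uniformity in \<open>x\<close>
  comes from compactness of \<open>unit_cell\<close> times the unit ball.\<close>

lemma lagrangian_growth:
  fixes L H :: "'n::finite torus \<Rightarrow> real ^ 'n \<Rightarrow> real"
  assumes L: "\<And>x. continuous_on UNIV (L x)" "\<And>x. convex_on UNIV (L x)" and H: "is_hamiltonian L H"
    and H_C2: "cont_diff 2 (\<lambda>(y, p). H (to_torus y) p)" and C0: "C0 > 0"
    and H_pp: "\<And>x p v. 1 / C0 * (v \<bullet> v) \<le> hessian_form (H x) p v v"
  obtains C where "C \<ge> 0" "\<And>x a. - C \<le> L x a" "\<And>x a. L x a \<le> C * (1 + (norm a)\<^sup>2)"
proof -
  let ?g = "\<lambda>(y, p). H (to_torus y) p"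
  note sl = cont_diff_slices[OF H_C2]
  have "compact ((unit_cell :: (real ^ 'n) set) \<times> cball (0 :: real ^ 'n) 1)"
    by (intro compact_Times compact_unit_cell compact_cball)
  then have "bounded (?g ` (unit_cell \<times> cball 0 1))"
    using compact_continuous_image[OF continuous_on_subset[OF sl(3)]] compact_imp_bounded by blast
  then obtain B where B: "\<And>z. z \<in> unit_cell \<times> cball 0 1 \<Longrightarrow> \<bar>?g z\<bar> \<le> B" by (auto simp: bounded_iff)
  have HB: "\<bar>H x p\<bar> \<le> B" if p: "norm p \<le> 1" for x p
  proof -
    obtain k where k: "\<And>i. k $ i \<in> \<int>" "torus_rep x + k \<in> unit_cell" using unit_cell_cover by blast
    have "to_torus (torus_rep x + k) = x" using to_torus_shift[OF k(1)] by simp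
    then show ?thesis using B[of "(torus_rep x + k, p)"] k(2) p by simp
  qed
  have B0: "0 \<le> B" using HB[of 0 0] by simp
  have low: "- B \<le> L x a" for x a using lagrangian_lower[OF H, of x 0 a] HB[of 0 x] by simp
  have Hlow: "- B - 2 * B * norm p + 1 / C0 / 2 * (norm p)\<^sup>2 \<le> H x p" for x p
  proof -
    have d1: "H x differentiable (at p)" for p using sl(1)[of "torus_rep x" p] by simp
    have d2: "(\<lambda>p. frechet_derivative (H x) (at p) v) differentiable (at p)" for p v
      using sl(2)[of "torus_rep x" v p] by simp
    note sc = strongly_convex_lower[OF d1 d2 H_pp]
    let ?l = "frechet_derivative (H x) (at 0)"
    have lin: "linear ?l" by (rule linear_frechet_derivative[OF d1])
    \<comment> \<open>Convexity at \<open>- v\<close> gives \<open>H x 0 - ?l v\<close> at most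
      \<open>H x (- v)\<close>, and both values of \<open>H\<close> lie within \<open>B\<close> of
      0.\<close>
    have unit: "- 2 * B \<le> ?l v" if v: "norm v = 1" for v
    proof -
      have "H x 0 + ?l (- v) + 1 / C0 / 2 * (norm (- v))\<^sup>2 \<le> H x (- v)" by (rule sc)
      moreover have "?l (- v) = - ?l v" by (rule linear_neg[OF lin])
      moreover have "0 \<le> 1 / C0 / 2 * (norm (- v))\<^sup>2" using C0 by simp
      moreover have "\<bar>H x 0\<bar> \<le> B" "\<bar>H x (- v)\<bar> \<le> B" using HB v by auto
      ultimately show ?thesis by linarith
    qed
    have "- 2 * B * norm p \<le> ?l p"
    proof (cases "p = 0")
      case True
      then show ?thesis using linear_0[OF lin] by simp
    next
      case False
      have "norm p * (- 2 * B) \<le> norm p * ?l ((1 / norm p) *\<^sub>R p)"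
        using False by (intro mult_left_mono unit) auto
      also have "\<dots> = ?l p" using False by (simp add: linear_scale[OF lin])
      finally show ?thesis by (simp add: mult.commute)
    qed
    then show ?thesis using sc[of p] HB[of 0 x] by simp
  qed
  have up: "L x a \<le> B + C0 * (4 * B\<^sup>2 + (norm a)\<^sup>2)" for x a
  proof (rule field_le_epsilon)
    fix e :: real assume e: "e > 0"
    obtain p where p: "L x a - e \<le> - H x p - a \<bullet> p" by (rule lagrangian_approx[OF L H e])
    let ?s = "2 * B + norm a"
    have "- (a \<bullet> p) \<le> norm a * norm p" using Cauchy_Schwarz_ineq2[of a p] by simp
    then have "L x a - e \<le> B + (?s * norm p - 1 / C0 / 2 * (norm p)\<^sup>2)"
      using p Hlow[of p x] by (simp add: algebra_simps)
    \<comment> \<open>The concave quadratic in \<open>norm p\<close> is maximal at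
      \<open>C0 * ?s\<close>, where the completed square is centred.\<close>
    also have "?s * norm p - 1 / C0 / 2 * (norm p)\<^sup>2 \<le> C0 / 2 * ?s\<^sup>2"
    proof -
      have "0 \<le> (C0 * ?s - norm p)\<^sup>2 / (2 * C0)" using C0 by simp
      also have "\<dots> = C0 / 2 * ?s\<^sup>2 - ?s * norm p + 1 / C0 / 2 * (norm p)\<^sup>2"
      proof -
        have "(C0 * s - q)\<^sup>2 / (2 * C0) = C0 / 2 * s\<^sup>2 - s * q + 1 / C0 / 2 * q\<^sup>2" for s q
          using C0 by (simp add: power2_eq_square field_simps)
        then show ?thesis .
      qed
      finally show ?thesis by simp
    qed
    also have "C0 / 2 * ?s\<^sup>2 \<le> C0 / 2 * (2 * (4 * B\<^sup>2 + (norm a)\<^sup>2))"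
    proof (rule mult_left_mono)
      show "?s\<^sup>2 \<le> 2 * (4 * B\<^sup>2 + (norm a)\<^sup>2)"
        using zero_le_power2[of "2 * B - norm a"] by (simp add: power2_sum power2_diff power_mult_distrib)
    qed (use C0 in simp)
    also have "C0 / 2 * (2 * (4 * B\<^sup>2 + (norm a)\<^sup>2)) = C0 * (4 * B\<^sup>2 + (norm a)\<^sup>2)" by simp
    finally show "L x a \<le> B + C0 * (4 * B\<^sup>2 + (norm a)\<^sup>2) + e" by linarith
  qed
  let ?C = "B + C0 * (4 * B\<^sup>2 + 1)"
  show ?thesis
  proof (rule that[of ?C])
    show "0 \<le> ?C" using B0 C0 by simp
    have "0 \<le> C0 * (4 * B\<^sup>2 + 1)" using C0 by simp
    then show "- ?C \<le> L x a" for x a using low[of x a] by linarith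
    show "L x a \<le> ?C * (1 + (norm a)\<^sup>2)" for x a
    proof -
      have "0 \<le> B * (norm a)\<^sup>2" "0 \<le> C0 * (4 * B\<^sup>2 * (norm a)\<^sup>2 + 1)" using B0 C0 by auto
      then show ?thesis using up[of x a] by (simp add: algebra_simps)
    qed
  qed
qed

text \<open>The momenta whose affine minorant is \<open>e\<close>-close at \<open>a\<close> form an
  open set by continuity of \<open>H x\<close>, nonempty by \<open>lagrangian_approx\<close>; a
  dense set must meet it.\<close>

lemma lagrangian_countable_sup:
  fixes L H :: "'n::finite torus \<Rightarrow> real ^ 'n \<Rightarrow> real"
  assumes L: "\<And>x. continuous_on UNIV (L x)" "\<And>x. convex_on UNIV (L x)" and H: "is_hamiltonian L H"
    and H_C2: "cont_diff 2 (\<lambda>(y, p). H (to_torus y) p)" and e: "e > 0"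
    and D: "\<And>X. open X \<Longrightarrow> X \<noteq> {} \<Longrightarrow> \<exists>d\<in>D. d \<in> X"
  shows "\<exists>p\<in>D. L x a - e < - H x p - a \<bullet> p"
proof -
  note sl = cont_diff_slices[OF H_C2]
  obtain q where q: "L x a - e / 2 \<le> - H x q - a \<bullet> q" by (rule lagrangian_approx[OF L H, of "e/2"]) (use e in auto)
  have "continuous_on UNIV (\<lambda>p. (\<lambda>(y, p). H (to_torus y) p) (torus_rep x, p))"
    by (intro continuous_on_compose2[OF sl(3)] continuous_intros) auto
  then have "continuous_on UNIV (H x)" by simp
  then have c: "continuous_on UNIV (\<lambda>p. - H x p - a \<bullet> p)"
    by (intro continuous_intros)
  let ?X = "{p. L x a - e < - H x p - a \<bullet> p}"
  have "open ?X" by (rule open_Collect_less[OF continuous_on_const c])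
  moreover have "q \<in> ?X" using q e by simp
  ultimately show ?thesis using D[of ?X] by blast
qed

lemma hamiltonian_torus_continuous:
  fixes H :: "'n::finite torus \<Rightarrow> real ^ 'n \<Rightarrow> real"
  assumes "cont_diff 2 (\<lambda>(y, p). H (to_torus y) p)"
  shows "continuous_on UNIV (\<lambda>x. H x p)"
proof (rule continuous_on_torusI)
  have "continuous_on UNIV (\<lambda>y. (\<lambda>(y, p). H (to_torus y) p) (y, p))"
    by (intro continuous_on_compose2[OF cont_diff_slices(3)[OF assms]] continuous_intros) auto
  then show "continuous_on UNIV (\<lambda>y. H (to_torus y) p)" by simp
qed

section \<open>Conditional expectation of the control\<close>

text \<open>Each sublevel set of \<open>f\<close> at a rational level \<open>q\<close> is the
  preimage under \<open>Z\<close> of some \<open>A q\<close>, and the value is recovered as the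
  infimum of the rationals \<open>q\<close> with \<open>Z x\<close> in \<open>A q\<close>. The
  infimum is extended real because off the range of \<open>Z\<close> it may be infinite.\<close>

lemma doob_dynkin:
  fixes f :: "'a \<Rightarrow> real"
  assumes f: "f \<in> borel_measurable (vimage_algebra X Z S)" and Z: "Z \<in> X \<rightarrow> space S"
  obtains g where "g \<in> borel_measurable S" "\<And>x. x \<in> X \<Longrightarrow> f x = g (Z x)"
proof -
  have "\<exists>A\<in>sets S. {x \<in> X. f x < of_rat q} = Z -` A \<inter> X" for q :: rat
  proof -
    have "{x \<in> space (vimage_algebra X Z S). f x < of_rat q} \<in> sets (vimage_algebra X Z S)"
      using f by measurable
    then show ?thesis unfolding sets_vimage_algebra2[OF Z] by auto
  qed
  then obtain A where A: "\<And>q. A q \<in> sets S" "\<And>q. {x \<in> X. f x < of_rat q} = Z -` A q \<inter> X"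
    by metis
  define h where "h z = (INF q::rat. if z \<in> A q then ereal (of_rat q) else \<infinity>)" for z
  have [measurable]: "h \<in> borel_measurable S"
    unfolding h_def using A(1) by (intro borel_measurable_INF measurable_If_set) auto
  have "f x = real_of_ereal (h (Z x))" if x: "x \<in> X" for x
  proof -
    have e: "Z x \<in> A q \<longleftrightarrow> f x < of_rat q" for q using A(2)[of q] x by blast
    have "h (Z x) = ereal (f x)"
      unfolding h_def e
    proof (rule INF_eqI)
      fix y :: ereal
      assume y: "\<And>q. q \<in> UNIV \<Longrightarrow> y \<le> (if f x < of_rat q then ereal (of_rat q) else \<infinity>)"
      show "y \<le> ereal (f x)"
      proof (rule ccontr)
        assume "\<not> y \<le> ereal (f x)"
        then obtain r where r: "ereal (f x) < ereal r" "ereal r < y"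
          by (metis ereal_dense2 ereal_less_eq(3) linorder_not_le less_ereal.simps(1) order_less_imp_le ereal_dense3)
        then obtain q where q: "f x < of_rat q" "of_rat q < r" using of_rat_dense[of "f x" r] by auto
        have "y \<le> ereal (of_rat q)" using y[of q] q(1) by simp
        also have "\<dots> < ereal r" using q(2) by simp
        finally show False using r(2) by simp
      qed
    qed (auto intro: less_imp_le)
    then show ?thesis by simp
  qed
  then show ?thesis using that[of "\<lambda>z. real_of_ereal (h z)"] by auto
qed

abbreviation cond_on :: "'a measure \<Rightarrow> ('a \<Rightarrow> 's) \<Rightarrow> 's measure \<Rightarrow> 'a measure" where
  "cond_on P Z S \<equiv> vimage_algebra (space P) Z S"

lemma subalgebra_cond_on: "Z \<in> P \<rightarrow>\<^sub>M S \<Longrightarrow> subalgebra P (cond_on P Z S)"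
proof -
  assume Z: "Z \<in> P \<rightarrow>\<^sub>M S"
  then have "Z \<in> space P \<rightarrow> space S" using measurable_space by auto
  then show ?thesis unfolding subalgebra_def using measurable_sets[OF Z] by (auto simp: sets_vimage_algebra2)
qed

lemma cond_on_sigma_finite:
  assumes "finite_measure P" "Z \<in> P \<rightarrow>\<^sub>M S"
  shows "sigma_finite_subalgebra P (cond_on P Z S)"
proof -
  interpret finite_measure P by fact
  interpret finite_measure_subalgebra P "cond_on P Z S"
    by unfold_locales (rule subalgebra_cond_on[OF assms(2)])
  show ?thesis ..
qed

text \<open>The Doob-Dynkin factorisation is applied to each coordinate. The equality holds at every
  point of \<open>space P\<close>, for the version that \<open>real_cond_exp\<close>
  selects.\<close>

lemma conditional_control:
  fixes \<alpha> :: "'a \<Rightarrow> real ^ 'n"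
  assumes "Z \<in> P \<rightarrow>\<^sub>M S"
  obtains A where "A \<in> borel_measurable S"
    "\<And>x k. x \<in> space P \<Longrightarrow> A (Z x) $ k = real_cond_exp P (cond_on P Z S) (\<lambda>x. \<alpha> x $ k) x"
proof -
  have "Z \<in> space P \<rightarrow> space S" using measurable_space[OF assms] by auto
  then have "\<exists>g. g \<in> borel_measurable S \<and> (\<forall>x\<in>space P. real_cond_exp P (cond_on P Z S) (\<lambda>x. \<alpha> x $ k) x = g (Z x))" for k
    using doob_dynkin[of "real_cond_exp P (cond_on P Z S) (\<lambda>x. \<alpha> x $ k)" "space P" Z S]
      borel_measurable_cond_exp by metis
  then obtain g where g: "\<And>k. g k \<in> borel_measurable S"
    "\<And>k x. x \<in> space P \<Longrightarrow> real_cond_exp P (cond_on P Z S) (\<lambda>x. \<alpha> x $ k) x = g k (Z x)" by metis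
  show ?thesis
    using that[of "\<lambda>z. \<chi> k. g k z"] g measurable_vec_lambda[of "\<lambda>z k. g k z" S] by simp
qed

lemma conditional_control_integral:
  fixes \<alpha> :: "'a \<Rightarrow> real ^ 'n" and A :: "'s \<Rightarrow> real ^ 'n"
  assumes P: "finite_measure P" and Z: "Z \<in> P \<rightarrow>\<^sub>M S"
    and \<alpha>: "\<And>k. integrable P (\<lambda>x. \<alpha> x $ k)"
    and A: "\<And>x k. x \<in> space P \<Longrightarrow> A (Z x) $ k = real_cond_exp P (cond_on P Z S) (\<lambda>x. \<alpha> x $ k) x"
    and g: "g \<in> borel_measurable S" "\<And>z. \<bar>g z\<bar> \<le> C"
  shows "integrable P (\<lambda>x. g (Z x) * A (Z x) $ k)"
    and "(\<integral>x. g (Z x) * A (Z x) $ k \<partial>P) = (\<integral>x. g (Z x) * \<alpha> x $ k \<partial>P)"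
proof -
  interpret sigma_finite_subalgebra P "cond_on P Z S" by (rule cond_on_sigma_finite[OF P Z])
  have Zc: "Z \<in> cond_on P Z S \<rightarrow>\<^sub>M S" using measurable_space[OF Z] by (intro measurable_vimage_algebra1) auto
  have gZ: "(\<lambda>x. g (Z x)) \<in> borel_measurable (cond_on P Z S)" by (rule measurable_compose[OF Zc g(1)])
  have gP: "(\<lambda>x. g (Z x)) \<in> borel_measurable P" by (rule measurable_compose[OF Z g(1)])
  have i: "integrable P (\<lambda>x. g (Z x) * \<alpha> x $ k)"
    by (rule Bochner_Integration.integrable_bound[of _ "\<lambda>x. C * \<alpha> x $ k"])
      (use \<alpha>[of k] gP g(2) in \<open>auto simp: abs_mult intro!: mult_mono order_trans[OF g(2) abs_ge_self] borel_measurable_times\<close>)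
  have ce: "integrable P (\<lambda>x. g (Z x) * real_cond_exp P (cond_on P Z S) (\<lambda>x. \<alpha> x $ k) x)"
    "(\<integral>x. g (Z x) * real_cond_exp P (cond_on P Z S) (\<lambda>x. \<alpha> x $ k) x \<partial>P) = (\<integral>x. g (Z x) * \<alpha> x $ k \<partial>P)"
    using real_cond_exp_intg[OF i gZ] \<alpha>[of k] by auto
  show "integrable P (\<lambda>x. g (Z x) * A (Z x) $ k)"
    using ce(1) by (subst Bochner_Integration.integrable_cong[OF refl]) (auto simp: A)
  show "(\<integral>x. g (Z x) * A (Z x) $ k \<partial>P) = (\<integral>x. g (Z x) * \<alpha> x $ k \<partial>P)"
    unfolding ce(2)[symmetric] by (rule Bochner_Integration.integral_cong) (auto simp: A)
qed

text \<open>\<open>\<Phi> z\<close> is the supremum of affine functions whose slopes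
  \<open>p\<close> range over a countable set common to all \<open>z\<close>. Countability lets
  almost sure inequalities for single slopes be combined; bounded measurable intercepts are
  integrable for any finite measure.\<close>

definition affine_sup :: "'s measure \<Rightarrow> (real ^ 'n) set \<Rightarrow> (real ^ 'n \<Rightarrow> 's \<Rightarrow> real) \<Rightarrow> ('s \<Rightarrow> real ^ 'n \<Rightarrow> real) \<Rightarrow> bool" where
  "affine_sup S Q c \<Phi> \<longleftrightarrow> countable Q \<and> Q \<noteq> {} \<and>
     (\<forall>p\<in>Q. c p \<in> borel_measurable S \<and> (\<exists>C. \<forall>z. \<bar>c p z\<bar> \<le> C)) \<and>
     (\<forall>z a. \<forall>p\<in>Q. c p z + a \<bullet> p \<le> \<Phi> z a) \<and>
     (\<forall>z a. \<forall>e>0. \<exists>p\<in>Q. \<Phi> z a - e < c p z + a \<bullet> p)"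

lemma affine_sup_measurable:
  assumes "affine_sup S Q c \<Phi>"
  shows "(\<lambda>(z, a). \<Phi> z a) \<in> borel_measurable (S \<Otimes>\<^sub>M borel)"
proof -
  note as = assms[unfolded affine_sup_def]
  have "\<Phi> z a = (SUP p\<in>Q. c p z + a \<bullet> p)" for z a
  proof (rule cSup_eq_non_empty[symmetric])
    show "(\<lambda>p. c p z + a \<bullet> p) ` Q \<noteq> {}" using as by simp
    show "x \<le> \<Phi> z a" if "x \<in> (\<lambda>p. c p z + a \<bullet> p) ` Q" for x using as that by auto
    show "\<Phi> z a \<le> y" if y: "\<And>x. x \<in> (\<lambda>p. c p z + a \<bullet> p) ` Q \<Longrightarrow> x \<le> y" for y
    proof (rule field_le_epsilon)
      fix e :: real assume "0 < e"
      then obtain p where "p \<in> Q" "\<Phi> z a - e < c p z + a \<bullet> p" using as by meson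
      then show "\<Phi> z a \<le> y + e" using y by fastforce
    qed
  qed
  then have e: "(\<lambda>(z, a). \<Phi> z a) = (\<lambda>x. SUP p\<in>Q. c p (fst x) + snd x \<bullet> p)" by auto
  show ?thesis unfolding e
  proof (rule borel_measurable_cSUP)
    show "countable Q" using as by blast
    fix p assume "p \<in> Q"
    then have [measurable]: "c p \<in> borel_measurable S" using as by blast
    show "(\<lambda>x. c p (fst x) + snd x \<bullet> p) \<in> borel_measurable (S \<Otimes>\<^sub>M borel)" by measurable
  next
    fix x
    show "bdd_above ((\<lambda>p. c p (fst x) + snd x \<bullet> p) ` Q)"
      by (rule bdd_aboveI[of _ "\<Phi> (fst x) (snd x)"]) (use as in auto)
  qed
qed

text \<open>Each affine minorant commutes with conditional expectation, so it lies below the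
  conditional expectation of \<open>\<Phi> (Z x) (\<alpha> x)\<close> almost surely; the supremum
  over the countably many slopes does too. Integrability follows by squeezing between one affine
  minorant and that conditional expectation.\<close>

lemma conditional_jensen:
  fixes \<alpha> :: "'a \<Rightarrow> real ^ 'n" and A :: "'s \<Rightarrow> real ^ 'n"
  assumes P: "finite_measure P" and Z: "Z \<in> P \<rightarrow>\<^sub>M S"
    and \<alpha>: "\<And>k. integrable P (\<lambda>x. \<alpha> x $ k)"
    and A: "\<And>x k. x \<in> space P \<Longrightarrow> A (Z x) $ k = real_cond_exp P (cond_on P Z S) (\<lambda>x. \<alpha> x $ k) x"
    and Am: "A \<in> borel_measurable S"
    and as: "affine_sup S Q c \<Phi>"
    and \<Phi>: "integrable P (\<lambda>x. \<Phi> (Z x) (\<alpha> x))"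
  shows "integrable P (\<lambda>x. \<Phi> (Z x) (A (Z x)))"
    and "(\<integral>x. \<Phi> (Z x) (A (Z x)) \<partial>P) \<le> (\<integral>x. \<Phi> (Z x) (\<alpha> x) \<partial>P)"
proof -
  interpret finite_measure P by fact
  interpret sigma_finite_subalgebra P "cond_on P Z S" by (rule cond_on_sigma_finite[OF P Z])
  note as' = as[unfolded affine_sup_def]
  let ?E = "real_cond_exp P (cond_on P Z S)"
  let ?l = "?E (\<lambda>x. \<Phi> (Z x) (\<alpha> x))"
  have Zc: "Z \<in> cond_on P Z S \<rightarrow>\<^sub>M S" using measurable_space[OF Z] by (intro measurable_vimage_algebra1) auto
  have inner: "v \<bullet> p = (\<Sum>k\<in>UNIV. p $ k * v $ k)" for v p :: "real ^ 'n"
    by (simp add: inner_vec_def mult.commute)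
  have ci: "integrable P (\<lambda>x. c p (Z x))" if "p \<in> Q" for p
  proof -
    obtain C where "\<forall>z. \<bar>c p z\<bar> \<le> C" using as' \<open>p \<in> Q\<close> by blast
    moreover have "(\<lambda>x. c p (Z x)) \<in> borel_measurable P"
      using as' \<open>p \<in> Q\<close> by (intro measurable_compose[OF Z]) blast
    ultimately show ?thesis by (intro integrable_const_bound[of _ C]) auto
  qed
  have le: "AE x in P. c p (Z x) + A (Z x) \<bullet> p \<le> ?l x" if p: "p \<in> Q" for p
  proof -
    have ai: "integrable P (\<lambda>x. p $ k * \<alpha> x $ k)" for k using \<alpha> by simp
    have si: "integrable P (\<lambda>x. \<Sum>k\<in>UNIV. p $ k * \<alpha> x $ k)" using ai by simp
    have "AE x in P. ?E (\<lambda>x. c p (Z x) + (\<Sum>k\<in>UNIV. p $ k * \<alpha> x $ k)) x \<le> ?l x"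
    proof (rule real_cond_exp_mono)
      show "AE x in P. c p (Z x) + (\<Sum>k\<in>UNIV. p $ k * \<alpha> x $ k) \<le> \<Phi> (Z x) (\<alpha> x)"
        using as' p unfolding inner[symmetric] by auto
    qed (use ci[OF p] si \<Phi> in auto)
    moreover have "AE x in P. ?E (\<lambda>x. c p (Z x) + (\<Sum>k\<in>UNIV. p $ k * \<alpha> x $ k)) x
        = ?E (\<lambda>x. c p (Z x)) x + ?E (\<lambda>x. \<Sum>k\<in>UNIV. p $ k * \<alpha> x $ k) x"
      by (rule real_cond_exp_add[OF ci[OF p] si])
    moreover have "AE x in P. ?E (\<lambda>x. c p (Z x)) x = c p (Z x)"
      using as' p by (intro real_cond_exp_F_meas ci[OF p] measurable_compose[OF Zc]) blast
    moreover have "AE x in P. ?E (\<lambda>x. \<Sum>k\<in>UNIV. p $ k * \<alpha> x $ k) x = (\<Sum>k\<in>UNIV. ?E (\<lambda>x. p $ k * \<alpha> x $ k) x)"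
      by (rule real_cond_exp_sum[OF ai])
    moreover have "AE x in P. \<forall>k\<in>UNIV. ?E (\<lambda>x. p $ k * \<alpha> x $ k) x = p $ k * ?E (\<lambda>x. \<alpha> x $ k) x"
      by (rule AE_finite_allI) (auto intro: real_cond_exp_cmult \<alpha>)
    ultimately show ?thesis
      using AE_space
    proof eventually_elim
      case (elim x)
      have "A (Z x) \<bullet> p = (\<Sum>k\<in>UNIV. p $ k * ?E (\<lambda>x. \<alpha> x $ k) x)"
        unfolding inner using A[OF elim(6)] by simp
      then show ?case using elim by simp
    qed
  qed
  have up: "AE x in P. \<Phi> (Z x) (A (Z x)) \<le> ?l x"
  proof -
    have "AE x in P. \<forall>p\<in>Q. c p (Z x) + A (Z x) \<bullet> p \<le> ?l x"
      using le as' by (subst AE_ball_countable) auto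
    then show ?thesis
    proof eventually_elim
      case (elim x)
      show ?case
      proof (rule field_le_epsilon)
        fix e :: real assume "0 < e"
        then obtain p where "p \<in> Q" "\<Phi> (Z x) (A (Z x)) - e < c p (Z x) + A (Z x) \<bullet> p" using as' by meson
        then show "\<Phi> (Z x) (A (Z x)) \<le> ?l x + e" using elim by fastforce
      qed
    qed
  qed
  have li: "integrable P ?l" and lE: "(\<integral>x. ?l x \<partial>P) = (\<integral>x. \<Phi> (Z x) (\<alpha> x) \<partial>P)"
    using real_cond_exp_int[OF \<Phi>] by auto
  obtain p where p: "p \<in> Q" using as' by blast
  have Ai: "integrable P (\<lambda>x. A (Z x) $ k)" for k
    using real_cond_exp_int(1)[OF \<alpha>, of k] by (subst Bochner_Integration.integrable_cong[OF refl]) (auto simp: A)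
  have low: "integrable P (\<lambda>x. c p (Z x) + A (Z x) \<bullet> p)"
    unfolding inner using ci[OF p] Ai by simp
  have ZA: "(\<lambda>x. (Z x, A (Z x))) \<in> P \<rightarrow>\<^sub>M S \<Otimes>\<^sub>M borel"
    using Z Am by measurable
  have m: "(\<lambda>x. \<Phi> (Z x) (A (Z x))) \<in> borel_measurable P"
    using measurable_compose[OF ZA affine_sup_measurable[OF as]] by simp
  show i: "integrable P (\<lambda>x. \<Phi> (Z x) (A (Z x)))"
  proof (rule Bochner_Integration.integrable_bound[OF _ m])
    show "integrable P (\<lambda>x. \<bar>?l x\<bar> + \<bar>c p (Z x) + A (Z x) \<bullet> p\<bar>)" using li low by auto
    show "AE x in P. norm (\<Phi> (Z x) (A (Z x))) \<le> norm (\<bar>?l x\<bar> + \<bar>c p (Z x) + A (Z x) \<bullet> p\<bar>)"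
      using up
    proof eventually_elim
      case (elim x)
      have "c p (Z x) + A (Z x) \<bullet> p \<le> \<Phi> (Z x) (A (Z x))" using as' p by blast
      then show ?case using elim by simp
    qed
  qed
  show "(\<integral>x. \<Phi> (Z x) (A (Z x)) \<partial>P) \<le> (\<integral>x. \<Phi> (Z x) (\<alpha> x) \<partial>P)"
    unfolding lE[symmetric] by (rule integral_mono_AE[OF i li up])
qed

section \<open>Jensen's inequality for functionals of the empirical measure\<close>

lemma measure_mixture:
  assumes "m1 \<in> torus_probs" "m2 \<in> torus_probs" "A \<in> sets borel" "0 \<le> \<theta>" "\<theta> \<le> 1"
  shows "measure (mixture \<theta> m1 m2) A = (1 - \<theta>) * measure m1 A + \<theta> * measure m2 A"
proof -
  interpret m1: prob_space m1 by (rule torus_probsD[OF assms(1)])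
  interpret m2: prob_space m2 by (rule torus_probsD[OF assms(2)])
  have "emeasure (mixture \<theta> m1 m2) A = ennreal ((1 - \<theta>) * measure m1 A + \<theta> * measure m2 A)"
    using assms by (simp add: emeasure_mixture m1.emeasure_eq_measure m2.emeasure_eq_measure
        flip: ennreal_mult ennreal_plus)
  then show ?thesis using assms by (intro measure_eq_emeasure_eq_ennreal) auto
qed

lemma mixture_torus_probs:
  assumes "m1 \<in> torus_probs" "m2 \<in> torus_probs" "0 \<le> \<theta>" "\<theta> \<le> 1"
  shows "mixture \<theta> m1 m2 \<in> torus_probs"
proof -
  interpret m1: prob_space m1 by (rule torus_probsD[OF assms(1)])
  interpret m2: prob_space m2 by (rule torus_probsD[OF assms(2)])
  have sp: "space (mixture \<theta> m1 m2) = UNIV" using sets_eq_imp_space_eq[OF sets_mixture] by simp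
  have "emeasure (mixture \<theta> m1 m2) UNIV = ennreal ((1 - \<theta>) + \<theta>)"
    using assms m1.emeasure_space_1 m2.emeasure_space_1 torus_probsD(3)[OF assms(1)] torus_probsD(3)[OF assms(2)]
    by (subst emeasure_mixture) (simp_all flip: ennreal_plus)
  then show ?thesis by (auto simp: torus_probs_def sp intro!: prob_spaceI)
qed

lemma torus_probs_eqI:
  assumes "m1 \<in> torus_probs" "m2 \<in> torus_probs" "\<And>A. A \<in> sets borel \<Longrightarrow> measure m1 A = measure m2 A"
  shows "m1 = m2"
proof -
  interpret m1: prob_space m1 by (rule torus_probsD[OF assms(1)])
  interpret m2: prob_space m2 by (rule torus_probsD[OF assms(2)])
  show ?thesis
    by (rule measure_eqI)
      (simp_all add: assms(3) torus_probsD(2)[OF assms(1)] torus_probsD(2)[OF assms(2)]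
        m1.emeasure_eq_measure m2.emeasure_eq_measure)
qed

text \<open>Binary mixtures are iterated: the new measure is mixed with the renormalised mixture of
  the others. The result is described by its values on Borel sets, which determine it.\<close>

lemma convex_finite_mixture:
  fixes F :: "'n::finite torus measure \<Rightarrow> real"
  assumes F: "convex_on_probs F" and J: "finite J" "J \<noteq> {}"
    and w: "\<And>j. j \<in> J \<Longrightarrow> 0 \<le> w j" "sum w J = 1" and \<mu>: "\<And>j. j \<in> J \<Longrightarrow> \<mu> j \<in> torus_probs"
  shows "\<exists>m\<in>torus_probs. (\<forall>A\<in>sets borel. measure m A = (\<Sum>j\<in>J. w j * measure (\<mu> j) A)) \<and> F m \<le> (\<Sum>j\<in>J. w j * F (\<mu> j))"
  using J w \<mu>
proof (induction J arbitrary: w rule: finite_ne_induct)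
  case (singleton k)
  then show ?case by (intro bexI[of _ "\<mu> k"]) auto
next
  case (insert k J)
  have s: "w k + sum w J = 1" using insert by simp
  have nn: "0 \<le> sum w J" using insert by (intro sum_nonneg) auto
  show ?case
  \<comment> \<open>Here renormalising by \<open>1 - w k\<close> would divide by zero; the remaining
    weights all vanish.\<close>
  proof (cases "w k = 1")
    case True
    then have "\<forall>j\<in>J. w j = 0" using s insert.prems(1) insert.hyps(1) by (simp add: sum_nonneg_eq_0_iff)
    then show ?thesis using True insert by (intro bexI[of _ "\<mu> k"]) auto
  next
    case False
    let ?r = "1 - w k"
    have r: "?r > 0" using False s nn by linarith
    obtain m where m: "m \<in> torus_probs" "\<forall>A\<in>sets borel. measure m A = (\<Sum>j\<in>J. w j / ?r * measure (\<mu> j) A)"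
      "F m \<le> (\<Sum>j\<in>J. w j / ?r * F (\<mu> j))"
      using insert.IH[of "\<lambda>j. w j / ?r"] insert.prems r s by (auto simp flip: sum_divide_distrib)
    have k: "\<mu> k \<in> torus_probs" and wk: "0 \<le> w k" "w k \<le> 1" using insert.prems r by auto
    have e: "?r * (\<Sum>j\<in>J. w j / ?r * f j) = (\<Sum>j\<in>J. w j * f j)" for f :: "_ \<Rightarrow> real"
      using r by (simp add: sum_distrib_left)
    show ?thesis
    proof (intro bexI[of _ "mixture (w k) m (\<mu> k)"] conjI ballI mixture_torus_probs m(1) k wk)
      fix A :: "'n torus set" assume A: "A \<in> sets borel"
      show "measure (mixture (w k) m (\<mu> k)) A = (\<Sum>j\<in>insert k J. w j * measure (\<mu> j) A)"
        unfolding measure_mixture[OF m(1) k A wk] m(2)[rule_format, OF A] e using insert.hyps by simp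
    next
      have "F (mixture (w k) m (\<mu> k)) \<le> ?r * F m + w k * F (\<mu> k)"
        using F m(1) k wk unfolding convex_on_probs_def by simp
      also have "\<dots> \<le> ?r * (\<Sum>j\<in>J. w j / ?r * F (\<mu> j)) + w k * F (\<mu> k)"
        using m(3) r by (intro add_right_mono mult_left_mono) auto
      also have "\<dots> = (\<Sum>j\<in>insert k J. w j * F (\<mu> j))"
        unfolding e using insert.hyps by simp
      finally show "F (mixture (w k) m (\<mu> k)) \<le> (\<Sum>j\<in>insert k J. w j * F (\<mu> j))" .
    qed
  qed
qed

section \<open>Functionals of rounded configurations, measurability and Jensen's inequality\<close>

lemma measure_empirical:
  fixes x :: "nat \<Rightarrow> 'n::finite torus"
  assumes A: "A \<in> sets borel"
  shows "measure (empirical N x) A = (\<Sum>i<N. indicat_real A (x i)) / real N"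
proof -
have "emeasure (empirical N x) A = ennreal ((1 / real N) * (\<Sum>i<N. indicat_real A (x i)))"
  using A sum_ennreal[of "{..<N}" "\<lambda>i. indicat_real A (x i)"]
  by (simp add: emeasure_empirical ennreal_indicator del: sum_ennreal)
    (subst ennreal_mult[symmetric], auto intro!: sum_nonneg)
then show ?thesis by (simp add: measure_def sum_nonneg)
  qed

text \<open>Entries from \<open>N\<close> on are irrelevant to the empirical measure; fixing them at
  0 leaves only finitely many configurations once the positions take finitely many values.\<close>

definition truncate_config :: "nat \<Rightarrow> (nat \<Rightarrow> 'n::finite torus) \<Rightarrow> nat \<Rightarrow> 'n torus" where
  "truncate_config N x i = (if i < N then x i else 0)"

lemma empirical_truncate: "empirical N (truncate_config N x) = empirical N x"
  unfolding empirical_def truncate_config_def by (intro arg_cong[where f="measure_of _ _"] ext) simp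

lemma finite_config_measurable:
  fixes X :: "nat \<Rightarrow> 'a \<Rightarrow> 'n::finite torus"
  assumes X: "\<And>i. i < N \<Longrightarrow> X i \<in> borel_measurable S" and R: "finite R" "\<And>i s. X i s \<in> R"
  defines "\<xi> \<equiv> \<lambda>s. truncate_config N (\<lambda>i. X i s)"
  shows "finite (\<xi> ` space S)" and "\<xi> \<in> S \<rightarrow>\<^sub>M count_space (\<xi> ` space S)"
proof -
  have "\<xi> ` space S \<subseteq> {f. \<forall>i. (i \<in> {..<N} \<longrightarrow> f i \<in> R) \<and> (i \<notin> {..<N} \<longrightarrow> f i = 0)}"
    using R(2) by (auto simp: \<xi>_def truncate_config_def)
  then show fin: "finite (\<xi> ` space S)"
    using finite_set_of_finite_funs[of "{..<N}" R 0] R(1) by (auto intro: finite_subset)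
  show "\<xi> \<in> S \<rightarrow>\<^sub>M count_space (\<xi> ` space S)"
    unfolding measurable_count_space_eq2[OF fin]
  proof (intro conjI ballI)
    fix f assume f: "f \<in> \<xi> ` space S"
    obtain x where x: "f = \<xi> x" using f by blast
    have "\<xi> s = f \<longleftrightarrow> (\<forall>i\<in>{..<N}. X i s \<in> {f i})" for s
    proof
      assume "\<forall>i\<in>{..<N}. X i s \<in> {f i}"
      then have "\<xi> s i = f i" for i by (cases "i < N") (simp_all add: x \<xi>_def truncate_config_def)
      then show "\<xi> s = f" by blast
    qed (auto simp: \<xi>_def truncate_config_def)
    then have "\<xi> -` {f} \<inter> space S = {s \<in> space S. \<forall>i\<in>{..<N}. X i s \<in> {f i}}"
      by auto
    also have "\<dots> \<in> sets S"
    proof (rule sets.sets_Collect_finite_All)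
      fix i assume "i \<in> {..<N}"
      then show "{s \<in> space S. X i s \<in> {f i}} \<in> sets S"
        using measurable_sets[OF X, of i "{f i}"] by (simp add: vimage_def Int_def conj_commute)
    qed simp
    finally show "\<xi> -` {f} \<inter> space S \<in> sets S" .
  qed auto
qed

text \<open>On a finite discrete set of configurations every function is measurable, so
  \<open>F\<close> may be arbitrary at this stage.\<close>

lemma finite_config_functional_measurable:
  fixes X :: "nat \<Rightarrow> 'a \<Rightarrow> 'n::finite torus"
  assumes X: "\<And>i. i < N \<Longrightarrow> X i \<in> borel_measurable S" and R: "finite R" "\<And>i s. X i s \<in> R"
  shows "(\<lambda>s. F (empirical N (\<lambda>i. X i s)) :: real) \<in> borel_measurable S"
proof -
  have "(\<lambda>s. truncate_config N (\<lambda>i. X i s)) \<in> S \<rightarrow>\<^sub>M count_space ((\<lambda>s. truncate_config N (\<lambda>i. X i s)) ` space S)"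
    by (rule finite_config_measurable(2)) (use X R in auto)
  then have "(\<lambda>s. F (empirical N (truncate_config N (\<lambda>i. X i s)))) \<in> borel_measurable S"
    by (rule measurable_compose[where g="\<lambda>f. F (empirical N f)"]) auto
  then show ?thesis by (simp add: empirical_truncate)
qed

lemma discretization_sequence:
  obtains D :: "nat \<Rightarrow> 'n::finite torus \<Rightarrow> 'n torus"
  where "\<And>k. finite (range (D k))" "\<And>k. D k \<in> borel_measurable borel" "\<And>k x. dist (D k x) x \<le> inverse (real (Suc k))"
proof -
  have "\<exists>D :: 'n torus \<Rightarrow> 'n torus. finite (range D) \<and> D \<in> borel_measurable borel \<and> (\<forall>x. dist (D x) x < inverse (real (Suc k)))" for k
    using torus_discretization[of "inverse (real (Suc k))"] by (metis inverse_positive_iff_positive of_nat_0_less_iff zero_less_Suc)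
  then obtain D :: "nat \<Rightarrow> 'n torus \<Rightarrow> 'n torus" where "\<And>k. finite (range (D k)) \<and> D k \<in> borel_measurable borel \<and> (\<forall>x. dist (D k x) x < inverse (real (Suc k)))"
    by metis
  then show ?thesis using that[of D] by (meson less_imp_le)
qed

text \<open>The functional is a pointwise limit of functionals of rounded positions: rounding by
  \<open>1 / (k + 1)\<close> moves the empirical measure by at most that much in
  \<open>d1\<close>.\<close>

lemma empirical_functional_measurable:
  fixes X :: "nat \<Rightarrow> 'a \<Rightarrow> 'n::finite torus" and F :: "'n torus measure \<Rightarrow> real"
  assumes N: "N \<ge> 1" and X: "\<And>i. i < N \<Longrightarrow> X i \<in> borel_measurable S" and F: "d1_lipschitz F"
  shows "(\<lambda>s. F (empirical N (\<lambda>i. X i s))) \<in> borel_measurable S"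
proof -
  obtain D :: "nat \<Rightarrow> 'n torus \<Rightarrow> 'n torus" where D: "\<And>k. finite (range (D k))" "\<And>k. D k \<in> borel_measurable borel"
    "\<And>k x. dist (D k x) x \<le> inverse (real (Suc k))" using discretization_sequence by blast
  obtain K where K: "K \<ge> 0" "\<And>m1 m2. m1 \<in> torus_probs \<Longrightarrow> m2 \<in> torus_probs \<Longrightarrow> \<bar>F m1 - F m2\<bar> \<le> K * d1 m1 m2"
    using d1_lipschitzE[OF F] by blast
  show ?thesis
  proof (rule borel_measurable_LIMSEQ_real)
    fix s
    show "(\<lambda>k. F (empirical N (\<lambda>i. D k (X i s)))) \<longlonglongrightarrow> F (empirical N (\<lambda>i. X i s))"
    proof (rule LIM_zero_cancel, rule Lim_null_comparison)
      show "\<forall>\<^sub>F k in sequentially. norm (F (empirical N (\<lambda>i. D k (X i s))) - F (empirical N (\<lambda>i. X i s))) \<le> K * inverse (real (Suc k))"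
      proof (rule always_eventually, rule allI)
        fix k
        have "K * d1 (empirical N (\<lambda>i. D k (X i s))) (empirical N (\<lambda>i. X i s)) \<le> K * inverse (real (Suc k))"
          using D(3) K(1) by (intro mult_left_mono d1_empirical_le[OF N]) auto
        then show "norm (F (empirical N (\<lambda>i. D k (X i s))) - F (empirical N (\<lambda>i. X i s))) \<le> K * inverse (real (Suc k))"
          using K(2)[OF empirical_torus_probs[OF N] empirical_torus_probs[OF N], of "\<lambda>i. D k (X i s)" "\<lambda>i. X i s"] by simp
      qed
      show "(\<lambda>k. K * inverse (real (Suc k))) \<longlonglongrightarrow> 0"
        using tendsto_mult_right_zero[OF LIMSEQ_inverse_real_of_nat] by simp
    qed
  next
    fix k
    show "(\<lambda>s. F (empirical N (\<lambda>i. D k (X i s)))) \<in> borel_measurable S"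
      by (rule finite_config_functional_measurable[OF _ D(1)[of k]]) (use X D(2) measurable_compose in auto)
  qed
qed

text \<open>Rounding the positions gives a random empirical measure with finitely many values, to
  which finite convexity applies. Its mean is the image of \<open>m\<close> under the rounding, so
  rounding costs \<open>K * \<delta>\<close> once for \<open>m\<close> and once under the
  expectation.\<close>

theorem jensen_empirical:
  fixes X :: "nat \<Rightarrow> 'a \<Rightarrow> 'n::finite torus" and F :: "'n torus measure \<Rightarrow> real"
  assumes M: "prob_space M" and N: "N \<ge> 1" and X: "\<And>i. i < N \<Longrightarrow> X i \<in> borel_measurable M"
    and F: "convex_on_probs F" "d1_lipschitz F" and m: "m \<in> torus_probs"
    and law: "\<And>A. A \<in> sets borel \<Longrightarrow> measure m A = (\<Sum>i<N. measure M {\<omega> \<in> space M. X i \<omega> \<in> A}) / real N"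
  shows "integrable M (\<lambda>\<omega>. F (empirical N (\<lambda>i. X i \<omega>)))"
    and "F m \<le> (\<integral>\<omega>. F (empirical N (\<lambda>i. X i \<omega>)) \<partial>M)"
proof -
  interpret prob_space M by fact
  obtain BF where BF: "BF \<ge> 0" "\<And>m. m \<in> torus_probs \<Longrightarrow> \<bar>F m\<bar> \<le> BF" using d1_lipschitz_bounded[OF F(2)] by blast
  obtain K where K: "K \<ge> 0" "\<And>m1 m2. m1 \<in> torus_probs \<Longrightarrow> m2 \<in> torus_probs \<Longrightarrow> \<bar>F m1 - F m2\<bar> \<le> K * d1 m1 m2"
    using d1_lipschitzE[OF F(2)] by blast
  have int: "integrable M (\<lambda>\<omega>. F (empirical N (\<lambda>i. X' i \<omega>)))" if "\<And>i. i < N \<Longrightarrow> X' i \<in> borel_measurable M" for X'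
    by (rule integrable_const_bound[of _ BF])
      (use BF(2) empirical_torus_probs[OF N] empirical_functional_measurable[OF N that F(2)] in auto)
  show i: "integrable M (\<lambda>\<omega>. F (empirical N (\<lambda>i. X i \<omega>)))" by (rule int[OF X])
  show "F m \<le> (\<integral>\<omega>. F (empirical N (\<lambda>i. X i \<omega>)) \<partial>M)"
  proof (rule field_le_epsilon)
    fix e :: real assume e: "0 < e"
    \<comment> \<open>Chosen so that two rounding errors \<open>K * \<delta>\<close> fit into
      \<open>e\<close>; the summand 1 covers \<open>K = 0\<close>.\<close>
    define \<delta> where "\<delta> = e / (2 * (K + 1))"
    have \<delta>: "\<delta> > 0" "2 * (K * \<delta>) \<le> e" using e K(1) by (auto simp: \<delta>_def field_simps)
    obtain D :: "'n torus \<Rightarrow> 'n torus" where D: "finite (range D)" "D \<in> borel_measurable borel" "\<And>x. dist (D x) x < \<delta>"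
      using torus_discretization[OF \<delta>(1)] by blast
    let ?X = "\<lambda>i \<omega>. D (X i \<omega>)"
    have X': "?X i \<in> borel_measurable M" if "i < N" for i by (rule measurable_compose[OF X[OF that] D(2)])
    note fc = finite_config_measurable[OF X' D(1)]
    let ?\<xi> = "\<lambda>\<omega>. truncate_config N (\<lambda>i. ?X i \<omega>)"
    let ?J = "?\<xi> ` space M"
    have fin: "finite ?J" by (rule fc) auto
    have \<xi>: "?\<xi> \<in> M \<rightarrow>\<^sub>M count_space ?J" by (rule fc) auto
    let ?w = "\<lambda>f. prob {\<omega> \<in> space M. ?\<xi> \<omega> = f}"
    have set\<xi>: "{\<omega> \<in> space M. ?\<xi> \<omega> = f} \<in> events" if "f \<in> ?J" for f
      using measurable_sets[OF \<xi>, of "{f}"] that by (simp add: vimage_def Int_def conj_commute)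
    \<comment> \<open>The change of variables formula for the finitely valued configuration; it
      yields the total weight 1, the values of the mixture and the mean of \<open>F\<close>.\<close>
    have sum\<xi>: "(\<integral>\<omega>. g (?\<xi> \<omega>) \<partial>M) = (\<Sum>f\<in>?J. ?w f * g f)" for g :: "_ \<Rightarrow> real"
    proof -
      have "(\<integral>\<omega>. g (?\<xi> \<omega>) \<partial>M) = (\<integral>\<omega>. (\<Sum>f\<in>?J. indicat_real {\<omega> \<in> space M. ?\<xi> \<omega> = f} \<omega> * g f) \<partial>M)"
      proof (rule Bochner_Integration.integral_cong[OF refl])
        fix \<omega> assume \<omega>: "\<omega> \<in> space M"
        have "(\<Sum>f\<in>?J. indicat_real {\<omega> \<in> space M. ?\<xi> \<omega> = f} \<omega> * g f) = (\<Sum>f\<in>?J. if f = ?\<xi> \<omega> then g f else 0)"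
          using \<omega> by (intro sum.cong) (auto simp: indicator_def)
        then show "g (?\<xi> \<omega>) = (\<Sum>f\<in>?J. indicat_real {\<omega> \<in> space M. ?\<xi> \<omega> = f} \<omega> * g f)"
          using fin \<omega> by simp
      qed
      also have "\<dots> = (\<Sum>f\<in>?J. ?w f * g f)"
      proof -
        have "integrable M (\<lambda>\<omega>. indicat_real {\<omega> \<in> space M. ?\<xi> \<omega> = f} \<omega> * g f)" if "f \<in> ?J" for f
          using set\<xi>[OF that] by (intro integrable_mult_left integrable_real_indicator) (auto simp: emeasure_eq_measure)
        moreover have "(\<integral>\<omega>. indicat_real {\<omega> \<in> space M. ?\<xi> \<omega> = f} \<omega> * g f \<partial>M) = ?w f * g f" if "f \<in> ?J" for f
          using set\<xi>[OF that] by simp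
        ultimately show ?thesis by (subst Bochner_Integration.integral_sum) (auto intro!: sum.cong)
      qed
      finally show ?thesis .
    qed
    have J: "?J \<noteq> {}" using not_empty by simp
    have w1: "(\<Sum>f\<in>?J. ?w f) = 1" using sum\<xi>[of "\<lambda>_. 1"] by (simp add: prob_space)
    obtain m' where m': "m' \<in> torus_probs" "\<forall>A\<in>sets borel. measure m' A = (\<Sum>f\<in>?J. ?w f * measure (empirical N f) A)"
      "F m' \<le> (\<Sum>f\<in>?J. ?w f * F (empirical N f))"
      using convex_finite_mixture[OF F(1) fin J, of ?w "empirical N"] w1 empirical_torus_probs[OF N] by auto
    have mD: "D \<in> borel_measurable m" using D(2) torus_probsD(2)[OF m] by (simp cong: measurable_cong_sets)
    \<comment> \<open>Both measures give \<open>A\<close> the average probability that a particle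
      lies in the preimage of \<open>A\<close> under \<open>D\<close>.\<close>
    have m'eq: "m' = distr m borel D"
    proof (rule torus_probs_eqI[OF m'(1) distr_torus_probs[OF torus_probsD(1)[OF m] mD]])
      fix A :: "'n torus set" assume A: "A \<in> sets borel"
      have DA: "D -` A \<in> sets borel" using measurable_sets[OF D(2) A] by simp
      have "measure m' A = (\<integral>\<omega>. measure (empirical N (?\<xi> \<omega>)) A \<partial>M)"
        using m'(2) A sum\<xi>[of "\<lambda>f. measure (empirical N f) A"] by simp
      also have "\<dots> = (\<integral>\<omega>. (\<Sum>i<N. indicat_real {\<omega> \<in> space M. X i \<omega> \<in> D -` A} \<omega>) / real N \<partial>M)"
        unfolding empirical_truncate measure_empirical[OF A]
        by (rule Bochner_Integration.integral_cong) (auto simp: indicator_def intro!: sum.cong)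
      also have "\<dots> = (\<Sum>i<N. prob {\<omega> \<in> space M. X i \<omega> \<in> D -` A}) / real N"
      proof -
        have "{\<omega> \<in> space M. X i \<omega> \<in> D -` A} \<in> events" if "i < N" for i
          using measurable_sets[OF X[OF that] DA] by (simp add: vimage_def Int_def conj_commute)
        then have "(\<integral>\<omega>. (\<Sum>i<N. indicat_real {\<omega> \<in> space M. X i \<omega> \<in> D -` A} \<omega>) \<partial>M)
            = (\<Sum>i<N. \<integral>\<omega>. indicat_real {\<omega> \<in> space M. X i \<omega> \<in> D -` A} \<omega> \<partial>M)"
          by (intro Bochner_Integration.integral_sum integrable_real_indicator) (auto simp: emeasure_eq_measure)
        moreover have "{\<omega> \<in> space M. X i \<omega> \<in> D -` A} \<inter> space M = {\<omega> \<in> space M. X i \<omega> \<in> D -` A}" for i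
          by blast
        ultimately show ?thesis by simp
      qed
      also have "\<dots> = measure m (D -` A)" by (rule law[OF DA, symmetric])
      also have "\<dots> = measure (distr m borel D) A"
        using A mD torus_probsD(3)[OF m] by (simp add: measure_distr)
      finally show "measure m' A = measure (distr m borel D) A" .
    qed
    have "d1 m m' \<le> \<delta>"
    proof -
      have idm: "(\<lambda>x. x) \<in> borel_measurable m" using torus_probsD(2)[OF m] by (simp cong: measurable_cong_sets)
      have "d1 (distr m borel (\<lambda>x. x)) (distr m borel D) \<le> (\<integral>x. \<delta> \<partial>m)"
        by (rule d1_distr_le[OF torus_probsD(1)[OF m] idm mD])
          (use D(3) prob_space.finite_measure[OF torus_probsD(1)[OF m]] in
            \<open>auto simp: dist_commute less_imp_le intro!: finite_measure.integrable_const\<close>)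
      moreover have "distr m borel (\<lambda>x. x) = m"
        using distr_id2[of borel m] torus_probsD(2)[OF m] by (simp add: id_def)
      ultimately show ?thesis
        using prob_space.prob_space[OF torus_probsD(1)[OF m]] by (simp add: m'eq)
    qed
    then have "F m \<le> F m' + K * \<delta>"
      using K(2)[OF m m'(1)] mult_left_mono[of "d1 m m'" \<delta> K] K(1) by linarith
    also have "F m' \<le> (\<integral>\<omega>. F (empirical N (\<lambda>i. ?X i \<omega>)) \<partial>M)"
      using m'(3) sum\<xi>[of "\<lambda>f. F (empirical N f)"] by (simp add: empirical_truncate)
    also have "\<dots> \<le> (\<integral>\<omega>. F (empirical N (\<lambda>i. X i \<omega>)) + K * \<delta> \<partial>M)"
    proof (rule integral_mono[OF int[OF X']])
      show "integrable M (\<lambda>\<omega>. F (empirical N (\<lambda>i. X i \<omega>)) + K * \<delta>)" using i by simp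
      fix \<omega>
      have "d1 (empirical N (\<lambda>i. ?X i \<omega>)) (empirical N (\<lambda>i. X i \<omega>)) \<le> \<delta>"
        using D(3) by (intro d1_empirical_le[OF N]) (auto simp: less_imp_le)
      then have "K * d1 (empirical N (\<lambda>i. ?X i \<omega>)) (empirical N (\<lambda>i. X i \<omega>)) \<le> K * \<delta>"
        using K(1) by (rule mult_left_mono)
      then show "F (empirical N (\<lambda>i. ?X i \<omega>)) \<le> F (empirical N (\<lambda>i. X i \<omega>)) + K * \<delta>"
        using K(2)[OF empirical_torus_probs[OF N] empirical_torus_probs[OF N], of "\<lambda>i. ?X i \<omega>" "\<lambda>i. X i \<omega>"] by linarith
    qed auto
    also have "\<dots> = (\<integral>\<omega>. F (empirical N (\<lambda>i. X i \<omega>)) \<partial>M) + K * \<delta>" using i by (simp add: prob_space)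
    finally show "F m \<le> (\<integral>\<omega>. F (empirical N (\<lambda>i. X i \<omega>)) \<partial>M) + e" using \<delta>(2) by linarith
  qed
qed

section \<open>Lifting the particles to Euclidean space\<close>

text \<open>Rounding the time down to a multiple of \<open>1 / (k + 1)\<close> leaves countably many
  measurable maps glued together; continuity of the paths gives convergence.\<close>

lemma continuous_process_measurable:
  fixes X :: "real \<Rightarrow> 'w \<Rightarrow> 'b::metric_space"
  assumes meas: "\<And>t. X t \<in> borel_measurable M"
    and cont: "\<And>\<omega>. \<omega> \<in> space M \<Longrightarrow> continuous_on UNIV (\<lambda>t. X t \<omega>)"
  shows "(\<lambda>(t, \<omega>). X t \<omega>) \<in> borel_measurable (borel \<Otimes>\<^sub>M M)"
proof (rule borel_measurable_LIMSEQ_metric)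
  fix k :: nat
  let ?g = "\<lambda>x :: real \<times> 'w. \<lfloor>fst x * real (Suc k)\<rfloor>"
  have fm: "(\<lambda>x. X (of_int i / real (Suc k)) (snd x)) \<in> borel_measurable (borel \<Otimes>\<^sub>M M)" for i :: int
    by (rule measurable_compose[OF measurable_snd meas])
  have gm: "?g \<in> borel \<Otimes>\<^sub>M M \<rightarrow>\<^sub>M count_space UNIV" by measurable
  from measurable_compose_countable[where f="\<lambda>i x. X (of_int i / real (Suc k)) (snd x)", OF fm gm]
  show "(\<lambda>x. X (of_int \<lfloor>fst x * real (Suc k)\<rfloor> / real (Suc k)) (snd x)) \<in> borel_measurable (borel \<Otimes>\<^sub>M M)"
    by simp
next
  fix x assume x: "x \<in> space (borel \<Otimes>\<^sub>M M :: (real \<times> 'w) measure)"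
  obtain t \<omega> where tx: "x = (t, \<omega>)" by (cases x)
  then have \<omega>: "\<omega> \<in> space M" using x by (simp add: space_pair_measure)
  have lim: "(\<lambda>k. of_int \<lfloor>t * real (Suc k)\<rfloor> / real (Suc k)) \<longlonglongrightarrow> t"
  proof (rule LIM_zero_cancel, rule Lim_null_comparison)
    show "\<forall>\<^sub>F k in sequentially. norm (of_int \<lfloor>t * real (Suc k)\<rfloor> / real (Suc k) - t) \<le> inverse (real (Suc k))"
    proof (rule always_eventually, rule allI)
      fix k
      have "\<bar>of_int \<lfloor>t * real (Suc k)\<rfloor> - t * real (Suc k)\<bar> \<le> 1" by linarith
      then have "\<bar>of_int \<lfloor>t * real (Suc k)\<rfloor> - t * real (Suc k)\<bar> / real (Suc k) \<le> 1 / real (Suc k)"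
        by (intro divide_right_mono) auto
      moreover have "\<bar>of_int \<lfloor>t * real (Suc k)\<rfloor> - t * real (Suc k)\<bar> / real (Suc k)
          = \<bar>of_int \<lfloor>t * real (Suc k)\<rfloor> / real (Suc k) - t\<bar>"
      proof -
        have e: "\<bar>y - t * p\<bar> / p = \<bar>y / p - t\<bar>" if "p > 0" for y p :: real
        proof -
          have "\<bar>y - t * p\<bar> / p = \<bar>(y - t * p) / p\<bar>" using that by (simp add: abs_divide)
          also have "(y - t * p) / p = y / p - t" using that by (simp add: diff_divide_distrib)
          finally show ?thesis .
        qed
        show ?thesis by (rule e) simp
      qed
      ultimately show "norm (of_int \<lfloor>t * real (Suc k)\<rfloor> / real (Suc k) - t) \<le> inverse (real (Suc k))"
        by (simp add: inverse_eq_divide)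
    qed
  qed (rule LIMSEQ_inverse_real_of_nat)
  have "isCont (\<lambda>t. X t \<omega>) t"
    using cont[OF \<omega>] by (simp add: continuous_on_eq_continuous_at)
  from isCont_tendsto_compose[OF this lim]
  show "(\<lambda>k. X (of_int \<lfloor>fst x * real (Suc k)\<rfloor> / real (Suc k)) (snd x)) \<longlonglongrightarrow> (case x of (t, \<omega>) \<Rightarrow> X t \<omega>)"
    by (simp add: tx)
qed

text \<open>Progressive measurability is stated on the restricted interval; extension by zero moves
  it to the product with \<open>lborel\<close>, where the integration theorems apply.\<close>

lemma measurable_extend_by_zero:
  fixes f :: "real \<Rightarrow> 'w \<Rightarrow> 'b::real_normed_vector"
  assumes f: "(\<lambda>(r, \<omega>). f r \<omega>) \<in> borel_measurable (restrict_space borel {s..t} \<Otimes>\<^sub>M N)"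
  shows "(\<lambda>(r, \<omega>). indicat_real {s..t} r *\<^sub>R f r \<omega>) \<in> borel_measurable (lborel \<Otimes>\<^sub>M N)"
proof -
  let ?S = "{x \<in> space (lborel \<Otimes>\<^sub>M N). fst x \<in> {s..t}}"
  have id: "(\<lambda>x. x) \<in> restrict_space (lborel \<Otimes>\<^sub>M N) {x. fst x \<in> {s..t}} \<rightarrow>\<^sub>M restrict_space borel {s..t} \<Otimes>\<^sub>M N"
  proof (rule measurable_pair)
    show "fst \<circ> (\<lambda>x. x) \<in> restrict_space (lborel \<Otimes>\<^sub>M N) {x. fst x \<in> {s..t}} \<rightarrow>\<^sub>M restrict_space borel {s..t}"
      unfolding comp_def
      by (intro measurable_restrict_space2 measurable_restrict_space1)
        (auto simp: space_restrict_space)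
    show "snd \<circ> (\<lambda>x. x) \<in> restrict_space (lborel \<Otimes>\<^sub>M N) {x. fst x \<in> {s..t}} \<rightarrow>\<^sub>M N"
      unfolding comp_def by (intro measurable_restrict_space1) auto
  qed
  have "(\<lambda>x. if fst x \<in> {s..t} then (\<lambda>(r, \<omega>). f r \<omega>) x else 0) \<in> borel_measurable (lborel \<Otimes>\<^sub>M N)"
  proof (subst measurable_If_restrict_space_iff)
    show "{x \<in> space (lborel \<Otimes>\<^sub>M N). fst x \<in> {s..t}} \<in> sets (lborel \<Otimes>\<^sub>M N)"
      using measurable_sets[OF measurable_fst, of "{s..t}" lborel N] by (simp add: vimage_def Int_def conj_commute)
    show "(\<lambda>(r, \<omega>). f r \<omega>) \<in> borel_measurable (restrict_space (lborel \<Otimes>\<^sub>M N) {x. fst x \<in> {s..t}}) \<and>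
      (\<lambda>x. 0) \<in> borel_measurable (restrict_space (lborel \<Otimes>\<^sub>M N) {x. fst x \<notin> {s..t}})"
      using measurable_compose[OF id f] by simp
  qed
  also have "(\<lambda>x. if fst x \<in> {s..t} then (\<lambda>(r, \<omega>). f r \<omega>) x else 0) = (\<lambda>(r, \<omega>). indicat_real {s..t} r *\<^sub>R f r \<omega>)"
    by (auto simp: fun_eq_iff indicator_def)
  finally show ?thesis .
qed

lemma measurable_time_integral:
  fixes f :: "real \<Rightarrow> 'w \<Rightarrow> real ^ 'n"
  assumes f: "(\<lambda>(r, \<omega>). f r \<omega>) \<in> borel_measurable (lborel \<Otimes>\<^sub>M N)"
  shows "(\<lambda>\<omega>. \<integral>r. f r \<omega> \<partial>lborel) \<in> borel_measurable N"
proof -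
  have "(\<lambda>(\<omega>, r). f r \<omega>) \<in> borel_measurable (N \<Otimes>\<^sub>M lborel)"
    using measurable_compose[OF measurable_pair_swap' f] by (simp add: case_prod_unfold)
  then show ?thesis by (rule lborel.borel_measurable_lebesgue_integral)
qed

lemma subalgebra_measurable_id: "subalgebra M F \<Longrightarrow> (\<lambda>x. x) \<in> M \<rightarrow>\<^sub>M F"
  by (rule measurable_from_subalg) auto

context noise_basis
begin

lemma subalg_mono:
  assumes "0 \<le> s" "s \<le> t" "t \<le> T"
  shows "subalgebra (Filt t) (Filt s)"
  using subalg[of s] subalg[of t] filt_mono[OF assms] assms by (simp add: subalgebra_def)

lemma null_in_filt:
  assumes "Z \<in> null_sets M" "0 \<le> t" "t \<le> T"
  shows "Z \<in> sets (Filt t)"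
  using filt_complete[OF assms(1) subset_refl] filt_mono[of 0 t] assms by auto

text \<open>Dropping the quotient in \<open>state\<close> gives a Euclidean process started at a
  representative of \<open>x i\<close>. The moments of Gaussian increments and their independence of
  the past give the axioms of \<open>drift_diffusion\<close>; \<open>3 * (CARD('n))\<^sup>2\<close>
  is the fourth moment constant and also dominates the second moment constant
  \<open>CARD('n)\<close>.\<close>

lemma particle_lift:
  fixes \<alpha> :: "nat \<Rightarrow> real \<Rightarrow> 'w \<Rightarrow> real ^ 'n" and x :: "nat \<Rightarrow> 'n torus"
  assumes adm: "admissible_control M Filt T N t0 \<alpha>" and t0: "0 \<le> t0" "t0 \<le> T" and i: "i < N"
  defines "a \<equiv> \<lambda>r \<omega>. indicat_real {t0..T} r *\<^sub>R \<alpha> i r \<omega>"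
  obtains Y where
    "drift_diffusion M t0 T (3 * (real CARD('n))\<^sup>2) a Y (\<lambda>s t \<omega>. W i t \<omega> - W i s \<omega>)"
    "AE \<omega> in M. \<forall>t\<in>{t0..T}. to_torus (Y t \<omega>) = state W t0 x \<alpha> i t \<omega>"
    "\<And>\<omega>. to_torus (Y t0 \<omega>) = x i"
proof -
  interpret pair: pair_sigma_finite lborel M ..
  \<comment> \<open>Clamping the time to \<open>[t0, T]\<close> makes the lift a process on the
    whole real line without leaving the range of the filtration.\<close>
  define \<kappa> where "\<kappa> t = max t0 (min t T)" for t
  have \<kappa>: "t0 \<le> \<kappa> t" "\<kappa> t \<le> T" "0 \<le> \<kappa> t" for t using t0 by (auto simp: \<kappa>_def)
  have \<kappa>id: "\<kappa> t = t" if "t \<in> {t0..T}" for t using that by (simp add: \<kappa>_def)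
  have prog: "(\<lambda>(r, \<omega>). indicat_real {t0..t} r *\<^sub>R \<alpha> i r \<omega>) \<in> borel_measurable (lborel \<Otimes>\<^sub>M Filt t)"
    if "t \<in> {t0..T}" for t
    by (rule measurable_extend_by_zero) (use adm i that in \<open>simp add: admissible_control_def\<close>)
  have idM: "(\<lambda>x. x) \<in> lborel \<Otimes>\<^sub>M M \<rightarrow>\<^sub>M lborel \<Otimes>\<^sub>M Filt T"
    using subalgebra_measurable_id[OF subalg[of T]] t0
    by (intro measurable_pair) (auto simp: comp_def intro: measurable_compose[OF measurable_snd])
  have am: "(\<lambda>(r, \<omega>). a r \<omega>) \<in> borel_measurable (lborel \<Otimes>\<^sub>M M)"
    unfolding a_def using measurable_compose[OF idM prog[of T]] t0 by simp
  have aint: "integrable (lborel \<Otimes>\<^sub>M M) (\<lambda>(r, \<omega>). (norm (a r \<omega>))\<^sup>2)"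
  proof (rule integrableI_bounded)
    show m: "(\<lambda>(r, \<omega>). (norm (a r \<omega>))\<^sup>2) \<in> borel_measurable (lborel \<Otimes>\<^sub>M M)"
      using am by (simp add: case_prod_unfold)
    have "(\<integral>\<^sup>+ x. ennreal (norm (case x of (r, \<omega>) \<Rightarrow> (norm (a r \<omega>))\<^sup>2)) \<partial>(lborel \<Otimes>\<^sub>M M))
      = (\<integral>\<^sup>+\<omega>. (\<integral>\<^sup>+r. ennreal ((norm (a r \<omega>))\<^sup>2) \<partial>lborel) \<partial>M)"
      using m by (subst pair.nn_integral_snd[symmetric]) (auto simp: case_prod_unfold)
    also have "\<dots> = (\<integral>\<^sup>+\<omega>. (\<integral>\<^sup>+t\<in>{t0..T}. ennreal ((norm (\<alpha> i t \<omega>))\<^sup>2) \<partial>lborel) \<partial>M)"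
      by (intro nn_integral_cong) (auto simp: a_def indicator_def)
    also have "\<dots> < \<infinity>" using adm i by (simp add: admissible_control_def)
    finally show "(\<integral>\<^sup>+ x. ennreal (norm (case x of (r, \<omega>) \<Rightarrow> (norm (a r \<omega>))\<^sup>2)) \<partial>(lborel \<Otimes>\<^sub>M M)) < \<infinity>" .
  qed
  have bm: "brownian_motion Filt T (W i)" by (rule brownian_W)
  have Wm: "W i t \<in> borel_measurable (Filt t)" if "t \<in> {0..T}" for t
    using bm that by (simp add: brownian_motion_def)
  have Wm': "W i s \<in> borel_measurable (Filt t)" if "0 \<le> s" "s \<le> t" "t \<le> T" for s t
    using measurable_from_subalg[OF subalg_mono[OF that] Wm] that by simp
  have WM: "W i t \<in> borel_measurable M" if "t \<in> {0..T}" for t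
    using measurable_from_subalg[OF subalg[OF that] Wm[OF that]] .
  \<comment> \<open>Off one null set \<open>Z\<close> the Brownian path is continuous and the
    control has finite energy, so the lift can be formed at all times simultaneously.\<close>
  let ?good = "\<lambda>\<omega>. continuous_on {0..T} (\<lambda>t. W i t \<omega>) \<and> integrable lborel (\<lambda>r. (norm (a r \<omega>))\<^sup>2)"
  have "AE \<omega> in M. ?good \<omega>"
    using bm pair.AE_integrable_snd[OF aint] by (auto simp: brownian_motion_def)
  then obtain Z where Z: "Z \<in> null_sets M" "\<And>\<omega>. \<omega> \<in> space M \<Longrightarrow> \<omega> \<notin> Z \<Longrightarrow> ?good \<omega>"
    unfolding eventually_ae_filter by blast
  have ai: "set_integrable lborel {s..t} (\<lambda>r. a r \<omega>)" if "\<omega> \<in> space M" "\<omega> \<notin> Z" for \<omega> s t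
  proof (rule set_integrable_of_square)
    show "(\<lambda>r. a r \<omega>) \<in> borel_measurable lborel"
      using measurable_compose[OF measurable_Pair2'[OF that(1)] am] by simp
    show "set_integrable lborel {s..t} (\<lambda>r. (norm (a r \<omega>))\<^sup>2)"
      unfolding set_integrable_def using Z(2)[OF that] by (intro integrable_mult_indicator) auto
  qed
  define Y where "Y t \<omega> = (if \<omega> \<in> Z then torus_rep (x i) else
     torus_rep (x i) + (\<integral>r\<in>{t0..\<kappa> t}. a r \<omega> \<partial>lborel) + sqrt 2 *\<^sub>R (W i (\<kappa> t) \<omega> - W i t0 \<omega>))" for t \<omega>
  have YF: "Y t \<in> borel_measurable (Filt (\<kappa> t))" for t
  proof -
    let ?F = "Filt (\<kappa> t)"
    have "(\<lambda>\<omega>. \<integral>r. indicat_real {t0..\<kappa> t} r *\<^sub>R \<alpha> i r \<omega> \<partial>lborel) \<in> borel_measurable ?F"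
      using prog[of "\<kappa> t"] \<kappa> by (intro measurable_time_integral) auto
    also have "(\<lambda>\<omega>. \<integral>r. indicat_real {t0..\<kappa> t} r *\<^sub>R \<alpha> i r \<omega> \<partial>lborel) = (\<lambda>\<omega>. \<integral>r\<in>{t0..\<kappa> t}. a r \<omega> \<partial>lborel)"
      unfolding set_lebesgue_integral_def a_def using \<kappa>(2)[of t]
      by (intro ext Bochner_Integration.integral_cong) (auto simp: indicator_def)
    finally have [measurable]: "(\<lambda>\<omega>. \<integral>r\<in>{t0..\<kappa> t}. a r \<omega> \<partial>lborel) \<in> borel_measurable ?F" .
    have [measurable]: "W i (\<kappa> t) \<in> borel_measurable ?F" "W i t0 \<in> borel_measurable ?F"
      using \<kappa> t0 by (auto intro!: Wm')
    \<comment> \<open>Completeness of the filtration keeps the lift adapted after its modification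
      on the null set.\<close>
    have "Z \<inter> space ?F \<in> sets ?F" using null_in_filt[OF Z(1), of "\<kappa> t"] \<kappa> by simp
    then show ?thesis unfolding Y_def by (intro measurable_If_set) auto
  qed
  have YM: "Y t \<in> borel_measurable M" for t
    using measurable_from_subalg[OF subalg YF] \<kappa> by simp
  have Ym: "(\<lambda>(t, \<omega>). Y t \<omega>) \<in> borel_measurable (lborel \<Otimes>\<^sub>M M)"
  proof -
    let ?W = "\<lambda>t \<omega>. if \<omega> \<in> Z then 0 else W i (\<kappa> t) \<omega> - W i t0 \<omega>"
    have W1: "(\<lambda>(t, \<omega>). ?W t \<omega>) \<in> borel_measurable (borel \<Otimes>\<^sub>M M)"
    proof (rule continuous_process_measurable)
      fix t
      have [measurable]: "W i (\<kappa> t) \<in> borel_measurable M" "W i t0 \<in> borel_measurable M"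
        using \<kappa> t0 by (auto intro!: WM)
      show "?W t \<in> borel_measurable M" using Z(1) by (intro measurable_If_set) auto
    next
      fix \<omega> assume \<omega>: "\<omega> \<in> space M"
      show "continuous_on UNIV (\<lambda>t. ?W t \<omega>)"
      proof (cases "\<omega> \<in> Z")
        case False
        have "continuous_on UNIV (\<lambda>t. W i (\<kappa> t) \<omega>)"
        proof (rule continuous_on_compose2[of "{0..T}" "\<lambda>t. W i t \<omega>"])
          show "continuous_on {0..T} (\<lambda>t. W i t \<omega>)" using Z(2)[OF \<omega> False] by blast
          show "continuous_on UNIV \<kappa>" unfolding \<kappa>_def[abs_def] by (intro continuous_intros)
        qed (use \<kappa> in auto)
        then show ?thesis using False by (auto intro!: continuous_intros)
      qed simp
    qed
    have A1: "(\<lambda>(t, \<omega>). \<integral>r\<in>{t0..\<kappa> t}. a r \<omega> \<partial>lborel) \<in> borel_measurable (lborel \<Otimes>\<^sub>M M)"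
    proof -
      have [measurable]: "\<kappa> \<in> borel_measurable borel" unfolding \<kappa>_def[abs_def] by measurable
      have a2: "(\<lambda>y. a (fst y) (snd (snd y))) \<in> borel_measurable (lborel \<Otimes>\<^sub>M (lborel \<Otimes>\<^sub>M M))"
      proof -
        have "(\<lambda>y. (fst y, snd (snd y))) \<in> lborel \<Otimes>\<^sub>M (lborel \<Otimes>\<^sub>M M) \<rightarrow>\<^sub>M lborel \<Otimes>\<^sub>M M" by measurable
        from measurable_compose[OF this am] show ?thesis by simp
      qed
      have "(\<lambda>y. indicat_real {t0..\<kappa> (fst (snd y))} (fst y)) \<in> borel_measurable (lborel \<Otimes>\<^sub>M (lborel \<Otimes>\<^sub>M M))"
      proof -
        have e: "(\<lambda>y :: real \<times> real \<times> 'w. indicat_real {t0..\<kappa> (fst (snd y))} (fst y))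
          = (\<lambda>y. if t0 \<le> fst y \<and> fst y \<le> \<kappa> (fst (snd y)) then 1 else 0)"
          by (auto simp: indicator_def fun_eq_iff)
        show ?thesis unfolding e by measurable
      qed
      then have "(\<lambda>(r, z). indicat_real {t0..\<kappa> (fst z)} r *\<^sub>R a r (snd z)) \<in> borel_measurable (lborel \<Otimes>\<^sub>M (lborel \<Otimes>\<^sub>M M))"
        using a2 unfolding case_prod_unfold by (intro borel_measurable_scaleR)
      from measurable_time_integral[OF this] show ?thesis
        by (simp add: set_lebesgue_integral_def case_prod_unfold)
    qed
    have Zs: "{y \<in> space (lborel \<Otimes>\<^sub>M M). snd y \<in> Z} \<in> sets (lborel \<Otimes>\<^sub>M M)"
      using measurable_sets[OF measurable_snd, of Z M lborel] Z(1) by (auto simp: vimage_def Int_def conj_commute)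
    have e: "(\<lambda>(t, \<omega>). Y t \<omega>) = (\<lambda>y. if snd y \<in> Z then torus_rep (x i) else
        torus_rep (x i) + (\<lambda>(t, \<omega>). \<integral>r\<in>{t0..\<kappa> t}. a r \<omega> \<partial>lborel) y + sqrt 2 *\<^sub>R (\<lambda>(t, \<omega>). ?W t \<omega>) y)"
      by (auto simp: Y_def fun_eq_iff)
    have W2: "(\<lambda>(t, \<omega>). ?W t \<omega>) \<in> borel_measurable (lborel \<Otimes>\<^sub>M M)"
      using W1 by (subst measurable_cong_sets[OF sets_pair_measure_cong[OF sets_lborel refl] refl])
    show ?thesis unfolding e
      using Zs by (intro measurable_If borel_measurable_add borel_measurable_scaleR A1 W2) auto
  qed
  have c: "real CARD('n) \<le> 3 * (real CARD('n))\<^sup>2"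
  proof -
    have "1 \<le> real CARD('n)" using zero_less_card_finite[where 'a='n] by linarith
    then have "real CARD('n) * 1 \<le> real CARD('n) * real CARD('n)" by (intro mult_left_mono) auto
    moreover have "0 \<le> real CARD('n) * real CARD('n)" by simp
    ultimately show ?thesis unfolding power2_eq_square by linarith
  qed
  let ?B = "\<lambda>s t \<omega>. W i t \<omega> - W i s \<omega>"
  have dist: "distributed M lborel (?B s t) (\<lambda>z. ennreal (\<Prod>k\<in>UNIV. normal_density 0 (sqrt (t - s)) (z $ k)))"
    and ind: "indep_set (sets (Filt s)) {?B s t -` A \<inter> space M | A. A \<in> sets borel}"
    if "t0 \<le> s" "s < t" "t \<le> T" for s t
    using bm that t0 unfolding brownian_motion_def by auto
  have "drift_diffusion M t0 T (3 * (real CARD('n))\<^sup>2) a Y ?B"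
  proof
    show "t0 \<le> T" "0 \<le> 3 * (real CARD('n))\<^sup>2" using t0 by auto
    show "(\<lambda>(t, \<omega>). a t \<omega>) \<in> borel_measurable (lborel \<Otimes>\<^sub>M M)" by (rule am)
    show "integrable (lborel \<Otimes>\<^sub>M M) (\<lambda>(t, \<omega>). (norm (a t \<omega>))\<^sup>2)" by (rule aint)
    show "(\<lambda>(t, \<omega>). Y t \<omega>) \<in> borel_measurable (lborel \<Otimes>\<^sub>M M)" by (rule Ym)
    fix s t assume st: "t0 \<le> s" "s < t" "t \<le> T"
    then have st': "t0 \<le> t" "s \<le> T" "0 \<le> s" "0 \<le> t" using t0 by auto
    have h: "t - s > 0" using st by simp
    note gm = gaussian_moments[OF h dist[OF st]] and gn = gaussian_norm_moments[OF h dist[OF st]]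
    show Bm: "?B s t \<in> borel_measurable M" using st st' by (intro borel_measurable_diff WM) auto
    show "AE \<omega> in M. Y t \<omega> = Y s \<omega> + (\<integral>r\<in>{s..t}. a r \<omega> \<partial>lborel) + sqrt 2 *\<^sub>R ?B s t \<omega>"
      using AE_not_in[OF Z(1)] AE_space
    proof eventually_elim
      case (elim \<omega>)
      have "(\<integral>r\<in>{t0..t}. a r \<omega> \<partial>lborel) = (\<integral>r\<in>{t0..s}. a r \<omega> \<partial>lborel) + (\<integral>r\<in>{s..t}. a r \<omega> \<partial>lborel)"
        using st by (intro set_integral_split_Icc ai elim) auto
      then show ?case using elim \<kappa>id[of s] \<kappa>id[of t] st st' by (simp add: Y_def algebra_simps)
    qed
    show "integrable M (\<lambda>\<omega>. (norm (?B s t \<omega>))\<^sup>2) \<and> (\<integral>\<omega>. (norm (?B s t \<omega>))\<^sup>2 \<partial>M) \<le> 3 * (real CARD('n))\<^sup>2 * (t - s)"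
      using gn mult_right_mono[OF c, of "t - s"] h by simp
    show "integrable M (\<lambda>\<omega>. (norm (?B s t \<omega>))^4) \<and> (\<integral>\<omega>. (norm (?B s t \<omega>))^4 \<partial>M) \<le> 3 * (real CARD('n))\<^sup>2 * (t - s)\<^sup>2"
      using gn by simp
    fix \<eta> :: "real ^ 'n \<Rightarrow> real" and C and k l :: 'n
    assume \<eta>: "\<eta> \<in> borel_measurable borel" "\<And>y. \<bar>\<eta> y\<bar> \<le> C"
    have \<xi>: "(\<lambda>\<omega>. \<eta> (Y s \<omega>)) \<in> borel_measurable (Filt s)"
      using measurable_compose[OF YF[of s] \<eta>(1)] \<kappa>id[of s] st st' by simp
    have sub: "subalgebra M (Filt s)" using st st' by (intro subalg) auto
    note ip = indep_set_product_integral[OF ind[OF st] sub \<xi> \<eta>(2) Bm]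
    have q1: "(\<lambda>z :: real ^ 'n. z $ k) \<in> borel_measurable borel" by measurable
    show "has_bochner_integral M (\<lambda>\<omega>. \<eta> (Y s \<omega>) * ?B s t \<omega> $ k) 0"
      using ip[OF q1 gm(1)] gm(2) by (simp add: has_bochner_integral_iff)
    have q2: "(\<lambda>z :: real ^ 'n. z $ k * z $ l) \<in> borel_measurable borel" by measurable
    show "has_bochner_integral M (\<lambda>\<omega>. \<eta> (Y s \<omega>) * (?B s t \<omega> $ k * ?B s t \<omega> $ l))
        ((if k = l then t - s else 0) * (\<integral>\<omega>. \<eta> (Y s \<omega>) \<partial>M))"
      using ip[OF q2 gm(3)] gm(4) by (simp only: has_bochner_integral_iff mult.commute simp_thms)
  qed
  moreover have "AE \<omega> in M. \<forall>t\<in>{t0..T}. to_torus (Y t \<omega>) = state W t0 x \<alpha> i t \<omega>"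
    using AE_not_in[OF Z(1)] AE_space
  proof eventually_elim
    case (elim \<omega>)
    show ?case
    proof
      fix t assume t: "t \<in> {t0..T}"
      have "(\<integral>r\<in>{t0..t}. a r \<omega> \<partial>lborel) = (\<integral>r\<in>{t0..t}. \<alpha> i r \<omega> \<partial>lborel)"
        unfolding set_lebesgue_integral_def a_def using t
        by (intro Bochner_Integration.integral_cong) (auto simp: indicator_def)
      then show "to_torus (Y t \<omega>) = state W t0 x \<alpha> i t \<omega>"
        using elim(1) \<kappa>id[OF t] unfolding Y_def state_def
        by (simp add: to_torus_add add.assoc)
    qed
  qed
  moreover have "to_torus (Y t0 \<omega>) = x i" for \<omega>
  proof -
    have "(\<integral>r\<in>{t0..t0}. a r \<omega> \<partial>lborel) = 0"
      unfolding set_lebesgue_integral_def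
      by (rule integral_eq_zero_AE) (use AE_lborel_singleton[of t0] in \<open>eventually_elim, auto simp: indicator_def\<close>)
    then show ?thesis using \<kappa>id[of t0] t0 by (simp add: Y_def)
  qed
  ultimately show ?thesis using that by blast
qed

end

section \<open>The mean field pair generated by a particle system\<close>

text \<open>\<open>torus_rep\<close> comes with no regularity, but for periodic \<open>q\<close> the
  map \<open>q (t, torus_rep x)\<close> is the descent of a continuous function and so is continuous
  in each variable, hence jointly measurable.\<close>

lemma torus_slice_measurable:
  fixes q :: "real \<times> (real ^ 'n) \<Rightarrow> real"
  assumes cont: "continuous_on UNIV q" and per: "\<And>t y k. (\<forall>i. k $ i \<in> \<int>) \<Longrightarrow> q (t, y + k) = q (t, y)"
  shows "(\<lambda>(t, x). q (t, torus_rep x)) \<in> borel_measurable (borel \<Otimes>\<^sub>M (borel :: 'n torus measure))"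
    and "q (t, torus_rep (to_torus y)) = q (t, y)"
proof -
  have rep: "q (t, torus_rep (to_torus y)) = q (t, y)" for t y
  proof -
    have "int_equiv (torus_rep (to_torus y)) y" by (simp flip: to_torus_eq_iff)
    then have "q (t, y + (torus_rep (to_torus y) - y)) = q (t, y)"
      by (intro per) (simp add: int_equiv_def)
    then show ?thesis by simp
  qed
  then show "q (t, torus_rep (to_torus y)) = q (t, y)" .
  show "(\<lambda>(t, x). q (t, torus_rep x)) \<in> borel_measurable (borel \<Otimes>\<^sub>M (borel :: 'n torus measure))"
  proof (rule continuous_process_measurable)
    fix t
    have "continuous_on UNIV (\<lambda>y. q (t, y))"
      by (rule continuous_on_compose2[OF cont, of _ "Pair t"]) (auto intro!: continuous_intros)
    then have "continuous_on UNIV (\<lambda>x. q (t, torus_rep x))"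
      by (intro continuous_on_torusI) (simp only: rep)
    then show "(\<lambda>x. q (t, torus_rep x)) \<in> borel_measurable borel"
      by (rule borel_measurable_continuous_onI)
  next
    fix x :: "'n torus"
    show "continuous_on UNIV (\<lambda>t. q (t, torus_rep x))"
      by (rule continuous_on_compose2[OF cont, of _ "\<lambda>t. (t, torus_rep x)"]) (auto intro!: continuous_intros)
  qed
qed

text \<open>The operators of the Fokker-Planck equation are identified with derivatives of the
  periodic lift. The support in time lies strictly inside the interval, so the function vanishes at
  both ends, where the mean formula leaves boundary terms.\<close>

lemma test_function_taylor:
  fixes \<phi> :: "real \<Rightarrow> 'n::finite torus \<Rightarrow> real"
  assumes "test_function a b \<phi>"
  obtains K f0 f1 f2 where "taylor_bounds K (\<lambda>(t, y). \<phi> t (to_torus y)) f0 f1 f2"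
    "\<And>t x. deriv (\<lambda>s. \<phi> s x) t = f0 (t, torus_rep x)"
    "\<And>t x. torus_laplacian (\<phi> t) x = (\<Sum>i\<in>UNIV. f2 i i (t, torus_rep x))"
    "\<And>t x i. torus_gradient (\<phi> t) x $ i = f1 i (t, torus_rep x)"
    "\<And>x. \<phi> a x = 0" "\<And>x. \<phi> b x = 0"
    "\<And>q t y k. q \<in> {f0} \<union> range f1 \<union> (\<Union>i. range (f2 i)) \<Longrightarrow> \<forall>i. k $ i \<in> \<int> \<Longrightarrow> q (t, y + k) = q (t, y)"
proof -
  let ?F = "\<lambda>(t, y). \<phi> t (to_torus y)"
  let ?f0 = "\<lambda>z. frechet_derivative ?F (at z) (1, 0)"
  let ?f1 = "\<lambda>i z. frechet_derivative ?F (at z) (0, axis i 1)"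
  let ?f2 = "\<lambda>i j z. frechet_derivative (?f1 i) (at z) (0, axis j 1)"
  obtain a' b' where ab': "a < a'" "b' < b" "\<And>t x. t \<notin> {a'..b'} \<Longrightarrow> \<phi> t x = 0" and sm: "smooth ?F"
    using assms unfolding test_function_def by blast
  have per: "periodic_cutoff a' b' ?F"
    unfolding periodic_cutoff_def using ab'(3) by (auto simp: to_torus_shift)
  obtain K where K: "taylor_bounds K ?F ?f0 ?f1 ?f2"
    using smooth_taylor_bounds[OF per sm] by blast
  note sD = periodic_cutoff_smooth_derivative[OF per sm]
  note sDD = periodic_cutoff_smooth_derivative[OF sD]
  have slice: "((\<lambda>y. g (t, y)) has_derivative (\<lambda>h. frechet_derivative g (at (t, y)) (0, h))) (at y)"
    if "smooth g" for g :: "real \<times> (real ^ 'n) \<Rightarrow> real" and t y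
  proof -
    have "(Pair t has_derivative (\<lambda>h. (0, h))) (at y)" by (auto intro!: derivative_eq_intros)
    moreover have "(g has_derivative frechet_derivative g (at (t, y))) (at (t, y))"
      using smooth_differentiable[OF that] frechet_derivative_works by blast
    ultimately show ?thesis by (rule has_derivative_compose)
  qed
  have slice': "frechet_derivative (\<lambda>y. g (t, y)) (at y) v = frechet_derivative g (at (t, y)) (0, v)"
    if "smooth g" for g :: "real \<times> (real ^ 'n) \<Rightarrow> real" and t y v
    using frechet_derivative_at[OF slice[OF that]] by metis
  have c1: "deriv (\<lambda>s. \<phi> s x) t = ?f0 (t, torus_rep x)" for t x
  proof (rule DERIV_imp_deriv)
    have "((\<lambda>s. \<phi> (s + t) x) has_real_derivative ?f0 (t, torus_rep x)) (at 0)"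
      using line_derivative[OF smooth_differentiable[OF sm], of "(t, torus_rep x)" "(1, 0)" 0]
      by (simp add: add.commute)
    then show "((\<lambda>s. \<phi> s x) has_real_derivative ?f0 (t, torus_rep x)) (at t)"
      using DERIV_shift[of "\<lambda>s. \<phi> s x" "?f0 (t, torus_rep x)" 0 t] by simp
  qed
  have c2: "torus_gradient (\<phi> t) x $ i = ?f1 i (t, torus_rep x)" for t x i
    using slice'[OF sm, of t "torus_rep x" "axis i 1"] by (simp add: torus_gradient_def gradient_def)
  have c3: "torus_laplacian (\<phi> t) x = (\<Sum>i\<in>UNIV. ?f2 i i (t, torus_rep x))" for t x
  proof -
    have "(\<lambda>y. frechet_derivative (\<lambda>y. \<phi> t (to_torus y)) (at y) v) = (\<lambda>y. frechet_derivative ?F (at (t, y)) (0, v))" for v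
      using slice'[OF sm, of t] by simp
    then show ?thesis
      using slice'[OF sD(2), where t=t and y="torus_rep x"]
      by (simp add: torus_laplacian_def laplacian_def hessian_form_def)
  qed
  have c4: "q (t, y + k) = q (t, y)"
    if "q \<in> {?f0} \<union> range ?f1 \<union> (\<Union>i. range (?f2 i))" "\<forall>i. k $ i \<in> \<int>" for q t y k
  proof -
    have "periodic_cutoff a' b' q" using that(1) sD sDD by auto
    then show ?thesis using that(2) by (simp add: periodic_cutoff_def)
  qed
  show ?thesis
    by (rule that[OF K c1 c3 c2 _ _ c4]) (use ab' in auto)
qed

text \<open>Joint measurability is demanded for every natural number because functions on the
  product with the index space are glued over all of them, although the uniform index charges only
  those below \<open>N\<close>.\<close>

locale particle_system = prob_space M for M :: "'w measure" +
  fixes N :: nat and a b c :: real and \<alpha> Y :: "nat \<Rightarrow> real \<Rightarrow> 'w \<Rightarrow> real ^ 'n"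
    and B :: "nat \<Rightarrow> real \<Rightarrow> real \<Rightarrow> 'w \<Rightarrow> real ^ 'n"
  assumes N: "N \<ge> 1"
    and dd: "\<And>i. i < N \<Longrightarrow> drift_diffusion M a b c (\<alpha> i) (Y i) (B i)"
    and \<alpha>m: "\<And>i. (\<lambda>(t, \<omega>). \<alpha> i t \<omega>) \<in> borel_measurable (lborel \<Otimes>\<^sub>M M)"
    and Ym: "\<And>i. (\<lambda>(t, \<omega>). Y i t \<omega>) \<in> borel_measurable (lborel \<Otimes>\<^sub>M M)"
begin

section \<open>Averages over particles, times and outcomes\<close>

abbreviation index_measure :: "nat measure" where
  "index_measure \<equiv> measure_pmf (pmf_of_set {..<N})"

abbreviation sample :: "(nat \<times> 'w) measure" where
  "sample \<equiv> index_measure \<Otimes>\<^sub>M M"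

abbreviation time :: "real measure" where
  "time \<equiv> restrict_space lborel {a..b}"

abbreviation paths :: "(real \<times> nat \<times> 'w) measure" where
  "paths \<equiv> time \<Otimes>\<^sub>M sample"

abbreviation X :: "nat \<Rightarrow> real \<Rightarrow> 'w \<Rightarrow> 'n torus" where
  "X i t \<omega> \<equiv> to_torus (Y i t \<omega>)"

text \<open>The push-forward under a uniformly chosen index, rather than an integral of measures:
  integrals against it become integrals over \<open>sample\<close>.\<close>

definition law :: "real \<Rightarrow> 'n torus measure" where
  "law t = distr sample borel (\<lambda>(i, \<omega>). X i t \<omega>)"

sublocale lM: pair_sigma_finite lborel M ..

lemma ab: "a \<le> b"
  using dd[of 0] N by (simp add: drift_diffusion_def drift_diffusion_axioms_def)

lemma finite_measure_time: "finite_measure time"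
  by (rule finite_measureI) (simp add: emeasure_restrict_space space_restrict_space emeasure_lborel_Icc_eq)

sublocale U: prob_space index_measure by (rule prob_space_measure_pmf)
sublocale UM: pair_prob_space index_measure M ..
sublocale I: finite_measure time by (rule finite_measure_time)
sublocale Psf: pair_sigma_finite time sample ..

lemma set_pmf_index: "set_pmf (pmf_of_set {..<N}) = {..<N}"
  using N by (intro set_pmf_of_set) (auto simp: lessThan_empty_iff)

lemma Y_measurable: "Y i t \<in> borel_measurable M"
  using measurable_compose[OF measurable_Pair1' Ym[of i], of t] by simp

lemma X_measurable: "X i t \<in> borel_measurable M"
  by (rule measurable_compose[OF Y_measurable measurable_to_torus])

lemma Xm: "(\<lambda>(t, \<omega>). X i t \<omega>) \<in> borel_measurable (lborel \<Otimes>\<^sub>M M)"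
  using measurable_compose[OF Ym[of i] measurable_to_torus] by (simp add: case_prod_unfold)

lemma sample_measurable:
  assumes "\<And>i. h i \<in> M \<rightarrow>\<^sub>M L"
  shows "(\<lambda>(i, \<omega>). h i \<omega>) \<in> sample \<rightarrow>\<^sub>M L"
proof -
  have fm: "(\<lambda>x. h i (snd x)) \<in> sample \<rightarrow>\<^sub>M L" for i
    by (rule measurable_compose[OF measurable_snd assms])
  have gm: "fst \<in> sample \<rightarrow>\<^sub>M count_space UNIV" using measurable_fst[of index_measure M] by simp
  show ?thesis
    using measurable_compose_countable[where f="\<lambda>i x. h i (snd x)", OF fm gm] by (simp add: case_prod_unfold)
qed

lemma paths_measurable:
  assumes "\<And>i. (\<lambda>(t, \<omega>). h i t \<omega>) \<in> lborel \<Otimes>\<^sub>M M \<rightarrow>\<^sub>M L"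
  shows "(\<lambda>(t, i, \<omega>). h i t \<omega>) \<in> paths \<rightarrow>\<^sub>M L"
proof -
  have id: "(\<lambda>x. (fst x, snd (snd x))) \<in> paths \<rightarrow>\<^sub>M lborel \<Otimes>\<^sub>M M"
    by (intro measurable_Pair measurable_compose[OF measurable_snd measurable_snd]
        measurable_compose[OF measurable_fst] measurable_restrict_space1 measurable_ident_sets) simp
  have fm: "(\<lambda>x. h i (fst x) (snd (snd x))) \<in> paths \<rightarrow>\<^sub>M L" for i
    using measurable_compose[OF id assms[of i]] by simp
  have gm: "(\<lambda>x. fst (snd x)) \<in> paths \<rightarrow>\<^sub>M count_space UNIV"
    using measurable_compose[OF measurable_snd measurable_fst, of time index_measure M] by simp
  show ?thesis
    using measurable_compose_countable[where f="\<lambda>i x. h i (fst x) (snd (snd x))", OF fm gm]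
    by (simp add: case_prod_unfold)
qed

lemma sample_average:
  fixes h :: "nat \<Rightarrow> 'w \<Rightarrow> real"
  assumes m: "\<And>i. h i \<in> borel_measurable M" and int: "\<And>i. i < N \<Longrightarrow> integrable M (h i)"
  shows "integrable sample (\<lambda>(i, \<omega>). h i \<omega>)"
    and "(\<integral>z. (case z of (i, \<omega>) \<Rightarrow> h i \<omega>) \<partial>sample) = (\<Sum>i<N. \<integral>\<omega>. h i \<omega> \<partial>M) / real N"
proof -
  show i: "integrable sample (\<lambda>(i, \<omega>). h i \<omega>)"
  proof (rule UM.Fubini_integrable)
    show "(\<lambda>(i, \<omega>). h i \<omega>) \<in> borel_measurable sample" by (rule sample_measurable[OF m])
    show "integrable index_measure (\<lambda>x. \<integral>y. norm (case (x, y) of (i, \<omega>) \<Rightarrow> h i \<omega>) \<partial>M)"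
      by (rule integrable_measure_pmf_finite) (simp add: set_pmf_index)
    show "AE x in index_measure. integrable M (\<lambda>y. case (x, y) of (i, \<omega>) \<Rightarrow> h i \<omega>)"
      using int by (subst AE_measure_pmf_iff) (simp add: set_pmf_index)
  qed
  have "(\<integral>z. (case z of (i, \<omega>) \<Rightarrow> h i \<omega>) \<partial>sample) = (\<integral>i. (\<integral>\<omega>. h i \<omega> \<partial>M) \<partial>index_measure)"
    using UM.integral_fst'[OF i] by simp
  also have "\<dots> = (\<Sum>i<N. \<integral>\<omega>. h i \<omega> \<partial>M) / real N"
    using N by (subst integral_pmf_of_set) (auto simp: lessThan_empty_iff)
  finally show "(\<integral>z. (case z of (i, \<omega>) \<Rightarrow> h i \<omega>) \<partial>sample) = (\<Sum>i<N. \<integral>\<omega>. h i \<omega> \<partial>M) / real N" .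
qed

text \<open>Fubini in the order of integration of the particle cost. Integrability is asked only
  below \<open>N\<close>, where the index measure lives; finiteness is checked on absolute values
  first.\<close>

lemma paths_average:
  fixes h :: "nat \<Rightarrow> real \<Rightarrow> 'w \<Rightarrow> real"
  assumes m: "\<And>i. (\<lambda>(t, \<omega>). h i t \<omega>) \<in> borel_measurable (lborel \<Otimes>\<^sub>M M)"
    and int: "\<And>i. i < N \<Longrightarrow> integrable (lborel \<Otimes>\<^sub>M M) (\<lambda>(t, \<omega>). indicat_real {a..b} t *\<^sub>R h i t \<omega>)"
  shows "integrable paths (\<lambda>(t, i, \<omega>). h i t \<omega>)"
    and "(\<integral>z. (case z of (t, i, \<omega>) \<Rightarrow> h i t \<omega>) \<partial>paths)
      = (\<Sum>i<N. \<integral>\<omega>. (\<integral>t\<in>{a..b}. h i t \<omega> \<partial>lborel) \<partial>M) / real N"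
proof -
  let ?h = "\<lambda>(t, i, \<omega>). h i t \<omega>"
  have hm: "?h \<in> borel_measurable paths" by (rule paths_measurable[OF m])
  have im: "(\<lambda>(t, \<omega>). indicat_real {a..b} t *\<^sub>R h i t \<omega>) \<in> borel_measurable (lborel \<Otimes>\<^sub>M M)" for i
    using m[of i] unfolding case_prod_unfold by (intro borel_measurable_scaleR indicator_fst_measurable)
  show ih: "integrable paths ?h"
  proof (rule integrableI_bounded[OF hm])
    have "(\<integral>\<^sup>+z. ennreal (norm (?h z)) \<partial>paths) = (\<integral>\<^sup>+y. (\<integral>\<^sup>+t. ennreal (norm (?h (t, y))) \<partial>time) \<partial>sample)"
      by (rule Psf.nn_integral_snd[symmetric]) (auto intro!: measurable_compose[OF hm])
    also have "\<dots> = (\<integral>\<^sup>+i. (\<integral>\<^sup>+\<omega>. (\<integral>\<^sup>+t. ennreal (norm (h i t \<omega>)) \<partial>time) \<partial>M) \<partial>index_measure)"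
    proof -
      have "(\<lambda>y. \<integral>\<^sup>+t. ennreal (norm (?h (t, y))) \<partial>time) \<in> borel_measurable sample"
      proof (rule I.borel_measurable_nn_integral)
        show "(\<lambda>(y, t). ennreal (norm (?h (t, y)))) \<in> borel_measurable (sample \<Otimes>\<^sub>M time)"
          using measurable_compose[OF measurable_pair_swap' measurable_compose[OF hm, of "\<lambda>x. ennreal (norm x)" borel]]
          by (simp add: case_prod_unfold)
      qed
      from nn_integral_fst[OF this] show ?thesis by simp
    qed
    also have "\<dots> = (\<Sum>i<N. (\<integral>\<^sup>+\<omega>. (\<integral>\<^sup>+t. ennreal (norm (h i t \<omega>)) \<partial>time) \<partial>M)) / real N"
      using N by (subst nn_integral_pmf_of_set) (auto simp: lessThan_empty_iff ennreal_of_nat_eq_real_of_nat)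
    also have "\<dots> < \<infinity>"
    proof -
      have "(\<integral>\<^sup>+\<omega>. (\<integral>\<^sup>+t. ennreal (norm (h i t \<omega>)) \<partial>time) \<partial>M) < \<infinity>" if "i < N" for i
      proof -
        have "(\<integral>\<^sup>+\<omega>. (\<integral>\<^sup>+t. ennreal (norm (h i t \<omega>)) \<partial>time) \<partial>M)
          = (\<integral>\<^sup>+\<omega>. (\<integral>\<^sup>+t. ennreal (norm (indicat_real {a..b} t *\<^sub>R h i t \<omega>)) \<partial>lborel) \<partial>M)"
          by (intro nn_integral_cong, subst nn_integral_restrict_space)
            (auto intro!: nn_integral_cong simp: indicator_def)
        also have "\<dots> = (\<integral>\<^sup>+z. ennreal (norm (case z of (t, \<omega>) \<Rightarrow> indicat_real {a..b} t *\<^sub>R h i t \<omega>)) \<partial>(lborel \<Otimes>\<^sub>M M))"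
          using measurable_compose[OF im[of i], of "\<lambda>x. ennreal (norm x)" borel]
          by (subst lM.nn_integral_snd[symmetric]) simp_all
        also have "\<dots> < \<infinity>" using int[OF that] by (simp add: integrable_iff_bounded)
        finally show ?thesis .
      qed
      then have "(\<Sum>i<N. (\<integral>\<^sup>+\<omega>. (\<integral>\<^sup>+t. ennreal (norm (h i t \<omega>)) \<partial>time) \<partial>M)) < \<infinity>" by simp
      then show ?thesis using N by (simp add: divide_ennreal_def ennreal_mult_less_top inverse_ennreal)
    qed
    finally show "(\<integral>\<^sup>+z. ennreal (norm (?h z)) \<partial>paths) < \<infinity>" .
  qed
  have ti: "(\<integral>t. f t \<partial>time) = (\<integral>t\<in>{a..b}. f t \<partial>lborel)" for f :: "real \<Rightarrow> real"
    unfolding set_lebesgue_integral_def by (rule integral_restrict_space) simp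
  have "(\<integral>z. ?h z \<partial>paths) = (\<integral>y. (\<integral>t. ?h (t, y) \<partial>time) \<partial>sample)"
    using Psf.integral_snd[of "\<lambda>t y. ?h (t, y)"] ih by simp
  also have "\<dots> = (\<integral>y. (case y of (i, \<omega>) \<Rightarrow> (\<integral>t\<in>{a..b}. h i t \<omega> \<partial>lborel)) \<partial>sample)"
    by (intro Bochner_Integration.integral_cong) (auto simp: ti)
  also have "\<dots> = (\<Sum>i<N. \<integral>\<omega>. (\<integral>t\<in>{a..b}. h i t \<omega> \<partial>lborel) \<partial>M) / real N"
  proof (rule sample_average)
    show "(\<lambda>\<omega>. \<integral>t\<in>{a..b}. h i t \<omega> \<partial>lborel) \<in> borel_measurable M" for i
    proof -
      have "(\<lambda>(\<omega>, t). indicat_real {a..b} t *\<^sub>R h i t \<omega>) \<in> borel_measurable (M \<Otimes>\<^sub>M lborel)"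
        using measurable_compose[OF measurable_pair_swap' im[of i]] by (simp add: case_prod_unfold)
      then show ?thesis unfolding set_lebesgue_integral_def by (rule lborel.borel_measurable_lebesgue_integral)
    qed
    show "integrable M (\<lambda>\<omega>. \<integral>t\<in>{a..b}. h i t \<omega> \<partial>lborel)" if "i < N" for i
      unfolding set_lebesgue_integral_def by (rule lM.integrable_snd[OF int[OF that]])
  qed
  finally show "(\<integral>z. ?h z \<partial>paths) = (\<Sum>i<N. \<integral>\<omega>. (\<integral>t\<in>{a..b}. h i t \<omega> \<partial>lborel) \<partial>M) / real N" .
qed

text \<open>Quadratic growth in the control suffices: the time interval is bounded, \<open>M\<close>
  is a probability and the energy is integrable.\<close>

lemma dominated_integrable:
  fixes h :: "real \<Rightarrow> 'w \<Rightarrow> real"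
  assumes i: "i < N" and m: "(\<lambda>(t, \<omega>). h t \<omega>) \<in> borel_measurable (lborel \<Otimes>\<^sub>M M)"
    and bd: "\<And>t \<omega>. t \<in> {a..b} \<Longrightarrow> \<omega> \<in> space M \<Longrightarrow> \<bar>h t \<omega>\<bar> \<le> C * (1 + (norm (\<alpha> i t \<omega>))\<^sup>2)"
  shows "integrable (lborel \<Otimes>\<^sub>M M) (\<lambda>(t, \<omega>). indicat_real {a..b} t *\<^sub>R h t \<omega>)"
proof -
  interpret d: drift_diffusion M a b c "\<alpha> i" "Y i" "B i" by (rule dd[OF i])
  have "integrable (lborel \<Otimes>\<^sub>M M) (indicat_real ({a..b} \<times> space M))"
    by (rule integrable_real_indicator)
      (auto simp: emeasure_pair_measure_Times emeasure_space_1 emeasure_lborel_Icc_eq)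
  then have "integrable (lborel \<Otimes>\<^sub>M M) (\<lambda>x. C * (indicat_real ({a..b} \<times> space M) x + (case x of (t, \<omega>) \<Rightarrow> (norm (\<alpha> i t \<omega>))\<^sup>2)))"
    by (intro integrable_mult_right Bochner_Integration.integrable_add d.\<alpha>_int)
  then show ?thesis
  proof (rule Bochner_Integration.integrable_bound)
    show "(\<lambda>(t, \<omega>). indicat_real {a..b} t *\<^sub>R h t \<omega>) \<in> borel_measurable (lborel \<Otimes>\<^sub>M M)"
      using m unfolding case_prod_unfold by (intro borel_measurable_scaleR indicator_fst_measurable)
    show "AE x in lborel \<Otimes>\<^sub>M M. norm (case x of (t, \<omega>) \<Rightarrow> indicat_real {a..b} t *\<^sub>R h t \<omega>)
      \<le> norm (C * (indicat_real ({a..b} \<times> space M) x + (case x of (t, \<omega>) \<Rightarrow> (norm (\<alpha> i t \<omega>))\<^sup>2)))"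
    proof (rule AE_I2)
      fix x :: "real \<times> 'w" assume "x \<in> space (lborel \<Otimes>\<^sub>M M)"
      then obtain t \<omega> where x: "x = (t, \<omega>)" "\<omega> \<in> space M" by (auto simp: space_pair_measure)
      then show "norm (case x of (t, \<omega>) \<Rightarrow> indicat_real {a..b} t *\<^sub>R h t \<omega>)
        \<le> norm (C * (indicat_real ({a..b} \<times> space M) x + (case x of (t, \<omega>) \<Rightarrow> (norm (\<alpha> i t \<omega>))\<^sup>2)))"
        using order_trans[OF bd abs_ge_self, of t \<omega>] by (auto simp: indicator_def)
    qed
  qed
qed

section \<open>The mean law and its continuity in time\<close>

lemma X_sample: "(\<lambda>(i, \<omega>). X i t \<omega>) \<in> borel_measurable sample"
  by (rule sample_measurable[OF X_measurable])

lemma law_torus_probs: "law t \<in> torus_probs"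
  unfolding law_def by (rule distr_torus_probs[OF UM.prob_space_axioms X_sample])

lemma measure_law:
  assumes A: "A \<in> sets borel"
  shows "measure (law t) A = (\<Sum>i<N. prob {\<omega> \<in> space M. X i t \<omega> \<in> A}) / real N"
proof -
  have ev: "{\<omega> \<in> space M. X i t \<omega> \<in> A} \<in> events" for i
    using measurable_sets[OF X_measurable A] by (simp add: vimage_def Int_def conj_commute)
  have "measure (law t) A = (\<integral>x. indicat_real A x \<partial>law t)"
    using A sets_eq_imp_space_eq[of "law t" borel] by (simp add: law_def)
  also have "\<dots> = (\<integral>z. indicat_real A (case z of (i, \<omega>) \<Rightarrow> X i t \<omega>) \<partial>sample)"
    unfolding law_def by (rule integral_distr[OF X_sample]) (use A in simp)
  also have "\<dots> = (\<integral>z. (case z of (i, \<omega>) \<Rightarrow> indicat_real {\<omega> \<in> space M. X i t \<omega> \<in> A} \<omega>) \<partial>sample)"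
    by (rule Bochner_Integration.integral_cong) (auto simp: indicator_def space_pair_measure)
  also have "\<dots> = (\<Sum>i<N. \<integral>\<omega>. indicat_real {\<omega> \<in> space M. X i t \<omega> \<in> A} \<omega> \<partial>M) / real N"
    using ev by (intro sample_average) (auto intro!: integrable_real_indicator simp: emeasure_eq_measure)
  also have "\<dots> = (\<Sum>i<N. prob {\<omega> \<in> space M. X i t \<omega> \<in> A}) / real N"
    by (intro arg_cong2[where f="(/)"] sum.cong refl) (simp add: Int_absorb2 Collect_restrict)
  finally show ?thesis .
qed

lemma law_initial:
  assumes "\<And>i \<omega>. i < N \<Longrightarrow> X i a \<omega> = x i"
  shows "law a = empirical N x"
proof (rule torus_probs_eqI[OF law_torus_probs empirical_torus_probs[OF N]])
  fix A :: "'n torus set" assume A: "A \<in> sets borel"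
  have "prob {\<omega> \<in> space M. X i a \<omega> \<in> A} = indicat_real A (x i)" if "i < N" for i
    using assms[OF that] by (cases "x i \<in> A") (auto simp: prob_space)
  then show "measure (law a) A = measure (empirical N x) A"
    unfolding measure_law[OF A] measure_empirical[OF A] by simp
qed

text \<open>The same index and outcome couple the positions at times \<open>s\<close> and
  \<open>t\<close>, and the squared displacement has mean of order \<open>\<bar>s - t\<bar>\<close>;
  this gives Hoelder continuity of exponent one half.\<close>

lemma law_holder:
  obtains C where "C \<ge> 0"
    "\<And>s t. s \<in> {a..b} \<Longrightarrow> t \<in> {a..b} \<Longrightarrow> s \<noteq> t \<Longrightarrow> \<bar>s - t\<bar> \<le> 1 \<Longrightarrow> d1 (law s) (law t) \<le> C * sqrt \<bar>s - t\<bar>"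
proof -
  let ?disp = "\<lambda>i C s t. integrable M (\<lambda>\<omega>. (norm (Y i t \<omega> - Y i s \<omega>))\<^sup>2) \<and> (\<integral>\<omega>. (norm (Y i t \<omega> - Y i s \<omega>))\<^sup>2 \<partial>M) \<le> C * (t - s)"
  have "\<forall>i\<in>{..<N}. \<exists>C. C \<ge> 0 \<and> (\<forall>s t. a \<le> s \<and> s \<le> t \<and> t \<le> b \<and> t - s \<le> 1 \<longrightarrow> ?disp i C s t)"
  proof
    fix i assume "i \<in> {..<N}"
    then interpret d: drift_diffusion M a b c "\<alpha> i" "Y i" "B i" by (intro dd) simp
    show "\<exists>C. C \<ge> 0 \<and> (\<forall>s t. a \<le> s \<and> s \<le> t \<and> t \<le> b \<and> t - s \<le> 1 \<longrightarrow> ?disp i C s t)"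
      using d.displacement d.c_disp_nonneg by (intro exI[of _ d.c_disp]) simp
  qed
  then obtain D where "\<forall>i\<in>{..<N}. D i \<ge> 0 \<and> (\<forall>s t. a \<le> s \<and> s \<le> t \<and> t \<le> b \<and> t - s \<le> 1 \<longrightarrow> ?disp i (D i) s t)"
    by (rule bchoice[THEN exE])
  then have D: "\<And>i. i < N \<Longrightarrow> D i \<ge> 0" "\<And>i s t. i < N \<Longrightarrow> a \<le> s \<Longrightarrow> s \<le> t \<Longrightarrow> t \<le> b \<Longrightarrow> t - s \<le> 1 \<Longrightarrow> ?disp i (D i) s t"
    by auto
  have D': "integrable M (\<lambda>\<omega>. (norm (Y i s \<omega> - Y i t \<omega>))\<^sup>2) \<and> (\<integral>\<omega>. (norm (Y i s \<omega> - Y i t \<omega>))\<^sup>2 \<partial>M) \<le> D i * \<bar>s - t\<bar>"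
    if "i < N" "s \<in> {a..b}" "t \<in> {a..b}" "\<bar>s - t\<bar> \<le> 1" for i s t
  proof (cases "s \<le> t")
    case True
    then show ?thesis using D(2)[of i s t] that by (simp add: norm_minus_commute)
  next
    case False
    then show ?thesis using D(2)[of i t s] that by simp
  qed
  let ?C = "1 + (\<Sum>i<N. D i)"
  show ?thesis
  proof (rule that[of ?C])
    show "0 \<le> ?C" using D(1) by (intro add_nonneg_nonneg sum_nonneg) auto
    fix s t assume st: "s \<in> {a..b}" "t \<in> {a..b}" "s \<noteq> t" "\<bar>s - t\<bar> \<le> 1"
    define e where "e = sqrt \<bar>s - t\<bar>"
    have e: "e > 0" "\<bar>s - t\<bar> = e * e" using st by (auto simp: e_def)
    \<comment> \<open>A majorant of the displacement \<open>n\<close> through its square: either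
      \<open>n\<close> is at most \<open>e\<close>, or it is at most its square over
      \<open>e\<close>. With \<open>e\<close> the square root of the time difference, both terms
      have mean of order \<open>e\<close>.\<close>
    let ?h = "\<lambda>i \<omega>. e + (norm (Y i s \<omega> - Y i t \<omega>))\<^sup>2 / e"
    have hm: "?h i \<in> borel_measurable M" for i
      using Y_measurable[of i s] Y_measurable[of i t] by measurable
    have hi: "integrable M (?h i)" and hb: "(\<integral>\<omega>. ?h i \<omega> \<partial>M) \<le> e + D i * e" if "i < N" for i
    proof -
      show "integrable M (?h i)" using D'[OF that st(1,2,4)] by simp
      have "(\<integral>\<omega>. ?h i \<omega> \<partial>M) = e + (\<integral>\<omega>. (norm (Y i s \<omega> - Y i t \<omega>))\<^sup>2 \<partial>M) / e"
        using D'[OF that st(1,2,4)] by (simp add: prob_space)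
      also have "\<dots> \<le> e + D i * (e * e) / e"
        using D'[OF that st(1,2,4)] e by (intro add_left_mono divide_right_mono) auto
      finally show "(\<integral>\<omega>. ?h i \<omega> \<partial>M) \<le> e + D i * e" using e by simp
    qed
    note avg = sample_average[OF hm hi]
    have "d1 (law s) (law t) \<le> (\<integral>z. (case z of (i, \<omega>) \<Rightarrow> ?h i \<omega>) \<partial>sample)"
      unfolding law_def
    proof (rule d1_distr_le[OF UM.prob_space_axioms X_sample X_sample avg(1)])
      show "AE z in sample. dist (case z of (i, \<omega>) \<Rightarrow> X i s \<omega>) (case z of (i, \<omega>) \<Rightarrow> X i t \<omega>) \<le> (case z of (i, \<omega>) \<Rightarrow> ?h i \<omega>)"
      proof (rule AE_I2)
        fix z :: "nat \<times> 'w"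
        obtain i \<omega> where z: "z = (i, \<omega>)" by (cases z)
        let ?n = "norm (Y i s \<omega> - Y i t \<omega>)"
        have "?n \<le> e + ?n\<^sup>2 / e"
        proof (cases "?n \<le> e")
          case True
          have "0 \<le> ?n\<^sup>2 / e" using e by simp
          then show ?thesis using True by linarith
        next
          case False
          then have "?n * e \<le> ?n * ?n" by (intro mult_left_mono) auto
          then have "?n \<le> ?n\<^sup>2 / e" using e by (simp add: pos_le_divide_eq power2_eq_square)
          then show ?thesis using e by linarith
        qed
        then show "dist (case z of (i, \<omega>) \<Rightarrow> X i s \<omega>) (case z of (i, \<omega>) \<Rightarrow> X i t \<omega>) \<le> (case z of (i, \<omega>) \<Rightarrow> ?h i \<omega>)"
          using dist_to_torus_le[of "Y i s \<omega>" "Y i t \<omega>"] by (simp add: z)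
      qed
    qed
    also have "\<dots> = (\<Sum>i<N. \<integral>\<omega>. ?h i \<omega> \<partial>M) / real N" by (rule avg(2))
    also have "\<dots> \<le> (\<Sum>i<N. ?C * e) / real N"
    proof (intro divide_right_mono sum_mono)
      fix i assume i: "i \<in> {..<N}"
      have "D i \<le> (\<Sum>i<N. D i)" using i D(1) by (intro member_le_sum) auto
      then have "D i * e \<le> (\<Sum>i<N. D i) * e" using e by (intro mult_right_mono) auto
      then show "(\<integral>\<omega>. ?h i \<omega> \<partial>M) \<le> ?C * e" using hb[of i] i by (simp add: distrib_right)
    qed auto
    also have "\<dots> = ?C * e" using N by simp
    finally show "d1 (law s) (law t) \<le> ?C * sqrt \<bar>s - t\<bar>" by (simp add: e_def)
  qed
qed

lemma law_continuous:
  assumes t: "t \<in> {a..b}"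
  shows "((\<lambda>s. d1 (law s) (law t)) \<longlongrightarrow> 0) (at t within {a..b})"
proof -
  obtain C where C: "C \<ge> 0" "\<And>s t. s \<in> {a..b} \<Longrightarrow> t \<in> {a..b} \<Longrightarrow> s \<noteq> t \<Longrightarrow> \<bar>s - t\<bar> \<le> 1 \<Longrightarrow> d1 (law s) (law t) \<le> C * sqrt \<bar>s - t\<bar>"
    using law_holder by blast
  show ?thesis
  proof (rule Lim_null_comparison)
    have "\<forall>\<^sub>F s in at t within {a..b}. dist s t < 1"
      unfolding eventually_at by (rule exI[of _ 1]) simp
    moreover have "\<forall>\<^sub>F s in at t within {a..b}. s \<in> {a..b} \<and> s \<noteq> t" by (auto simp: eventually_at_filter)
    ultimately show "\<forall>\<^sub>F s in at t within {a..b}. norm (d1 (law s) (law t)) \<le> C * sqrt \<bar>s - t\<bar>"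
    proof eventually_elim
      case (elim s)
      have "0 \<le> d1 (law s) (law t)" using d1_nonneg_bounded law_torus_probs by metis
      then show ?case using C(2)[of s t] elim t by (simp add: dist_real_def)
    qed
    have "((\<lambda>s. C * sqrt \<bar>s - t\<bar>) \<longlongrightarrow> C * sqrt \<bar>t - t\<bar>) (at t within {a..b})"
      by (intro tendsto_intros)
    then show "((\<lambda>s. C * sqrt \<bar>s - t\<bar>) \<longlongrightarrow> 0) (at t within {a..b})" by simp
  qed
qed

section \<open>The feedback as a conditional expectation and the Fokker-Planck equation\<close>

abbreviation space_time :: "(real \<times> 'n torus) measure" where
  "space_time \<equiv> restrict_space borel {a..b} \<Otimes>\<^sub>M borel"

definition position :: "real \<times> nat \<times> 'w \<Rightarrow> real \<times> 'n torus" where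
  "position = (\<lambda>(t, i, \<omega>). (t, X i t \<omega>))"

lemma position_measurable: "position \<in> paths \<rightarrow>\<^sub>M space_time"
proof -
  have "fst \<in> paths \<rightarrow>\<^sub>M time" by (rule measurable_fst)
  then have "fst \<in> paths \<rightarrow>\<^sub>M restrict_space borel {a..b}"
    by (subst (asm) measurable_cong_sets[OF refl sets_restrict_space_cong[OF sets_lborel]])
  then have "(\<lambda>z. (fst z, (\<lambda>(t, i, \<omega>). X i t \<omega>) z)) \<in> paths \<rightarrow>\<^sub>M space_time"
    by (intro measurable_Pair paths_measurable Xm)
  then show ?thesis by (simp add: position_def case_prod_unfold)
qed

lemma finite_paths: "finite_measure paths"
proof
  have "emeasure paths (space paths) = emeasure time (space time) * emeasure sample (space sample)"
    unfolding space_pair_measure[of time] by (rule UM.P.emeasure_pair_measure_Times[OF sets.top sets.top])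
  then show "emeasure paths (space paths) \<noteq> \<infinity>"
    using I.emeasure_finite UM.emeasure_space_1 by simp
qed

text \<open>At a fixed time, \<open>position\<close> transports \<open>sample\<close> to
  \<open>law t\<close>; integrating over time identifies space-time integrals with integrals over
  \<open>paths\<close>.\<close>

lemma law_integral:
  fixes g :: "real \<times> 'n torus \<Rightarrow> real"
  assumes g: "g \<in> borel_measurable space_time" and int: "integrable paths (\<lambda>z. g (position z))"
  shows "integrable time (\<lambda>t. \<integral>x. g (t, x) \<partial>law t)"
    and "(\<integral>t\<in>{a..b}. (\<integral>x. g (t, x) \<partial>law t) \<partial>lborel) = (\<integral>z. g (position z) \<partial>paths)"
proof -
  have e: "(\<integral>x. g (t, x) \<partial>law t) = (\<integral>y. g (position (t, y)) \<partial>sample)" if t: "t \<in> {a..b}" for t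
  proof -
    have "(\<lambda>x. (t, x)) \<in> borel \<rightarrow>\<^sub>M space_time" using t by (intro measurable_Pair1') (simp add: space_restrict_space)
    from measurable_compose[OF this g] show ?thesis
      unfolding law_def by (subst integral_distr[OF X_sample]) (auto simp: position_def case_prod_unfold)
  qed
  have st: "space time = {a..b}" by (simp add: space_restrict_space)
  show "integrable time (\<lambda>t. \<integral>x. g (t, x) \<partial>law t)"
    using Psf.integrable_fst'[OF int] by (subst Bochner_Integration.integrable_cong[OF refl e]) (simp_all add: st)
  have "(\<integral>t\<in>{a..b}. (\<integral>x. g (t, x) \<partial>law t) \<partial>lborel) = (\<integral>t. (\<integral>x. g (t, x) \<partial>law t) \<partial>time)"
    unfolding set_lebesgue_integral_def by (rule integral_restrict_space[symmetric]) simp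
  also have "\<dots> = (\<integral>t. (\<integral>y. g (position (t, y)) \<partial>sample) \<partial>time)"
    by (rule Bochner_Integration.integral_cong) (simp_all add: st e)
  also have "\<dots> = (\<integral>z. g (position z) \<partial>paths)" by (rule Psf.integral_fst'[OF int])
  finally show "(\<integral>t\<in>{a..b}. (\<integral>x. g (t, x) \<partial>law t) \<partial>lborel) = (\<integral>z. g (position z) \<partial>paths)" .
qed

definition control :: "real \<times> nat \<times> 'w \<Rightarrow> real ^ 'n" where
  "control = (\<lambda>(t, i, \<omega>). \<alpha> i t \<omega>)"

lemma control_integrable: "integrable paths (\<lambda>z. control z $ k)"
proof -
  have m: "(\<lambda>(t, \<omega>). \<alpha> i t \<omega> $ k) \<in> borel_measurable (lborel \<Otimes>\<^sub>M M)" for i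
    using measurable_compose[OF \<alpha>m[of i] vec_nth_measurable] by (simp add: case_prod_unfold)
  have "integrable paths (\<lambda>(t, i, \<omega>). \<alpha> i t \<omega> $ k)"
  proof (rule paths_average(1)[OF m])
    fix i assume i: "i < N"
    show "integrable (lborel \<Otimes>\<^sub>M M) (\<lambda>(t, \<omega>). indicat_real {a..b} t *\<^sub>R \<alpha> i t \<omega> $ k)"
    proof (rule dominated_integrable[OF i m])
      fix t \<omega>
      show "\<bar>\<alpha> i t \<omega> $ k\<bar> \<le> 1 * (1 + (norm (\<alpha> i t \<omega>))\<^sup>2)"
        using order_trans[OF component_le_norm_cart[of "\<alpha> i t \<omega>" k] le_one_plus_square] by simp
    qed
  qed
  then show ?thesis by (simp add: control_def case_prod_unfold)
qed

text \<open>A choice fixes one version, so that the equation, the energy bound and the cost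
  comparison all speak of the same function.\<close>

definition feedback :: "real \<times> 'n torus \<Rightarrow> real ^ 'n" where
  "feedback = (SOME A. A \<in> borel_measurable space_time \<and>
     (\<forall>z\<in>space paths. \<forall>k. A (position z) $ k = real_cond_exp paths (cond_on paths position space_time) (\<lambda>z. control z $ k) z))"

lemma feedback:
  shows "feedback \<in> borel_measurable space_time"
    and "\<And>z k. z \<in> space paths \<Longrightarrow>
      feedback (position z) $ k = real_cond_exp paths (cond_on paths position space_time) (\<lambda>z. control z $ k) z"
proof -
  have "\<exists>A. A \<in> borel_measurable space_time \<and>
     (\<forall>z\<in>space paths. \<forall>k. A (position z) $ k = real_cond_exp paths (cond_on paths position space_time) (\<lambda>z. control z $ k) z)"
    using conditional_control[OF position_measurable, of control] by metis
  from someI_ex[OF this] show "feedback \<in> borel_measurable space_time"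
    "\<And>z k. z \<in> space paths \<Longrightarrow>
      feedback (position z) $ k = real_cond_exp paths (cond_on paths position space_time) (\<lambda>z. control z $ k) z"
    unfolding feedback_def by blast+
qed

lemma feedback_integral:
  assumes "g \<in> borel_measurable space_time" "\<And>z. \<bar>g z\<bar> \<le> C"
  shows "integrable paths (\<lambda>z. g (position z) * feedback (position z) $ k)"
    and "(\<integral>z. g (position z) * feedback (position z) $ k \<partial>paths) = (\<integral>z. g (position z) * control z $ k \<partial>paths)"
  by (rule conditional_control_integral[OF finite_paths position_measurable control_integrable _ assms];
      simp add: feedback(2))+

lemma feedback_jensen:
  assumes "affine_sup space_time Q f \<Phi>" "integrable paths (\<lambda>z. \<Phi> (position z) (control z))"
  shows "integrable paths (\<lambda>z. \<Phi> (position z) (feedback (position z)))"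
    and "(\<integral>z. \<Phi> (position z) (feedback (position z)) \<partial>paths) \<le> (\<integral>z. \<Phi> (position z) (control z) \<partial>paths)"
  by (rule conditional_jensen[OF finite_paths position_measurable control_integrable _ feedback(1) assms];
      simp add: feedback(2))+

lemma space_time_measurable:
  "g \<in> borel_measurable (borel \<Otimes>\<^sub>M (borel :: 'n torus measure)) \<Longrightarrow> g \<in> borel_measurable space_time"
proof -
  assume g: "g \<in> borel_measurable (borel \<Otimes>\<^sub>M (borel :: 'n torus measure))"
  have "(\<lambda>z. (fst z, snd z)) \<in> space_time \<rightarrow>\<^sub>M borel \<Otimes>\<^sub>M (borel :: 'n torus measure)"
    by (intro measurable_Pair measurable_snd measurable_compose[OF measurable_fst] measurable_restrict_space1 measurable_ident_sets refl)
  from measurable_compose[OF this g] show "g \<in> borel_measurable space_time" by simp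
qed

text \<open>The gradient term tests the feedback against a bounded function of time and position, so
  the feedback may be replaced by the control. What remains is the average over the particles of the
  integrated generator, which vanishes by the mean formula.\<close>

lemma law_fokker_planck: "fokker_planck a b law (\<lambda>t x. feedback (t, x))"
  unfolding fokker_planck_def
proof (intro allI impI)
  fix \<phi> :: "real \<Rightarrow> 'n torus \<Rightarrow> real" assume tf: "test_function a b \<phi>"
  obtain K f0 f1 f2 where tb: "taylor_bounds K (\<lambda>(t, y). \<phi> t (to_torus y)) f0 f1 f2"
    and d: "\<And>t x. deriv (\<lambda>s. \<phi> s x) t = f0 (t, torus_rep x)"
      "\<And>t x. torus_laplacian (\<phi> t) x = (\<Sum>i\<in>UNIV. f2 i i (t, torus_rep x))"
      "\<And>t x i. torus_gradient (\<phi> t) x $ i = f1 i (t, torus_rep x)"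
    and z: "\<And>x. \<phi> a x = 0" "\<And>x. \<phi> b x = 0"
    and per: "\<And>q t y k. q \<in> {f0} \<union> range f1 \<union> (\<Union>i. range (f2 i)) \<Longrightarrow> \<forall>i. k $ i \<in> \<int> \<Longrightarrow> q (t, y + k) = q (t, y)"
    using test_function_taylor[OF tf] by blast
  note tb' = taylor_boundsD[OF tb]
  have K: "0 \<le> K" by (rule tb'(1))
  have sub: "q \<in> {\<lambda>(t, y). \<phi> t (to_torus y), f0} \<union> range f1 \<union> (\<Union>i. range (f2 i))"
    if "q \<in> {f0} \<union> range f1 \<union> (\<Union>i. range (f2 i))" for q using that by blast
  have qc: "continuous_on UNIV q" and qb: "\<And>z. \<bar>q z\<bar> \<le> K" if "q \<in> {f0} \<union> range f1 \<union> (\<Union>i. range (f2 i))" for q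
    using tb'(5,6)[OF sub[OF that]] by auto
  let ?r = "\<lambda>q (t, x). q (t, torus_rep x) :: real"
  have qm: "?r q \<in> borel_measurable space_time" and qrep: "\<And>t y. q (t, torus_rep (to_torus y)) = q (t, y)"
    if q: "q \<in> {f0} \<union> range f1 \<union> (\<Union>i. range (f2 i))" for q
    using space_time_measurable[OF torus_slice_measurable(1)[OF qc[OF q] per[OF q]]]
      torus_slice_measurable(2)[OF qc[OF q] per[OF q]] by auto
  have in0: "f0 \<in> {f0} \<union> range f1 \<union> (\<Union>i. range (f2 i))" and in1: "\<And>i. f1 i \<in> {f0} \<union> range f1 \<union> (\<Union>i. range (f2 i))"
    and in2: "\<And>i j. f2 i j \<in> {f0} \<union> range f1 \<union> (\<Union>i. range (f2 i))" by blast+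
  let ?p = "\<lambda>z. ?r f0 z + (\<Sum>i\<in>UNIV. ?r (f2 i i) z)"
  let ?g = "\<lambda>z. ?p z + (\<Sum>k\<in>UNIV. ?r (f1 k) z * feedback z $ k)"
  have pm: "?p \<in> borel_measurable space_time"
    by (intro borel_measurable_add borel_measurable_sum qm in0 in2)
  have fm: "(\<lambda>z. feedback z $ k) \<in> borel_measurable space_time" for k
    by (rule measurable_compose[OF feedback(1) vec_nth_measurable])
  have gm: "?g \<in> borel_measurable space_time"
    by (intro borel_measurable_add pm borel_measurable_sum borel_measurable_times fm qm in1)
  have rb: "\<bar>?r q z\<bar> \<le> K" if "q \<in> {f0} \<union> range f1 \<union> (\<Union>i. range (f2 i))" for q z
    using qb[OF that] by (cases z) simp
  interpret P: finite_measure paths by (rule finite_paths)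
  have pint: "integrable paths (\<lambda>z. ?r q (position z))" if q: "q \<in> {f0} \<union> range f1 \<union> (\<Union>i. range (f2 i))" for q
    by (rule P.integrable_const_bound[of _ K])
      (use rb[OF q] measurable_compose[OF position_measurable qm[OF q]] in auto)
  have ppint: "integrable paths (\<lambda>z. ?p (position z))"
    by (intro Bochner_Integration.integrable_add Bochner_Integration.integrable_sum pint in0 in2)
  note fb = feedback_integral[OF qm[OF in1] rb[OF in1]]
  have sint: "integrable paths (\<lambda>z. \<Sum>k\<in>UNIV. ?r (f1 k) (position z) * feedback (position z) $ k)"
    by (intro Bochner_Integration.integrable_sum fb(1))
  have gint: "integrable paths (\<lambda>z. ?g (position z))"
    by (rule Bochner_Integration.integrable_add[OF ppint sint])
  have cint: "integrable paths (\<lambda>z. ?r (f1 k) (position z) * control z $ k)" for k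
  proof (rule Bochner_Integration.integrable_bound)
    show "integrable paths (\<lambda>z. K * (control z $ k))" using control_integrable by simp
    show "(\<lambda>z. ?r (f1 k) (position z) * control z $ k) \<in> borel_measurable paths"
      by (intro borel_measurable_times measurable_compose[OF position_measurable qm[OF in1]]
          borel_measurable_integrable[OF control_integrable])
    show "AE z in paths. norm (?r (f1 k) (position z) * control z $ k) \<le> norm (K * (control z $ k))"
    proof (rule AE_I2)
      fix z
      show "norm (?r (f1 k) (position z) * control z $ k) \<le> norm (K * (control z $ k))"
        using mult_right_mono[OF rb[OF in1[of k], of "position z"], of "\<bar>control z $ k\<bar>"] K
        unfolding real_norm_def abs_mult by simp
    qed
  qed
  let ?u = "\<lambda>i. drift_diffusion.drift_of (\<alpha> i) (Y i) f0 f1 f2"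
  have u_eq: "?u i r \<omega> = f0 (r, Y i r \<omega>) + (\<Sum>k\<in>UNIV. f2 k k (r, Y i r \<omega>)) + (\<Sum>k\<in>UNIV. \<alpha> i r \<omega> $ k * f1 k (r, Y i r \<omega>))"
    if "i < N" for i r \<omega>
    by (rule drift_diffusion.drift_of_def[OF dd[OF that]])
  let ?v = "\<lambda>i r \<omega>. f0 (r, Y i r \<omega>) + (\<Sum>k\<in>UNIV. f2 k k (r, Y i r \<omega>)) + (\<Sum>k\<in>UNIV. \<alpha> i r \<omega> $ k * f1 k (r, Y i r \<omega>))"
  have vm: "(\<lambda>(r, \<omega>). ?v i r \<omega>) \<in> borel_measurable (lborel \<Otimes>\<^sub>M M)" for i
  proof -
    have "(\<lambda>(r, \<omega>). (r, Y i r \<omega>)) \<in> lborel \<Otimes>\<^sub>M M \<rightarrow>\<^sub>M borel \<Otimes>\<^sub>M borel"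
      using Ym[of i] unfolding case_prod_unfold
      by (intro measurable_Pair) (auto intro!: measurable_compose[OF measurable_fst])
    then have p: "(\<lambda>(r, \<omega>). (r, Y i r \<omega>)) \<in> borel_measurable (lborel \<Otimes>\<^sub>M M)" by (simp only: borel_prod)
    have 1: "(\<lambda>(r, \<omega>). q (r, Y i r \<omega>)) \<in> borel_measurable (lborel \<Otimes>\<^sub>M M)"
      if "q \<in> {f0} \<union> range f1 \<union> (\<Union>i. range (f2 i))" for q
      using measurable_compose[OF p borel_measurable_continuous_onI[OF qc[OF that]]] by (simp add: case_prod_unfold)
    have 2: "(\<lambda>(r, \<omega>). \<alpha> i r \<omega> $ k) \<in> borel_measurable (lborel \<Otimes>\<^sub>M M)" for k
      using measurable_compose[OF \<alpha>m[of i] vec_nth_measurable] by (simp add: case_prod_unfold)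
    show ?thesis
      using 1[OF in0] 1[OF in1] 1[OF in2] 2 unfolding case_prod_unfold
      by (intro borel_measurable_add borel_measurable_sum borel_measurable_times) auto
  qed
  have vint: "integrable (lborel \<Otimes>\<^sub>M M) (\<lambda>(r, \<omega>). indicat_real {a..b} r *\<^sub>R ?v i r \<omega>)" if i: "i < N" for i
  proof (rule dominated_integrable[OF i vm])
    fix t \<omega>
    let ?n = "real CARD('n)" and ?m = "1 + (norm (\<alpha> i t \<omega>))\<^sup>2"
    have m1: "1 \<le> ?m" by simp
    have "\<bar>\<Sum>k\<in>UNIV. f2 k k (t, Y i t \<omega>)\<bar> \<le> ?n * K"
      by (rule order_trans[OF sum_abs sum_bounded_above]) (rule qb[OF in2])
    moreover have "\<bar>\<Sum>k\<in>UNIV. \<alpha> i t \<omega> $ k * f1 k (t, Y i t \<omega>)\<bar> \<le> ?n * (?m * K)"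
    proof (rule order_trans[OF sum_abs sum_bounded_above])
      fix k
      have "\<bar>\<alpha> i t \<omega> $ k\<bar> \<le> ?m"
        using component_le_norm_cart[of "\<alpha> i t \<omega>" k] le_one_plus_square[of "norm (\<alpha> i t \<omega>)"] by linarith
      then show "\<bar>\<alpha> i t \<omega> $ k * f1 k (t, Y i t \<omega>)\<bar> \<le> ?m * K"
        unfolding abs_mult using qb[OF in1] by (intro mult_mono) auto
    qed
    moreover have "K * 1 \<le> K * ?m" "?n * K * 1 \<le> ?n * K * ?m"
      using mult_left_mono[OF m1, of K] mult_left_mono[OF m1, of "?n * K"] K by auto
    ultimately have "\<bar>?v i t \<omega>\<bar> \<le> K * ?m + ?n * K * ?m + ?n * (?m * K)" using qb[OF in0, of "(t, Y i t \<omega>)"] by linarith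
    then show "\<bar>?v i t \<omega>\<bar> \<le> (K + 2 * ?n * K) * ?m" by (simp add: algebra_simps)
  qed
  \<comment> \<open>The boundary terms of the mean formula vanish because the test function is 0 at
    both ends of the interval.\<close>
  have zero: "(\<integral>\<omega>. (\<integral>r\<in>{a..b}. ?v i r \<omega> \<partial>lborel) \<partial>M) = 0" if i: "i < N" for i
    using drift_diffusion.ito_mean[OF dd[OF i] tb, unfolded u_eq[OF i], OF vint[OF i]] z by simp
  have "(\<integral>t\<in>{a..b}. (\<integral>x. (deriv (\<lambda>s. \<phi> s x) t + torus_laplacian (\<phi> t) x
         + feedback (t, x) \<bullet> torus_gradient (\<phi> t) x) \<partial>law t) \<partial>lborel)
     = (\<integral>t\<in>{a..b}. (\<integral>x. ?g (t, x) \<partial>law t) \<partial>lborel)"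
    by (simp add: d inner_vec_def mult.commute)
  also have "\<dots> = (\<integral>z. ?g (position z) \<partial>paths)" by (rule law_integral(2)[OF gm gint])
  also have "\<dots> = (\<integral>z. ?p (position z) \<partial>paths) + (\<Sum>k\<in>UNIV. \<integral>z. ?r (f1 k) (position z) * feedback (position z) $ k \<partial>paths)"
    using ppint sint fb(1) by (simp only: Bochner_Integration.integral_add Bochner_Integration.integral_sum)
  \<comment> \<open>The defining property of the conditional expectation, used with the derivative
    \<open>f1 k\<close> as the bounded test function.\<close>
  also have "\<dots> = (\<integral>z. ?p (position z) \<partial>paths) + (\<Sum>k\<in>UNIV. \<integral>z. ?r (f1 k) (position z) * control z $ k \<partial>paths)"
    by (simp only: fb(2))
  also have "\<dots> = (\<integral>z. ?p (position z) + (\<Sum>k\<in>UNIV. ?r (f1 k) (position z) * control z $ k) \<partial>paths)"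
    using ppint cint by (simp only: Bochner_Integration.integral_add Bochner_Integration.integral_sum Bochner_Integration.integrable_sum)
  also have "\<dots> = (\<integral>z. (case z of (t, i, \<omega>) \<Rightarrow> ?v i t \<omega>) \<partial>paths)"
    by (rule Bochner_Integration.integral_cong)
      (auto simp: position_def control_def qrep[OF in0] qrep[OF in1] qrep[OF in2] mult.commute)
  also have "\<dots> = (\<Sum>i<N. \<integral>\<omega>. (\<integral>t\<in>{a..b}. ?v i t \<omega> \<partial>lborel) \<partial>M) / real N"
    by (rule paths_average(2)[OF vm vint])
  also have "\<dots> = 0" using zero by simp
  finally show "(\<integral>t\<in>{a..b}. (\<integral>x. (deriv (\<lambda>s. \<phi> s x) t + torus_laplacian (\<phi> t) x
         + feedback (t, x) \<bullet> torus_gradient (\<phi> t) x) \<partial>law t) \<partial>lborel) = 0" .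
qed

end

section \<open>Comparison of the costs\<close>

lemma countable_dense_vec:
  obtains D :: "(real ^ 'n) set" where "countable D" "\<And>X. open X \<Longrightarrow> X \<noteq> {} \<Longrightarrow> \<exists>d\<in>D. d \<in> X"
  using countable_dense_exists by blast

text \<open>The supremum over all \<open>p\<close> is attained at \<open>p = 2 a\<close>.\<close>

lemma affine_sup_square:
  obtains Q where "affine_sup S Q (\<lambda>p _. - (norm p)\<^sup>2 / 4) (\<lambda>_ a :: real ^ 'n. (norm a)\<^sup>2)"
proof -
  obtain D :: "(real ^ 'n) set" where D: "countable D" "\<And>X. open X \<Longrightarrow> X \<noteq> {} \<Longrightarrow> \<exists>d\<in>D. d \<in> X"
    using countable_dense_vec by blast
  have le: "- (norm p)\<^sup>2 / 4 + a \<bullet> p \<le> (norm a)\<^sup>2" for a p :: "real ^ 'n"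
  proof -
    have "0 \<le> (norm (a - (1/2) *\<^sub>R p))\<^sup>2" by simp
    also have "\<dots> = (norm a)\<^sup>2 - a \<bullet> p + (norm p)\<^sup>2 / 4"
      by (simp add: power2_norm_eq_inner inner_diff_left inner_diff_right inner_commute)
    finally show ?thesis by simp
  qed
  have ap: "\<exists>p\<in>D. (norm a)\<^sup>2 - e < - (norm p)\<^sup>2 / 4 + a \<bullet> p" if e: "e > 0" for a :: "real ^ 'n" and e
  proof -
    let ?X = "{p. (norm a)\<^sup>2 - e < - (norm p)\<^sup>2 / 4 + a \<bullet> p}"
    have "open ?X" by (intro open_Collect_less continuous_intros) auto
    moreover have "2 *\<^sub>R a \<in> ?X" using e by (simp add: power2_norm_eq_inner)
    ultimately show ?thesis using D(2)[of ?X] by blast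
  qed
  have "D \<noteq> {}" using D(2)[of UNIV] by auto
  then have "affine_sup S D (\<lambda>p _. - (norm p)\<^sup>2 / 4) (\<lambda>_ a. (norm a)\<^sup>2)"
    unfolding affine_sup_def
  proof (intro conjI ballI allI impI)
    fix p :: "real ^ 'n"
    show "\<exists>C. \<forall>z::'a. \<bar>- (norm p)\<^sup>2 / 4\<bar> \<le> C" by (intro exI[of _ "\<bar>- (norm p)\<^sup>2 / 4\<bar>"]) simp
  qed (use D(1) le ap in auto)
  then show ?thesis using that by blast
qed

text \<open>The Fenchel-Young minorant with momentum \<open>q\<close> has slope \<open>- q\<close>;
  hence the slopes are the negatives of a countable dense set of momenta, with intercept
  \<open>- H (snd z) (- p)\<close>.\<close>

lemma affine_sup_lagrangian:
  fixes L H :: "'n::finite torus \<Rightarrow> real ^ 'n \<Rightarrow> real" and S :: "real measure"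
  assumes L: "\<And>x. continuous_on UNIV (L x)" "\<And>x. convex_on UNIV (L x)" and H: "is_hamiltonian L H"
    and H_C2: "cont_diff 2 (\<lambda>(y, p). H (to_torus y) p)"
  obtains Q where "affine_sup (S \<Otimes>\<^sub>M borel) Q (\<lambda>p z. - H (snd z) (- p)) (\<lambda>z a. L (snd z) a)"
proof -
  obtain D :: "(real ^ 'n) set" where D: "countable D" "\<And>X. open X \<Longrightarrow> X \<noteq> {} \<Longrightarrow> \<exists>d\<in>D. d \<in> X"
    using countable_dense_vec by blast
  have "D \<noteq> {}" using D(2)[of UNIV] by auto
  have "affine_sup (S \<Otimes>\<^sub>M borel) (uminus ` D) (\<lambda>p z. - H (snd z) (- p)) (\<lambda>z a. L (snd z) a)"
    unfolding affine_sup_def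
  proof (intro conjI ballI allI impI)
    show "countable (uminus ` D)" "uminus ` D \<noteq> {}" using D(1) \<open>D \<noteq> {}\<close> by auto
    fix p :: "real ^ 'n"
    have c: "continuous_on UNIV (\<lambda>x. H x (- p))" by (rule hamiltonian_torus_continuous[OF H_C2])
    then have "(\<lambda>x. H x (- p)) \<in> borel_measurable borel" by (rule borel_measurable_continuous_onI)
    from measurable_compose[OF measurable_snd this]
    show "(\<lambda>z. - H (snd z) (- p)) \<in> borel_measurable (S \<Otimes>\<^sub>M borel)" by (rule borel_measurable_uminus)
    obtain C where "\<And>x. \<bar>H x (- p)\<bar> \<le> C" using continuous_on_torus_bounded[OF c] by blast
    then show "\<exists>C. \<forall>z. \<bar>- H (snd z) (- p)\<bar> \<le> C" by auto
  next
    fix z :: "real \<times> 'n torus" and a p :: "real ^ 'n"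
    show "- H (snd z) (- p) + a \<bullet> p \<le> L (snd z) a" using lagrangian_lower[OF H, of "snd z" "- p" a] by simp
  next
    fix z :: "real \<times> 'n torus" and a :: "real ^ 'n" and e :: real assume "0 < e"
    from lagrangian_countable_sup[OF L H H_C2 this D(2), of "snd z" a]
    obtain p where "p \<in> D" "L (snd z) a - e < - H (snd z) p - a \<bullet> p" by blast
    then show "\<exists>p\<in>uminus ` D. L (snd z) a - e < - H (snd z) (- p) + a \<bullet> p"
      by (intro bexI[of _ "- p"]) auto
  qed
  then show ?thesis using that by blast
qed

context particle_system
begin

lemma control_energy: "integrable paths (\<lambda>z. (norm (control z))\<^sup>2)"
proof -
  have m: "(\<lambda>(t, \<omega>). (norm (\<alpha> i t \<omega>))\<^sup>2) \<in> borel_measurable (lborel \<Otimes>\<^sub>M M)" for i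
    using \<alpha>m[of i] unfolding case_prod_unfold by measurable
  have "integrable paths (\<lambda>(t, i, \<omega>). (norm (\<alpha> i t \<omega>))\<^sup>2)"
  proof (rule paths_average(1)[OF m])
    fix i assume i: "i < N"
    show "integrable (lborel \<Otimes>\<^sub>M M) (\<lambda>(t, \<omega>). indicat_real {a..b} t *\<^sub>R (norm (\<alpha> i t \<omega>))\<^sup>2)"
      by (rule dominated_integrable[OF i m, where C=1]) simp
  qed
  then show ?thesis by (simp add: control_def case_prod_unfold)
qed

text \<open>The finite energy of the feedback is conditional Jensen for the squared norm; the
  remaining conditions were established for \<open>law\<close> and \<open>feedback\<close>
  separately.\<close>

lemma feedback_admissible:
  assumes init: "\<And>i \<omega>. i < N \<Longrightarrow> X i a \<omega> = x i"
  shows "admissible_pair b a (empirical N x) law (\<lambda>t x. feedback (t, x))"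
  unfolding admissible_pair_def
proof (intro conjI ballI)
  show "law t \<in> torus_probs" for t by (rule law_torus_probs)
  show "((\<lambda>s. d1 (law s) (law t)) \<longlongrightarrow> 0) (at t within {a..b})" if "t \<in> {a..b}" for t
    by (rule law_continuous[OF that])
  show "(\<lambda>(t, x). feedback (t, x)) \<in> borel_measurable space_time" using feedback(1) by simp
  show "fokker_planck a b law (\<lambda>t x. feedback (t, x))" by (rule law_fokker_planck)
  show "law a = empirical N x" by (rule law_initial[OF init])
  \<comment> \<open>The squared norm written as a countable supremum of affine functions, the form
    that \<open>feedback_jensen\<close> accepts.\<close>
  obtain Q where Q: "affine_sup space_time Q (\<lambda>p _. - (norm p)\<^sup>2 / 4) (\<lambda>_ a :: real ^ 'n. (norm a)\<^sup>2)"
    using affine_sup_square by blast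
  have int: "integrable paths (\<lambda>z. (norm (feedback (position z)))\<^sup>2)"
    by (rule feedback_jensen(1)[OF Q control_energy])
  have st: "space time = {a..b}" by (simp add: space_restrict_space)
  let ?g = "\<lambda>z. ennreal ((norm (feedback z))\<^sup>2)"
  have gm: "?g \<in> borel_measurable space_time" using feedback(1) by measurable
  have gp: "(\<lambda>z. ?g (position z)) \<in> borel_measurable paths"
    by (rule measurable_compose[OF position_measurable gm])
  have "(\<integral>\<^sup>+t\<in>{a..b}. (\<integral>\<^sup>+x. ?g (t, x) \<partial>law t) \<partial>lborel) = (\<integral>\<^sup>+t. (\<integral>\<^sup>+x. ?g (t, x) \<partial>law t) \<partial>time)"
    by (rule nn_integral_restrict_space[symmetric]) simp
  also have "\<dots> = (\<integral>\<^sup>+t. (\<integral>\<^sup>+y. ?g (position (t, y)) \<partial>sample) \<partial>time)"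
  proof (rule nn_integral_cong)
    fix t assume "t \<in> space time"
    then have "(\<lambda>x. (t, x)) \<in> borel \<rightarrow>\<^sub>M space_time" by (intro measurable_Pair1') (simp add: space_restrict_space)
    from measurable_compose[OF this gm]
    show "(\<integral>\<^sup>+x. ?g (t, x) \<partial>law t) = (\<integral>\<^sup>+y. ?g (position (t, y)) \<partial>sample)"
      unfolding law_def by (subst nn_integral_distr[OF X_sample]) (auto simp: position_def case_prod_unfold)
  qed
  also have "\<dots> = (\<integral>\<^sup>+z. ?g (position z) \<partial>paths)" by (rule UM.nn_integral_fst[OF gp])
  also have "\<dots> < \<infinity>" using int by (simp add: integrable_iff_bounded)
  finally show "(\<integral>\<^sup>+t\<in>{a..b}. (\<integral>\<^sup>+x. ennreal ((norm (feedback (t, x)))\<^sup>2) \<partial>law t) \<partial>lborel) < \<infinity>" .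
qed

lemma law_functional_integrable:
  assumes F: "d1_lipschitz F"
  shows "set_integrable lborel {a..b} (\<lambda>t. F (law t))"
proof -
  obtain K where K: "K \<ge> 0" "\<And>m1 m2. m1 \<in> torus_probs \<Longrightarrow> m2 \<in> torus_probs \<Longrightarrow> \<bar>F m1 - F m2\<bar> \<le> K * d1 m1 m2"
    using d1_lipschitzE[OF F] by blast
  have "continuous_on {a..b} (\<lambda>t. F (law t))"
    unfolding continuous_on_def
  proof
    fix t assume t: "t \<in> {a..b}"
    have "((\<lambda>s. K * d1 (law s) (law t)) \<longlongrightarrow> K * 0) (at t within {a..b})"
      by (intro tendsto_intros law_continuous[OF t])
    then have l: "((\<lambda>s. K * d1 (law s) (law t)) \<longlongrightarrow> 0) (at t within {a..b})" by simp
    show "((\<lambda>s. F (law s)) \<longlongrightarrow> F (law t)) (at t within {a..b})"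
      by (rule LIM_zero_cancel, rule Lim_null_comparison[OF always_eventually l])
        (use K(2)[OF law_torus_probs law_torus_probs] in simp)
  qed
  then show ?thesis unfolding set_integrable_def by (rule borel_integrable_compact[OF compact_Icc])
qed

text \<open>Jensen's inequality for the empirical measure holds at each fixed time; integrating over
  time and exchanging the integrals gives the running cost.\<close>

lemma functional_cost:
  assumes F: "convex_on_probs F" "d1_lipschitz F"
  defines "h \<equiv> \<lambda>t \<omega>. F (empirical N (\<lambda>i. X i t \<omega>))"
  shows "integrable (lborel \<Otimes>\<^sub>M M) (\<lambda>(t, \<omega>). indicat_real {a..b} t *\<^sub>R h t \<omega>)"
    and "(\<integral>t\<in>{a..b}. F (law t) \<partial>lborel) \<le> (\<integral>\<omega>. (\<integral>t\<in>{a..b}. h t \<omega> \<partial>lborel) \<partial>M)"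
proof -
  obtain C where C: "C \<ge> 0" "\<And>m. m \<in> torus_probs \<Longrightarrow> \<bar>F m\<bar> \<le> C" using d1_lipschitz_bounded[OF F(2)] by blast
  have hm: "(\<lambda>(t, \<omega>). h t \<omega>) \<in> borel_measurable (lborel \<Otimes>\<^sub>M M)"
    using empirical_functional_measurable[OF N _ F(2), of "\<lambda>i (t, \<omega>). X i t \<omega>" "lborel \<Otimes>\<^sub>M M"] Xm
    unfolding h_def by (simp add: case_prod_unfold)
  \<comment> \<open>The domination lemma refers to the control of some particle; a bounded function
    is dominated using particle 0.\<close>
  have 0: "0 < N" using N by simp
  show hi: "integrable (lborel \<Otimes>\<^sub>M M) (\<lambda>(t, \<omega>). indicat_real {a..b} t *\<^sub>R h t \<omega>)"
  proof (rule dominated_integrable[OF 0 hm])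
    fix t \<omega>
    have "\<bar>h t \<omega>\<bar> \<le> C" unfolding h_def by (rule C(2)[OF empirical_torus_probs[OF N]])
    also have "C * 1 \<le> C * (1 + (norm (\<alpha> 0 t \<omega>))\<^sup>2)" using C(1) by (intro mult_left_mono) auto
    finally show "\<bar>h t \<omega>\<bar> \<le> C * (1 + (norm (\<alpha> 0 t \<omega>))\<^sup>2)" by simp
  qed
  then have hi': "integrable (lborel \<Otimes>\<^sub>M M) (case_prod (\<lambda>t \<omega>. indicat_real {a..b} t *\<^sub>R h t \<omega>))" .
  have "(\<integral>t. indicat_real {a..b} t *\<^sub>R F (law t) \<partial>lborel) \<le> (\<integral>t. (\<integral>\<omega>. indicat_real {a..b} t *\<^sub>R h t \<omega> \<partial>M) \<partial>lborel)"
  proof (rule integral_mono)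
    show "integrable lborel (\<lambda>t. indicat_real {a..b} t *\<^sub>R F (law t))"
      using law_functional_integrable[OF F(2)] by (simp add: set_integrable_def)
    show "integrable lborel (\<lambda>t. \<integral>\<omega>. indicat_real {a..b} t *\<^sub>R h t \<omega> \<partial>M)"
      using lM.integrable_fst[OF hi'] .
    fix t :: real
    show "indicat_real {a..b} t *\<^sub>R F (law t) \<le> (\<integral>\<omega>. indicat_real {a..b} t *\<^sub>R h t \<omega> \<partial>M)"
      using jensen_empirical(2)[OF prob_space_axioms N X_measurable F law_torus_probs measure_law, of t]
      by (auto simp: h_def indicator_def)
  qed
  also have "\<dots> = (\<integral>\<omega>. (\<integral>t. indicat_real {a..b} t *\<^sub>R h t \<omega> \<partial>lborel) \<partial>M)"
    by (rule lM.Fubini_integral[OF hi', symmetric])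
  finally show "(\<integral>t\<in>{a..b}. F (law t) \<partial>lborel) \<le> (\<integral>\<omega>. (\<integral>t\<in>{a..b}. h t \<omega> \<partial>lborel) \<partial>M)"
    by (simp add: set_lebesgue_integral_def)
qed

text \<open>Three comparisons are added: conditional Jensen for the Lagrangian, the time-integrated
  Jensen inequality for \<open>F\<close>, and Jensen's inequality at the final time for
  \<open>G\<close>. The growth bound on \<open>L\<close> makes every term integrable, so both costs
  may be split into these terms.\<close>

theorem mean_field_cost_le:
  fixes L H :: "'n torus \<Rightarrow> real ^ 'n \<Rightarrow> real"
  assumes L: "\<And>x. continuous_on UNIV (L x)" "\<And>x. convex_on UNIV (L x)" and H: "is_hamiltonian L H"
    and H_C2: "cont_diff 2 (\<lambda>(y, p). H (to_torus y) p)"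
    and C: "C \<ge> 0" "\<And>x a. - C \<le> L x a" "\<And>x a. L x a \<le> C * (1 + (norm a)\<^sup>2)"
    and F: "convex_on_probs F" "d1_lipschitz F" and G: "convex_on_probs G" "d1_lipschitz G"
  defines "J \<equiv> \<lambda>\<omega>. (\<integral>t\<in>{a..b}. ((1 / real N) * (\<Sum>i<N. L (X i t \<omega>) (\<alpha> i t \<omega>))
                 + F (empirical N (\<lambda>i. X i t \<omega>))) \<partial>lborel) + G (empirical N (\<lambda>i. X i b \<omega>))"
  shows "J \<in> borel_measurable M"
    and "mean_field_cost b L F G a law (\<lambda>t x. feedback (t, x)) \<le> (\<integral>\<omega>. J \<omega> \<partial>M)"
proof -
  let ?l = "\<lambda>i t \<omega>. L (X i t \<omega>) (\<alpha> i t \<omega>)" and ?h = "\<lambda>t \<omega>. F (empirical N (\<lambda>i. X i t \<omega>))"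
    and ?k = "\<lambda>\<omega>. G (empirical N (\<lambda>i. X i b \<omega>))"
  obtain Q where Q: "affine_sup space_time Q (\<lambda>p z. - H (snd z) (- p)) (\<lambda>z a. L (snd z) a)"
    using affine_sup_lagrangian[OF L H H_C2] by blast
  \<comment> \<open>The same representation over the unrestricted time line, where measurability of
    the Lagrangian along particle paths is checked before the integrals are restricted to
    \<open>[a, b]\<close>.\<close>
  obtain Q' where Q': "affine_sup (borel \<Otimes>\<^sub>M borel) Q' (\<lambda>p z. - H (snd z) (- p)) (\<lambda>z :: real \<times> 'n torus. L (snd z))"
    using affine_sup_lagrangian[OF L H H_C2] by blast
  have lm: "(\<lambda>(t, \<omega>). ?l i t \<omega>) \<in> borel_measurable (lborel \<Otimes>\<^sub>M M)" for i
  proof -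
    have "(\<lambda>z. ((fst z, (\<lambda>(t, \<omega>). X i t \<omega>) z), (\<lambda>(t, \<omega>). \<alpha> i t \<omega>) z)) \<in> lborel \<Otimes>\<^sub>M M \<rightarrow>\<^sub>M (borel \<Otimes>\<^sub>M borel) \<Otimes>\<^sub>M borel"
      by (intro measurable_Pair Xm \<alpha>m measurable_compose[OF measurable_fst]) simp
    from measurable_compose[OF this affine_sup_measurable[OF Q']] show ?thesis
      by (simp add: case_prod_unfold)
  qed
  have li: "integrable (lborel \<Otimes>\<^sub>M M) (\<lambda>(t, \<omega>). indicat_real {a..b} t *\<^sub>R ?l i t \<omega>)" if "i < N" for i
  proof (rule dominated_integrable[OF that lm])
    fix t \<omega>
    have "C * 1 \<le> C * (1 + (norm (\<alpha> i t \<omega>))\<^sup>2)" using C(1) by (intro mult_left_mono) auto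
    then show "\<bar>?l i t \<omega>\<bar> \<le> C * (1 + (norm (\<alpha> i t \<omega>))\<^sup>2)"
      using C(2)[of "X i t \<omega>" "\<alpha> i t \<omega>"] C(3)[of "X i t \<omega>" "\<alpha> i t \<omega>"] by linarith
  qed
  have li': "integrable (lborel \<Otimes>\<^sub>M M) (case_prod (\<lambda>t \<omega>. indicat_real {a..b} t *\<^sub>R ?l i t \<omega>))" if "i < N" for i
    by (rule li[OF that])
  note fF = functional_cost[OF F]
  have hi': "integrable (lborel \<Otimes>\<^sub>M M) (case_prod (\<lambda>t \<omega>. indicat_real {a..b} t *\<^sub>R ?h t \<omega>))"
    by (rule fF(1))
  have kG: "integrable M ?k" "G (law b) \<le> (\<integral>\<omega>. ?k \<omega> \<partial>M)"
    using jensen_empirical[OF prob_space_axioms N X_measurable G law_torus_probs measure_law, of b] by auto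
  have int_l: "integrable M (\<lambda>\<omega>. \<integral>t\<in>{a..b}. ?l i t \<omega> \<partial>lborel)" if "i < N" for i
    unfolding set_lebesgue_integral_def by (rule lM.integrable_snd[OF li'[OF that]])
  have int_h: "integrable M (\<lambda>\<omega>. \<integral>t\<in>{a..b}. ?h t \<omega> \<partial>lborel)"
    unfolding set_lebesgue_integral_def by (rule lM.integrable_snd[OF hi'])
  let ?J = "\<lambda>\<omega>. (\<Sum>i<N. \<integral>t\<in>{a..b}. ?l i t \<omega> \<partial>lborel) / real N + (\<integral>t\<in>{a..b}. ?h t \<omega> \<partial>lborel) + ?k \<omega>"
  have Jint: "integrable M ?J"
    using int_l int_h kG(1) by (intro Bochner_Integration.integrable_add integrable_divide_zero Bochner_Integration.integrable_sum) auto
  have mm: "(\<lambda>(t, \<omega>). (1 / real N) * (\<Sum>i<N. ?l i t \<omega>) + ?h t \<omega>) \<in> borel_measurable (lborel \<Otimes>\<^sub>M M)"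
  proof -
    have "(\<lambda>(t, \<omega>). ?h t \<omega>) \<in> borel_measurable (lborel \<Otimes>\<^sub>M M)"
      using empirical_functional_measurable[OF N _ F(2), of "\<lambda>i (t, \<omega>). X i t \<omega>" "lborel \<Otimes>\<^sub>M M"] Xm
      by (simp add: case_prod_unfold)
    then show ?thesis using lm unfolding case_prod_unfold
      by (intro borel_measurable_add borel_measurable_times borel_measurable_sum borel_measurable_const) auto
  qed
  show Jm: "J \<in> borel_measurable M"
  proof -
    have "(\<lambda>(t, \<omega>). indicat_real {a..b} t *\<^sub>R ((1 / real N) * (\<Sum>i<N. ?l i t \<omega>) + ?h t \<omega>)) \<in> borel_measurable (lborel \<Otimes>\<^sub>M M)"
      using mm unfolding case_prod_unfold by (intro borel_measurable_scaleR indicator_fst_measurable)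
    from measurable_compose[OF measurable_pair_swap' this]
    have "(\<lambda>(\<omega>, t). indicat_real {a..b} t *\<^sub>R ((1 / real N) * (\<Sum>i<N. ?l i t \<omega>) + ?h t \<omega>)) \<in> borel_measurable (M \<Otimes>\<^sub>M lborel)"
      by (simp add: case_prod_unfold)
    from lborel.borel_measurable_lebesgue_integral[OF this]
    show ?thesis unfolding J_def set_lebesgue_integral_def
      by (intro borel_measurable_add borel_measurable_integrable[OF kG(1)])
  qed
  have "AE \<omega> in M. \<forall>i\<in>{..<N}. set_integrable lborel {a..b} (\<lambda>t. ?l i t \<omega>)"
    unfolding set_integrable_def by (rule AE_finite_allI) (use lM.AE_integrable_snd[OF li'] in auto)
  moreover have "AE \<omega> in M. set_integrable lborel {a..b} (\<lambda>t. ?h t \<omega>)"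
    unfolding set_integrable_def by (rule lM.AE_integrable_snd[OF hi'])
  \<comment> \<open>The time integral of the sum splits only for outcomes at which every summand is
    integrable in time; these have full probability.\<close>
  ultimately have JJ: "AE \<omega> in M. J \<omega> = ?J \<omega>"
  proof eventually_elim
    case (elim \<omega>)
    have si: "set_integrable lborel {a..b} (\<lambda>t. \<Sum>i<N. ?l i t \<omega>)"
      using elim(1) unfolding set_integrable_def scaleR_sum_right by (intro Bochner_Integration.integrable_sum) auto
    have "(\<integral>t\<in>{a..b}. (\<Sum>i<N. ?l i t \<omega>) \<partial>lborel) = (\<Sum>i<N. \<integral>t\<in>{a..b}. ?l i t \<omega> \<partial>lborel)"
      using elim(1) unfolding set_integrable_def set_lebesgue_integral_def scaleR_sum_right
      by (intro Bochner_Integration.integral_sum) auto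
    moreover have "(\<integral>t\<in>{a..b}. ((1 / real N) * (\<Sum>i<N. ?l i t \<omega>) + ?h t \<omega>) \<partial>lborel)
        = (1 / real N) * (\<integral>t\<in>{a..b}. (\<Sum>i<N. ?l i t \<omega>) \<partial>lborel) + (\<integral>t\<in>{a..b}. ?h t \<omega> \<partial>lborel)"
      using set_integral_add(2)[OF set_integrable_mult_right[OF si, of "1 / real N"] elim(2)] by simp
    ultimately show ?case unfolding J_def by simp
  qed
  have "(\<integral>\<omega>. J \<omega> \<partial>M) = (\<integral>\<omega>. ?J \<omega> \<partial>M)"
    by (rule integral_cong_AE[OF Jm borel_measurable_integrable[OF Jint] JJ])
  also have "\<dots> = (\<Sum>i<N. \<integral>\<omega>. (\<integral>t\<in>{a..b}. ?l i t \<omega> \<partial>lborel) \<partial>M) / real N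
      + (\<integral>\<omega>. (\<integral>t\<in>{a..b}. ?h t \<omega> \<partial>lborel) \<partial>M) + (\<integral>\<omega>. ?k \<omega> \<partial>M)"
  proof -
    have s: "integrable M (\<lambda>\<omega>. (\<Sum>i<N. \<integral>t\<in>{a..b}. ?l i t \<omega> \<partial>lborel) / real N)"
      by (intro integrable_divide_zero Bochner_Integration.integrable_sum) (simp add: int_l)
    have "(\<integral>\<omega>. (\<Sum>i<N. \<integral>t\<in>{a..b}. ?l i t \<omega> \<partial>lborel) \<partial>M) = (\<Sum>i<N. \<integral>\<omega>. (\<integral>t\<in>{a..b}. ?l i t \<omega> \<partial>lborel) \<partial>M)"
      by (rule Bochner_Integration.integral_sum) (simp add: int_l)
    then have "(\<integral>\<omega>. (\<Sum>i<N. \<integral>t\<in>{a..b}. ?l i t \<omega> \<partial>lborel) / real N \<partial>M) = (\<Sum>i<N. \<integral>\<omega>. (\<integral>t\<in>{a..b}. ?l i t \<omega> \<partial>lborel) \<partial>M) / real N"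
      by simp
    then show ?thesis
      using s int_h kG(1) by (simp only: Bochner_Integration.integral_add Bochner_Integration.integrable_add)
  qed
  finally have EJ: "(\<integral>\<omega>. J \<omega> \<partial>M) = \<dots>" .
  have Pl: "integrable paths (\<lambda>(t, i, \<omega>). ?l i t \<omega>)"
    "(\<integral>z. (case z of (t, i, \<omega>) \<Rightarrow> ?l i t \<omega>) \<partial>paths) = (\<Sum>i<N. \<integral>\<omega>. (\<integral>t\<in>{a..b}. ?l i t \<omega> \<partial>lborel) \<partial>M) / real N"
    by (rule paths_average[OF lm li]; assumption)+
  have pc: "(\<lambda>(t, i, \<omega>). ?l i t \<omega>) = (\<lambda>z. L (snd (position z)) (control z))"
    by (auto simp: position_def control_def fun_eq_iff)
  note fj = feedback_jensen[OF Q Pl(1)[unfolded pc]]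
  have gm: "(\<lambda>z. L (snd z) (feedback z)) \<in> borel_measurable space_time"
  proof -
    have "(\<lambda>z. (z, feedback z)) \<in> space_time \<rightarrow>\<^sub>M space_time \<Otimes>\<^sub>M borel"
      by (intro measurable_Pair feedback(1) measurable_ident_sets refl)
    from measurable_compose[OF this affine_sup_measurable[OF Q]] show ?thesis by simp
  qed
  note lI = law_integral[OF gm fj(1)]
  have sL: "set_integrable lborel {a..b} (\<lambda>t. \<integral>x. L x (feedback (t, x)) \<partial>law t)"
    using lI(1) unfolding set_integrable_def by (subst (asm) integrable_restrict_space) auto
  have "mean_field_cost b L F G a law (\<lambda>t x. feedback (t, x))
    = (\<integral>t\<in>{a..b}. (\<integral>x. L x (feedback (t, x)) \<partial>law t) \<partial>lborel) + (\<integral>t\<in>{a..b}. F (law t) \<partial>lborel) + G (law b)"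
    unfolding mean_field_cost_def using set_integral_add(2)[OF sL law_functional_integrable[OF F(2)]] by simp
  also have "\<dots> \<le> (\<Sum>i<N. \<integral>\<omega>. (\<integral>t\<in>{a..b}. ?l i t \<omega> \<partial>lborel) \<partial>M) / real N
      + (\<integral>\<omega>. (\<integral>t\<in>{a..b}. ?h t \<omega> \<partial>lborel) \<partial>M) + (\<integral>\<omega>. ?k \<omega> \<partial>M)"
  proof (intro add_mono fF(2) kG(2))
    show "(\<integral>t\<in>{a..b}. (\<integral>x. L x (feedback (t, x)) \<partial>law t) \<partial>lborel) \<le> (\<Sum>i<N. \<integral>\<omega>. (\<integral>t\<in>{a..b}. ?l i t \<omega> \<partial>lborel) \<partial>M) / real N"
      using lI(2) fj(2) Pl(2)[unfolded pc] by simp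
  qed
  finally show "mean_field_cost b L F G a law (\<lambda>t x. feedback (t, x)) \<le> (\<integral>\<omega>. J \<omega> \<partial>M)"
    unfolding EJ .
qed

end

text \<open>If one of the Bochner integrals is undefined, it is \<open>0\<close>, which is above the bound.\<close>

lemma mean_field_cost_bounded_below:
  assumes L: "C \<ge> 0" "\<And>x a. - C \<le> L x a" and F: "\<And>m. m \<in> torus_probs \<Longrightarrow> \<bar>F m\<bar> \<le> CF"
    and G: "\<And>m. m \<in> torus_probs \<Longrightarrow> \<bar>G m\<bar> \<le> CG"
    and t: "t0 \<le> T" and m: "\<forall>t\<in>{t0..T}. m t \<in> torus_probs"
  shows "- ((T - t0) * (C + \<bar>CF\<bar>) + CG) \<le> mean_field_cost T L F G t0 m \<alpha>"
proof -
  have 1: "- C \<le> (\<integral>x. L x (\<alpha> t x) \<partial>m t)" if "t \<in> {t0..T}" for t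
  proof (cases "integrable (m t) (\<lambda>x. L x (\<alpha> t x))")
    case True
    interpret prob_space "m t" using m that torus_probsD(1) by blast
    show ?thesis by (rule integral_ge_const[OF True]) (use L in auto)
  next
    case False
    then show ?thesis using L by (simp add: not_integrable_integral_eq)
  qed
  let ?k = "\<lambda>t. (\<integral>x. L x (\<alpha> t x) \<partial>m t) + F (m t)"
  have 2: "- (C + \<bar>CF\<bar>) \<le> ?k t" if "t \<in> {t0..T}" for t
    using 1[OF that] F[OF m[rule_format, OF that]] by linarith
  have "- ((T - t0) * (C + \<bar>CF\<bar>)) \<le> (\<integral>t\<in>{t0..T}. ?k t \<partial>lborel)"
  proof (cases "set_integrable lborel {t0..T} ?k")
    case True
    have "(\<integral>t\<in>{t0..T}. - (C + \<bar>CF\<bar>) \<partial>lborel) \<le> (\<integral>t\<in>{t0..T}. ?k t \<partial>lborel)"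
      by (rule set_integral_mono[OF set_integrable_const_Icc True 2])
    then show ?thesis unfolding set_integral_const_Icc[OF t] by (simp only: mult_minus_right)
  next
    case False
    have "0 \<le> (T - t0) * (C + \<bar>CF\<bar>)" using t L by (intro mult_nonneg_nonneg) auto
    then show ?thesis using False unfolding set_integrable_def set_lebesgue_integral_def
      by (simp add: not_integrable_integral_eq)
  qed
  moreover have "- CG \<le> G (m T)" using G[of "m T"] m t by force
  ultimately show ?thesis unfolding mean_field_cost_def by linarith
qed

text \<open>Every subset of a null set is an event by completeness of \<open>Filt 0\<close>, so
  altering a measurable function on a null set keeps it measurable. This transfers the cost from the
  lift to the original state.\<close>

lemma (in noise_basis) measurable_AE_eq:
  fixes f g :: "'w \<Rightarrow> real"
  assumes g: "g \<in> borel_measurable M" and fg: "AE \<omega> in M. f \<omega> = g \<omega>"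
  shows "f \<in> borel_measurable M"
proof -
  obtain Z where Z: "Z \<in> null_sets M" "\<And>\<omega>. \<omega> \<in> space M \<Longrightarrow> \<omega> \<notin> Z \<Longrightarrow> f \<omega> = g \<omega>"
    using fg unfolding eventually_ae_filter by blast
  have sub: "sets (Filt 0) \<subseteq> events" using subalg[of 0] T_pos by (simp add: subalgebra_def)
  show ?thesis
  proof (rule measurableI)
    fix A :: "real set" assume A: "A \<in> sets borel"
    have "f -` A \<inter> space M = (g -` A \<inter> space M - Z) \<union> (f -` A \<inter> space M \<inter> Z)"
    proof (rule set_eqI)
      fix \<omega>
      show "\<omega> \<in> f -` A \<inter> space M \<longleftrightarrow> \<omega> \<in> (g -` A \<inter> space M - Z) \<union> (f -` A \<inter> space M \<inter> Z)"
        using Z(2)[of \<omega>] by (cases "\<omega> \<in> Z"; cases "\<omega> \<in> space M") simp_all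
    qed
    moreover have "f -` A \<inter> space M \<inter> Z \<in> events"      using filt_complete[OF Z(1), of "f -` A \<inter> space M \<inter> Z"] sub Int_lower2 by (rule_tac subsetD) simp_all
    ultimately show "f -` A \<inter> space M \<in> events"
      using measurable_sets[OF g A] Z(1) by (metis null_setsD2 sets.Diff sets.Un)
  qed simp
qed

text \<open>The lifts of the individual particles are assembled into a
  \<open>particle_system\<close>, whose law and feedback are the competitor. Its cost bound returns
  to \<open>particle_cost\<close> because almost surely lift and state have the same torus positions
  at all times of the interval.\<close>

lemma (in noise_basis) value_comparison:
  fixes L H :: "'n torus \<Rightarrow> real ^ 'n \<Rightarrow> real"
  assumes L: "\<And>x. continuous_on UNIV (L x)" "\<And>x. convex_on UNIV (L x)" and H: "is_hamiltonian L H"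
    and H_C2: "cont_diff 2 (\<lambda>(y, p). H (to_torus y) p)"
    and C: "C \<ge> 0" "\<And>x a. - C \<le> L x a" "\<And>x a. L x a \<le> C * (1 + (norm a)\<^sup>2)"
    and F: "convex_on_probs F" "d1_lipschitz F" and G: "convex_on_probs G" "d1_lipschitz G"
    and N: "N \<ge> 1" and t0: "t0 \<in> {0..T}" and adm: "admissible_control M Filt T N t0 \<alpha>"
  shows "\<exists>m A. admissible_pair T t0 (empirical N x) m A \<and>
    mean_field_cost T L F G t0 m A \<le> particle_cost M T W L F G N t0 x \<alpha>"
proof -
  let ?a = "\<lambda>i r \<omega>. indicat_real {t0..T} r *\<^sub>R \<alpha> i r \<omega>"
  let ?B = "\<lambda>i s t \<omega>. W i t \<omega> - W i s \<omega>"
  let ?c = "3 * (real CARD('n))\<^sup>2"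
  let ?good = "\<lambda>i Y. drift_diffusion M t0 T ?c (?a i) Y (?B i) \<and>
    (AE \<omega> in M. \<forall>t\<in>{t0..T}. to_torus (Y t \<omega>) = state W t0 x \<alpha> i t \<omega>) \<and> (\<forall>\<omega>. to_torus (Y t0 \<omega>) = x i)"
  have "\<forall>i\<in>{..<N}. \<exists>Y. ?good i Y"
  proof
    fix i assume "i \<in> {..<N}"
    then have i: "i < N" by simp
    have "0 \<le> t0" "t0 \<le> T" using t0 by auto
    then obtain Y where
      "drift_diffusion M t0 T ?c (?a i) Y (?B i)"
      "AE \<omega> in M. \<forall>t\<in>{t0..T}. to_torus (Y t \<omega>) = state W t0 x \<alpha> i t \<omega>" "\<And>\<omega>. to_torus (Y t0 \<omega>) = x i"
      by (rule particle_lift[OF adm _ _ i, where x=x]) (rule that)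
    then have "?good i Y" by (intro conjI allI)
    then show "\<exists>Y. ?good i Y" by (rule exI[of "?good i" Y])
  qed
  then obtain Y0 where Y0: "\<forall>i\<in>{..<N}. ?good i (Y0 i)" by (rule bchoice[THEN exE])
  \<comment> \<open>The value 0 from \<open>N\<close> on supplies the measurability that
    \<open>particle_system\<close> asks of all indices.\<close>
  define Y where "Y i = (if i < N then Y0 i else (\<lambda>_ _. 0))" for i
  define a where "a i = (if i < N then ?a i else (\<lambda>_ _. 0))" for i
  have Y: "drift_diffusion M t0 T ?c (a i) (Y i) (?B i)"
    "AE \<omega> in M. \<forall>t\<in>{t0..T}. to_torus (Y i t \<omega>) = state W t0 x \<alpha> i t \<omega>"
    "\<And>\<omega>. to_torus (Y i t0 \<omega>) = x i" if "i < N" for i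
    using Y0 that by (simp_all add: Y_def a_def)
  interpret ps: particle_system M N t0 T ?c a Y ?B
  proof (intro particle_system.intro particle_system_axioms.intro prob_space_axioms)
    show "1 \<le> N" by (rule N)
    show "drift_diffusion M t0 T ?c (a i) (Y i) (?B i)" if "i < N" for i by (rule Y(1)[OF that])
    show "(\<lambda>(t, \<omega>). a i t \<omega>) \<in> borel_measurable (lborel \<Otimes>\<^sub>M M)" for i
    proof (cases "i < N")
      case True
      show ?thesis by (rule drift_diffusion.\<alpha>_meas[OF Y(1)[OF True]])
    qed (simp add: a_def)
    show "(\<lambda>(t, \<omega>). Y i t \<omega>) \<in> borel_measurable (lborel \<Otimes>\<^sub>M M)" for i
    proof (cases "i < N")
      case True
      show ?thesis by (rule drift_diffusion.Y_meas[OF Y(1)[OF True]])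
    qed (simp add: Y_def)
  qed
  let ?m = "ps.law" and ?A = "\<lambda>t x. ps.feedback (t, x)"
  have pair: "admissible_pair T t0 (empirical N x) ?m ?A"
    by (rule ps.feedback_admissible) (rule Y(3))
  let ?J = "\<lambda>\<omega>. (\<integral>t\<in>{t0..T}. ((1 / real N) * (\<Sum>i<N. L (to_torus (Y i t \<omega>)) (a i t \<omega>))
                 + F (empirical N (\<lambda>i. to_torus (Y i t \<omega>)))) \<partial>lborel) + G (empirical N (\<lambda>i. to_torus (Y i T \<omega>)))"
  note cost = ps.mean_field_cost_le[OF L H H_C2 C F G]
  let ?X = "state W t0 x \<alpha>"
  let ?K = "\<lambda>\<omega>. (\<integral>t\<in>{t0..T}. ((1 / real N) * (\<Sum>i<N. L (?X i t \<omega>) (\<alpha> i t \<omega>))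
                 + F (empirical N (\<lambda>i. ?X i t \<omega>))) \<partial>lborel) + G (empirical N (\<lambda>i. ?X i T \<omega>))"
  have emp: "empirical N f = empirical N g" if "\<And>i. i < N \<Longrightarrow> f i = g i" for f g :: "nat \<Rightarrow> 'n torus"
    unfolding empirical_def using that by (intro arg_cong[where f="measure_of _ _"] ext) simp
  have "AE \<omega> in M. \<forall>i\<in>{..<N}. \<forall>t\<in>{t0..T}. to_torus (Y i t \<omega>) = ?X i t \<omega>"
    by (rule AE_finite_allI) (use Y(2) in auto)
  then have KJ: "AE \<omega> in M. ?K \<omega> = ?J \<omega>"
  proof eventually_elim
    case (elim \<omega>)
    have "(\<integral>t\<in>{t0..T}. ((1 / real N) * (\<Sum>i<N. L (?X i t \<omega>) (\<alpha> i t \<omega>)) + F (empirical N (\<lambda>i. ?X i t \<omega>))) \<partial>lborel)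
      = (\<integral>t\<in>{t0..T}. ((1 / real N) * (\<Sum>i<N. L (to_torus (Y i t \<omega>)) (a i t \<omega>))
                 + F (empirical N (\<lambda>i. to_torus (Y i t \<omega>)))) \<partial>lborel)"
    proof (rule set_lebesgue_integral_cong)
      show "\<forall>t. t \<in> {t0..T} \<longrightarrow> (1 / real N) * (\<Sum>i<N. L (?X i t \<omega>) (\<alpha> i t \<omega>)) + F (empirical N (\<lambda>i. ?X i t \<omega>))
        = (1 / real N) * (\<Sum>i<N. L (to_torus (Y i t \<omega>)) (a i t \<omega>)) + F (empirical N (\<lambda>i. to_torus (Y i t \<omega>)))"
      proof (intro allI impI)
        fix t assume t: "t \<in> {t0..T}"
        have "empirical N (\<lambda>i. ?X i t \<omega>) = empirical N (\<lambda>i. to_torus (Y i t \<omega>))"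
          using elim t by (intro emp) simp
        moreover have "(\<Sum>i<N. L (?X i t \<omega>) (\<alpha> i t \<omega>)) = (\<Sum>i<N. L (to_torus (Y i t \<omega>)) (a i t \<omega>))"
          using elim t by (intro sum.cong) (simp_all add: a_def)
        ultimately show "(1 / real N) * (\<Sum>i<N. L (?X i t \<omega>) (\<alpha> i t \<omega>)) + F (empirical N (\<lambda>i. ?X i t \<omega>))
          = (1 / real N) * (\<Sum>i<N. L (to_torus (Y i t \<omega>)) (a i t \<omega>)) + F (empirical N (\<lambda>i. to_torus (Y i t \<omega>)))" by simp
      qed
    qed simp
    moreover have "empirical N (\<lambda>i. ?X i T \<omega>) = empirical N (\<lambda>i. to_torus (Y i T \<omega>))"
      using elim t0 by (intro emp) simp
    ultimately show ?case by simp
  qed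
  have "(\<integral>\<omega>. ?K \<omega> \<partial>M) = (\<integral>\<omega>. ?J \<omega> \<partial>M)"
    by (rule integral_cong_AE[OF measurable_AE_eq[OF cost(1) KJ] cost(1) KJ])
  then have "mean_field_cost T L F G t0 ?m ?A \<le> particle_cost M T W L F G N t0 x \<alpha>"
    using cost(2) by (simp add: particle_cost_def Let_def)
  then show ?thesis using pair by blast
qed

theorem lemma7p1:
  fixes M :: "'w measure"
    and T C0 :: real
    and Filt :: "real \<Rightarrow> 'w measure"
    and W0 :: "real \<Rightarrow> 'w \<Rightarrow> real ^ 'n"
    and W :: "nat \<Rightarrow> real \<Rightarrow> 'w \<Rightarrow> real ^ 'n"
    and L H :: "'n torus \<Rightarrow> real ^ 'n \<Rightarrow> real"
    and F G :: "'n torus measure \<Rightarrow> real"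
  assumes basis: "noise_basis M T Filt W0 W"
    and L_cont: "\<And>x. continuous_on UNIV (L x)"
    and L_convex: "\<And>x. convex_on UNIV (L x)"
    and H: "is_hamiltonian L H"
    and F_convex: "convex_on_probs F" and F_lip: "d1_lipschitz F"
    and G_convex: "convex_on_probs G" and G_lip: "d1_lipschitz G"
    and H_C2: "cont_diff 2 (\<lambda>(y, p). H (to_torus y) p)"
    and C0: "C0 \<ge> 1"
    and H_pp: "\<And>x p v. 1 / C0 * (v \<bullet> v) \<le> hessian_form (H x) p v v \<and>
                        hessian_form (H x) p v v \<le> C0 * (v \<bullet> v)"
    and H_x: "\<And>x p. norm (torus_gradient (\<lambda>y. H y p) x) \<le> C0 * (1 + norm p)"
  shows "\<forall>N\<ge>1. \<forall>t\<in>{0..T}. \<forall>x :: nat \<Rightarrow> 'n torus.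
           U_value T L F G t (empirical N x) \<le> V_value M Filt T W L F G N t x"
proof (intro allI impI ballI)
  fix N :: nat and t and x :: "nat \<Rightarrow> 'n torus"
  assume N: "1 \<le> N" and t: "t \<in> {0..T}"
  interpret noise_basis M T Filt W0 W by (rule basis)
  have C0': "0 < C0" using C0 by simp
  obtain C where C: "C \<ge> 0" "\<And>x a. - C \<le> L x a" "\<And>x a. L x a \<le> C * (1 + (norm a)\<^sup>2)"
    using lagrangian_growth[OF L_cont L_convex H H_C2 C0'] H_pp by blast
  obtain CF where CF: "CF \<ge> 0" "\<And>m. m \<in> torus_probs \<Longrightarrow> \<bar>F m\<bar> \<le> CF" using d1_lipschitz_bounded[OF F_lip] by blast
  obtain CG where CG: "CG \<ge> 0" "\<And>m. m \<in> torus_probs \<Longrightarrow> \<bar>G m\<bar> \<le> CG" using d1_lipschitz_bounded[OF G_lip] by blast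
  let ?P = "{(m, \<alpha>). admissible_pair T t (empirical N x) m \<alpha>}"
  let ?c = "\<lambda>(m, \<alpha>). mean_field_cost T L F G t m \<alpha>"
  \<comment> \<open>The lower bound on \<open>L\<close> and the boundedness of \<open>F\<close> and
    \<open>G\<close> make the mean field costs bounded below, so that the real infimum
    \<open>U_value\<close> lies below each admissible cost.\<close>
  have bdd: "bdd_below (?c ` ?P)"
  proof (rule bdd_belowI)
    fix y assume "y \<in> ?c ` ?P"
    then obtain m \<alpha> where y: "y = mean_field_cost T L F G t m \<alpha>" and "admissible_pair T t (empirical N x) m \<alpha>" by auto
    then have "\<forall>s\<in>{t..T}. m s \<in> torus_probs" by (simp add: admissible_pair_def)
    then show "- ((T - t) * (C + \<bar>CF\<bar>) + CG) \<le> y"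
      unfolding y using t by (intro mean_field_cost_bounded_below C CF CG) auto
  qed
  show "U_value T L F G t (empirical N x) \<le> V_value M Filt T W L F G N t x"
    unfolding V_value_def
  proof (rule cINF_greatest)
    \<comment> \<open>The zero control shows that the infimum defining \<open>V_value\<close> is
      over a nonempty set.\<close>
    have "admissible_control M Filt T N t (\<lambda>_ _ _. 0 :: real ^ 'n)"
      unfolding admissible_control_def by (auto simp: case_prod_unfold)
    then show "{\<alpha> :: nat \<Rightarrow> real \<Rightarrow> 'w \<Rightarrow> real ^ 'n. admissible_control M Filt T N t \<alpha>} \<noteq> {}" by blast
    fix \<alpha> :: "nat \<Rightarrow> real \<Rightarrow> 'w \<Rightarrow> real ^ 'n" assume "\<alpha> \<in> {\<alpha>. admissible_control M Filt T N t \<alpha>}"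
    then obtain m A where mA: "admissible_pair T t (empirical N x) m A"
      "mean_field_cost T L F G t m A \<le> particle_cost M T W L F G N t x \<alpha>"
      using value_comparison[OF L_cont L_convex H H_C2 C F_convex F_lip G_convex G_lip N t] by blast
    have "U_value T L F G t (empirical N x) \<le> ?c (m, A)"
      unfolding U_value_def by (rule cINF_lower[OF bdd]) (use mA in simp)
    then show "U_value T L F G t (empirical N x) \<le> particle_cost M T W L F G N t x \<alpha>" using mA by simp
  qed
qed

end
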